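(* Let $M$ be a $(2n+1)$-dimensional smooth manifold with a contact structure $\xi$. There exists a non-degenerate skew-symmetric invariant bilinear map $$\mathcal{B}:\mathrm{TVect}(M)\wedge \mathrm{TVect}(M)\to \mathrm{CVect}(M),$$ where the $\wedge$-product is defined over $C^\infty(M)$.
   Context: A contact structure $\xi$ on a $(2n+1)$-dimensional smooth manifold $M$ ($n\ge 1$) is a codimension 1 distribution which is completely non-integrable: locally $\xi=\ker\alpha$ for a real 1-form $\alpha$ (a contact form, defined up to multiplication by a nonvanishing function) with $\alpha\wedge(d\alpha)^n\neq 0$ everywhere. All vector fields and functions are smooth with complex coefficients; $C^\infty(M)$ denotes complex-valued smooth functions. $\mathrm{CVect}(M)$ is the Lie algebra of contact vector fields, i.e. of vector fields $X$ with $L_X\alpha=f_X\alpha$ for some function $f_X$, for every (local) contact form $\alpha$. $\mathrm{TVect}(M)$ is the space of vector fields tangent to $\xi$ (i.e. $\alpha(X)=0$ for every local contact form). Both are $\mathrm{CVect}(M)$-modules under the Lie bracket. That the $\wedge$-product is over $C^\infty(M)$ means that $\mathcal{B}$ is defined on the exterior square of $\mathrm{TVect}(M)$ as a $C^\infty(M)$-module; in particular $\mathcal{B}(fX,Y)=\mathcal{B}(X,fY)$ for $f\in C^\infty(M)$. Invariant means invariant under the action of $\mathrm{CVect}(M)$: $[V,\mathcal{B}(X,Y)]=\mathcal{B}([V,X],Y)+\mathcal{B}(X,[V,Y])$ for all $V\in\mathrm{CVect}(M)$ and $X,Y\in\mathrm{TVect}(M)$. Non-degenerate means that for every $X\in\mathrm{TVect}(M)$,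 $X\neq 0$, there is $Y\in\mathrm{TVect}(M)$ with $\mathcal{B}(X,Y)\neq 0$. *)

theory Defs
  imports "HOL-Analysis.Analysis" "HOL-Combinatorics.Permutations"
begin

section \<open>Smooth maps between open subsets of normed spaces\<close>

text \<open>The predicates are meant for open sets only; \<open>frechet_derivative f (at x)\<close> then depends
  only on the values of \<open>f\<close> near \<open>x\<close>.\<close>

primrec higher_differentiable_on ::
  "'a::real_normed_vector set \<Rightarrow> ('a \<Rightarrow> 'b::real_normed_vector) \<Rightarrow> nat \<Rightarrow> bool" where
  "higher_differentiable_on S f 0 \<longleftrightarrow> continuous_on S f"
| "higher_differentiable_on S f (Suc k) \<longleftrightarrow>
     (\<forall>x\<in>S. f differentiable (at x)) \<and>
     (\<forall>v. higher_differentiable_on S (\<lambda>x. frechet_derivative f (at x) v) k)"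

definition smooth_on ::
  "'a::real_normed_vector set \<Rightarrow> ('a \<Rightarrow> 'b::real_normed_vector) \<Rightarrow> bool" where
  "smooth_on S f \<longleftrightarrow> (\<forall>k. higher_differentiable_on S f k)"

definition pderiv_at ::
  "'k::finite \<Rightarrow> (real^'k \<Rightarrow> 'b::real_normed_vector) \<Rightarrow> real^'k \<Rightarrow> 'b" where
  "pderiv_at i f x = frechet_derivative f (at x) (axis i 1)"


section \<open>Smooth manifolds\<close>

text \<open>The manifold is the whole type \<open>'m\<close>, with the topology of its type class; its smooth
  structure is given by an atlas. A chart is a pair of a domain and a map, only the values of the
  map on the domain being relevant.\<close>

type_synonym ('m, 'k) chart = "'m set \<times> ('m \<Rightarrow> real^'k)"

abbreviation cdom :: "('m, 'k::finite) chart \<Rightarrow> 'm set" where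
  "cdom c \<equiv> fst c"

abbreviation cmap :: "('m, 'k::finite) chart \<Rightarrow> 'm \<Rightarrow> real^'k" where
  "cmap c \<equiv> snd c"

definition cinv :: "('m, 'k::finite) chart \<Rightarrow> real^'k \<Rightarrow> 'm" where
  "cinv c = inv_into (cdom c) (cmap c)"

definition is_chart :: "('m::topological_space, 'k::finite) chart \<Rightarrow> bool" where
  "is_chart c \<longleftrightarrow> open (cdom c) \<and> open (cmap c ` cdom c) \<and>
     homeomorphism (cdom c) (cmap c ` cdom c) (cmap c) (cinv c)"

definition transition ::
  "('m, 'k::finite) chart \<Rightarrow> ('m, 'k) chart \<Rightarrow> real^'k \<Rightarrow> real^'k" where
  "transition c c' x = cmap c' (cinv c x)"

definition smooth_atlas :: "('m::topological_space, 'k::finite) chart set \<Rightarrow> bool" where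
  "smooth_atlas A \<longleftrightarrow>
     (\<forall>c\<in>A. is_chart c) \<and> (\<Union>c\<in>A. cdom c) = UNIV \<and>
     (\<forall>c\<in>A. \<forall>c'\<in>A. smooth_on (cmap c ` (cdom c \<inter> cdom c')) (transition c c'))"

definition charts_at :: "('m, 'k::finite) chart set \<Rightarrow> 'm \<Rightarrow> ('m, 'k) chart set" where
  "charts_at A p = {c \<in> A. p \<in> cdom c}"

text \<open>Entry \<open>i\<close>, \<open>j\<close> is the partial derivative of the \<open>i\<close>-th coordinate of \<open>c'\<close>
  with respect to the \<open>j\<close>-th coordinate of \<open>c\<close>.\<close>

definition jac ::
  "('m, 'k::finite) chart \<Rightarrow> ('m, 'k) chart \<Rightarrow> 'm \<Rightarrow> real^'k^'k" where
  "jac c c' p = (\<chi> i j. pderiv_at j (transition c c') (cmap c p) $ i)"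

definition smooth_fun_on ::
  "('m, 'k::finite) chart set \<Rightarrow> 'm set \<Rightarrow> ('m \<Rightarrow> complex) \<Rightarrow> bool" where
  "smooth_fun_on A W f \<longleftrightarrow>
     (\<forall>c\<in>A. smooth_on (cmap c ` (cdom c \<inter> W)) (\<lambda>x. f (cinv c x)))"


section \<open>Tangent vectors, vector fields, 1-forms\<close>

text \<open>A tangent vector at \<open>p\<close> is the family of its coordinate vectors in the charts around \<open>p\<close>,
  subject to the usual transformation rule; it is set to 0 at all other indices, so that equality
  of functions is equality of tangent vectors. With \<open>'f = real\<close> this is the tangent space, with
  \<open>'f = complex\<close> its complexification. Covectors are treated in the same way.\<close>

definition tangent_space ::
  "('m, 'k::finite) chart set \<Rightarrow> 'm \<Rightarrow> (('m, 'k) chart \<Rightarrow> 'f::real_vector^'k) set" where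
  "tangent_space A p =
     {v. (\<forall>c\<in>charts_at A p. \<forall>c'\<in>charts_at A p. \<forall>i.
            v c' $ i = (\<Sum>j\<in>UNIV. jac c c' p $ i $ j *\<^sub>R v c $ j)) \<and>
         (\<forall>c. c \<notin> charts_at A p \<longrightarrow> v c = 0)}"

definition cotangent_space ::
  "('m, 'k::finite) chart set \<Rightarrow> 'm \<Rightarrow> (('m, 'k) chart \<Rightarrow> real^'k) set" where
  "cotangent_space A p =
     {a. (\<forall>c\<in>charts_at A p. \<forall>c'\<in>charts_at A p. \<forall>j.
            a c $ j = (\<Sum>i\<in>UNIV. jac c c' p $ i $ j * a c' $ i)) \<and>
         (\<forall>c. c \<notin> charts_at A p \<longrightarrow> a c = 0)}"

definition local_rep ::
  "('m, 'k::finite) chart \<Rightarrow> ('m \<Rightarrow> ('m, 'k) chart \<Rightarrow> 'b) \<Rightarrow> real^'k \<Rightarrow> 'b" where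
  "local_rep c T x = T (cinv c x) c"

type_synonym ('m, 'k) vfield = "'m \<Rightarrow> ('m, 'k) chart \<Rightarrow> complex^'k"
type_synonym ('m, 'k) rform = "'m \<Rightarrow> ('m, 'k) chart \<Rightarrow> real^'k"

definition Vect :: "('m, 'k::finite) chart set \<Rightarrow> ('m, 'k) vfield set" where
  "Vect A = {X. (\<forall>p. X p \<in> tangent_space A p) \<and>
                (\<forall>c\<in>A. smooth_on (cmap c ` cdom c) (local_rep c X))}"

definition vf_zero :: "('m, 'k::finite) vfield" where
  "vf_zero = (\<lambda>p c. 0)"

definition vf_add ::
  "('m, 'k::finite) vfield \<Rightarrow> ('m, 'k) vfield \<Rightarrow> ('m, 'k) vfield" where
  "vf_add X Y = (\<lambda>p c. X p c + Y p c)"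

definition vf_minus :: "('m, 'k::finite) vfield \<Rightarrow> ('m, 'k) vfield" where
  "vf_minus X = (\<lambda>p c. - X p c)"

definition vf_mult ::
  "('m \<Rightarrow> complex) \<Rightarrow> ('m, 'k::finite) vfield \<Rightarrow> ('m, 'k) vfield" where
  "vf_mult f X = (\<lambda>p c. f p *s X p c)"

definition bracket ::
  "('m, 'k::finite) chart set \<Rightarrow> ('m, 'k) vfield \<Rightarrow> ('m, 'k) vfield \<Rightarrow> ('m, 'k) vfield" where
  "bracket A X Y = (\<lambda>p c. if c \<in> charts_at A p then
       (\<chi> j. \<Sum>i\<in>UNIV. X p c $ i * pderiv_at i (local_rep c Y) (cmap c p) $ j
                       - Y p c $ i * pderiv_at i (local_rep c X) (cmap c p) $ j)
     else 0)"

text \<open>Real 1-forms on the open set \<open>W\<close>; the values outside \<open>W\<close> are irrelevant.\<close>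

definition one_form_on ::
  "('m::topological_space, 'k::finite) chart set \<Rightarrow> 'm set \<Rightarrow> ('m, 'k) rform \<Rightarrow> bool" where
  "one_form_on A W \<alpha> \<longleftrightarrow> open W \<and> (\<forall>p\<in>W. \<alpha> p \<in> cotangent_space A p) \<and>
     (\<forall>c\<in>A. smooth_on (cmap c ` (cdom c \<inter> W)) (local_rep c \<alpha>))"

definition covec_app :: "real^'k::finite \<Rightarrow> 'f::real_vector^'k \<Rightarrow> 'f" where
  "covec_app a v = (\<Sum>i\<in>UNIV. a $ i *\<^sub>R v $ i)"

text \<open>The 2-form \<open>d\<alpha>\<close> at \<open>p\<close>, evaluated on two vectors with coordinates \<open>u\<close>, \<open>w\<close> in the
  chart \<open>c\<close>.\<close>

definition ext_deriv ::
  "('m, 'k::finite) chart \<Rightarrow> ('m, 'k) rform \<Rightarrow> 'm \<Rightarrow> real^'k \<Rightarrow> real^'k \<Rightarrow> real" where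
  "ext_deriv c \<alpha> p u w = (\<Sum>i\<in>UNIV. \<Sum>j\<in>UNIV.
     (pderiv_at i (local_rep c \<alpha>) (cmap c p) $ j - pderiv_at j (local_rep c \<alpha>) (cmap c p) $ i)
       * u $ i * w $ j)"

text \<open>The value on \<open>v 0, \<dots>, v (2 * n)\<close> of the exterior product \<open>a \<and> D \<and> \<dots> \<and> D\<close> of a
  covector \<open>a\<close> with \<open>n\<close> copies of an alternating bilinear form \<open>D\<close>. The factor \<open>1 / 2 ^ n\<close>
  is the product of the \<open>1 / (deg!)\<close> in the convention
  \<open>(\<omega>\<^sub>1 \<and> \<dots> \<and> \<omega>\<^sub>r) (v) =
    (\<Prod> 1 / (deg \<omega>\<^sub>i)!) * (\<Sum>\<sigma>. sign \<sigma> * (\<omega>\<^sub>1 \<otimes> \<dots> \<otimes> \<omega>\<^sub>r) (v \<circ> \<sigma>))\<close>.\<close>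

definition wedge_power ::
  "nat \<Rightarrow> real^'k::finite \<Rightarrow> (real^'k \<Rightarrow> real^'k \<Rightarrow> real) \<Rightarrow> (nat \<Rightarrow> real^'k) \<Rightarrow> real" where
  "wedge_power n a D v = (1 / 2 ^ n) *
     (\<Sum>\<sigma> | \<sigma> permutes {..2 * n}. of_int (sign \<sigma>) * covec_app a (v (\<sigma> 0)) *
        (\<Prod>i<n. D (v (\<sigma> (2 * i + 1))) (v (\<sigma> (2 * i + 2)))))"

text \<open>Coordinates in the chart \<open>c\<close> of the Lie derivative of \<open>\<alpha>\<close> along \<open>X\<close> at \<open>p\<close>.\<close>

definition lie_deriv_form ::
  "('m, 'k::finite) chart \<Rightarrow> ('m, 'k) vfield \<Rightarrow> ('m, 'k) rform \<Rightarrow> 'm \<Rightarrow> complex^'k" where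
  "lie_deriv_form c X \<alpha> p = (\<chi> j. \<Sum>i\<in>UNIV.
       X p c $ i * of_real (pderiv_at i (local_rep c \<alpha>) (cmap c p) $ j)
     + of_real (\<alpha> p c $ i) * pderiv_at j (local_rep c X) (cmap c p) $ i)"


section \<open>Contact structures\<close>

type_synonym ('m, 'k) distrib = "'m \<Rightarrow> (('m, 'k) chart \<Rightarrow> real^'k) set"

definition contact_form ::
  "('m::topological_space, 'k::finite) chart set \<Rightarrow> nat \<Rightarrow> ('m, 'k) distrib \<Rightarrow>
   'm set \<Rightarrow> ('m, 'k) rform \<Rightarrow> bool" where
  "contact_form A n \<xi> W \<alpha> \<longleftrightarrow> one_form_on A W \<alpha> \<and>
     (\<forall>p\<in>W. \<xi> p = {v \<in> tangent_space A p. \<forall>c\<in>charts_at A p. covec_app (\<alpha> p c) (v c) = 0}) \<and>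
     (\<forall>p\<in>W. \<forall>c\<in>charts_at A p. \<exists>v. wedge_power n (\<alpha> p c) (ext_deriv c \<alpha> p) v \<noteq> 0)"

text \<open>A contact form vanishes nowhere, so that its kernel is a hyperplane at every point; hence
  the codimension of \<open>\<xi>\<close> need not be required separately.\<close>

definition contact_structure ::
  "('m::topological_space, 'k::finite) chart set \<Rightarrow> nat \<Rightarrow> ('m, 'k) distrib \<Rightarrow> bool" where
  "contact_structure A n \<xi> \<longleftrightarrow> (\<forall>p. \<exists>W \<alpha>. p \<in> W \<and> contact_form A n \<xi> W \<alpha>)"

definition CVect ::
  "('m::topological_space, 'k::finite) chart set \<Rightarrow> nat \<Rightarrow> ('m, 'k) distrib \<Rightarrow>
   ('m, 'k) vfield set" where
  "CVect A n \<xi> = {X \<in> Vect A. \<forall>W \<alpha>. contact_form A n \<xi> W \<alpha> \<longrightarrow>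
     (\<exists>f. smooth_fun_on A W f \<and>
       (\<forall>p\<in>W. \<forall>c\<in>charts_at A p. \<forall>j.
          lie_deriv_form c X \<alpha> p $ j = f p * of_real (\<alpha> p c $ j)))}"

definition TVect ::
  "('m::topological_space, 'k::finite) chart set \<Rightarrow> nat \<Rightarrow> ('m, 'k) distrib \<Rightarrow>
   ('m, 'k) vfield set" where
  "TVect A n \<xi> = {X \<in> Vect A. \<forall>W \<alpha>. contact_form A n \<xi> W \<alpha> \<longrightarrow>
     (\<forall>p\<in>W. \<forall>c\<in>charts_at A p. covec_app (\<alpha> p c) (X p c) = 0)}"


section \<open>Bilinear maps on tangent vector fields\<close>

text \<open>In the following definitions \<open>T\<close> is a space of vector fields and \<open>B\<close> is considered on
  \<open>T \<times> T\<close> only.\<close>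

definition vf_bilinear_on ::
  "('m, 'k::finite) vfield set \<Rightarrow>
   (('m, 'k) vfield \<Rightarrow> ('m, 'k) vfield \<Rightarrow> ('m, 'k) vfield) \<Rightarrow> bool" where
  "vf_bilinear_on T B \<longleftrightarrow>
     (\<forall>X\<in>T. \<forall>X'\<in>T. \<forall>Y\<in>T. B (vf_add X X') Y = vf_add (B X Y) (B X' Y)) \<and>
     (\<forall>X\<in>T. \<forall>Y\<in>T. \<forall>Y'\<in>T. B X (vf_add Y Y') = vf_add (B X Y) (B X Y')) \<and>
     (\<forall>a. \<forall>X\<in>T. \<forall>Y\<in>T. B (vf_mult (\<lambda>_. a) X) Y = vf_mult (\<lambda>_. a) (B X Y)) \<and>
     (\<forall>a. \<forall>X\<in>T. \<forall>Y\<in>T. B X (vf_mult (\<lambda>_. a) Y) = vf_mult (\<lambda>_. a) (B X Y))"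

definition vf_skew_on ::
  "('m, 'k::finite) vfield set \<Rightarrow>
   (('m, 'k) vfield \<Rightarrow> ('m, 'k) vfield \<Rightarrow> ('m, 'k) vfield) \<Rightarrow> bool" where
  "vf_skew_on T B \<longleftrightarrow> (\<forall>X\<in>T. \<forall>Y\<in>T. B X Y = vf_minus (B Y X))"

text \<open>Together with \<open>\<complex>\<close>-bilinearity and skew-symmetry, this says that \<open>B\<close> factors through the
  exterior square of \<open>T\<close> over the smooth functions. No compatibility of the values of \<open>B\<close> with
  multiplication by functions is meant (contact vector fields do not form a module over them).\<close>

definition vf_balanced_on ::
  "('m, 'k::finite) chart set \<Rightarrow> ('m, 'k) vfield set \<Rightarrow>
   (('m, 'k) vfield \<Rightarrow> ('m, 'k) vfield \<Rightarrow> ('m, 'k) vfield) \<Rightarrow> bool" where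
  "vf_balanced_on A T B \<longleftrightarrow>
     (\<forall>f. smooth_fun_on A UNIV f \<longrightarrow>
        (\<forall>X\<in>T. \<forall>Y\<in>T. B (vf_mult f X) Y = B X (vf_mult f Y)))"

definition vf_invariant_on ::
  "('m, 'k::finite) chart set \<Rightarrow> ('m, 'k) vfield set \<Rightarrow> ('m, 'k) vfield set \<Rightarrow>
   (('m, 'k) vfield \<Rightarrow> ('m, 'k) vfield \<Rightarrow> ('m, 'k) vfield) \<Rightarrow> bool" where
  "vf_invariant_on A C T B \<longleftrightarrow>
     (\<forall>V\<in>C. \<forall>X\<in>T. \<forall>Y\<in>T.
        bracket A V (B X Y) = vf_add (B (bracket A V X) Y) (B X (bracket A V Y)))"

definition vf_nondegenerate_on ::
  "('m, 'k::finite) vfield set \<Rightarrow>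
   (('m, 'k) vfield \<Rightarrow> ('m, 'k) vfield \<Rightarrow> ('m, 'k) vfield) \<Rightarrow> bool" where
  "vf_nondegenerate_on T B \<longleftrightarrow>
     (\<forall>X\<in>T. X \<noteq> vf_zero \<longrightarrow> (\<exists>Y\<in>T. B X Y \<noteq> vf_zero))"

end

theory Submission
  imports Defs
begin

text \<open>Every vector field is uniquely the sum of a contact vector field and of one tangent to \<open>\<xi>\<close>;
  \<open>B X Y\<close> is the contact part of \<open>[X, Y]\<close>. It is balanced because \<open>[f X, Y] - [X, f Y]\<close> is tangent
  to \<open>\<xi>\<close>. The fields tangent to \<open>\<xi>\<close> span \<open>\<xi>\<close> at every point (bump functions), hence a vector field is
  contact iff its bracket with every tangent field is tangent; so both summands are stable under brackets with
  contact fields, and invariance is the Jacobi identity. Uniqueness of the decomposition and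
  nondegeneracy follow from \<open>\<alpha>([X, Y]) = - d\<alpha>(X, Y)\<close> for tangent \<open>X\<close>, \<open>Y\<close> and the
  nondegeneracy of \<open>d\<alpha>\<close> on \<open>ker \<alpha>\<close>. The tangent part of a field solves a linear system
  at each point, and is smooth by Cramer's rule; it does not depend on the chart, as it is characterised
  by brackets alone.\<close>

section \<open>Calculus of smooth maps\<close>

text \<open>A contact form exists only locally and is fixed only up to a factor, so neither a Reeb
  field nor a Hamiltonian is available on all of the manifold. The splitting into contact and
  tangent fields replaces them: modulo \<open>TVect\<close> a vector field is a section of the line
  bundle \<open>TM / \<xi>\<close>, and the splitting says that each such section comes from exactly
  one contact field. In terms of a local form, \<open>B X Y\<close> is the contact field whose
  Hamiltonian is \<open>\<alpha>([X, Y]) = - d\<alpha>(X, Y)\<close>. This value is linear over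
  functions in both arguments, while the contact field with Hamiltonian \<open>h\<close> also
  involves \<open>dh\<close>; this is why \<open>B\<close> is balanced without being linear over
  functions. Reading contact fields as the stabiliser of \<open>TVect\<close> makes their closure
  under sums, scalars and brackets formal; the price is to recover from stability a smooth factor
  \<open>f\<close> with \<open>L_V \<alpha> = f \<alpha>\<close>. The contact data are real but the
  fields are complex, so nondegeneracy of \<open>d\<alpha>\<close> has to be carried to complex
  vectors before it can be used.\<close>

lemma frechet_derivative_eq:
  "(f has_derivative f') (at x) \<Longrightarrow> frechet_derivative f (at x) = f'"
  using frechet_derivative_at by metis

lemma higher_differentiable_on_cong:
  assumes "open S" "\<And>x. x \<in> S \<Longrightarrow> f x = g x" "higher_differentiable_on S f k"
  shows "higher_differentiable_on S g k"
  using assms(2,3)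
proof (induction k arbitrary: f g)
  case 0
  then show ?case by (simp cong: continuous_on_cong_simp)
next
  case (Suc k)
  have fd: "f differentiable (at x)" if "x \<in> S" for x using Suc.prems(2) that by simp
  have gd: "(g has_derivative frechet_derivative f (at x)) (at x)" if "x \<in> S" for x
    using fd[OF that] Suc.prems(1) assms(1) that
    by (metis frechet_derivative_works has_derivative_transform_within_open)
  have "higher_differentiable_on S (\<lambda>x. frechet_derivative g (at x) v) k" for v
    by (rule Suc.IH[where f="\<lambda>x. frechet_derivative f (at x) v"])
       (use Suc.prems(2) in \<open>simp_all add: frechet_derivative_eq[OF gd]\<close>)
  moreover have "g differentiable (at x)" if "x \<in> S" for x
    using gd[OF that] differentiable_def by blast
  ultimately show ?case by simp
qed

lemma higher_differentiable_on_SucI: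
  assumes "open S" "\<And>x. x \<in> S \<Longrightarrow> (f has_derivative f' x) (at x)"
    and "\<And>v. higher_differentiable_on S (\<lambda>x. f' x v) k"
  shows "higher_differentiable_on S f (Suc k)"
proof -
  have "higher_differentiable_on S (\<lambda>x. frechet_derivative f (at x) v) k" for v
    by (rule higher_differentiable_on_cong[OF assms(1) _ assms(3)[of v]])
       (simp add: frechet_derivative_eq[OF assms(2)])
  then show ?thesis using assms(2) unfolding higher_differentiable_on.simps differentiable_def by blast
qed

lemma higher_differentiable_on_imp_continuous_on:
  assumes "higher_differentiable_on S f k"
  shows "continuous_on S f"
proof (cases k)
  case 0
  with assms show ?thesis by simp
next
  case (Suc l)
  with assms have "\<forall>x\<in>S. isCont f x"
    using differentiable_imp_continuous_within by auto
  then show ?thesis by (rule continuous_at_imp_continuous_on)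
qed

lemma higher_differentiable_on_SucD:
  "higher_differentiable_on S f (Suc k) \<Longrightarrow> higher_differentiable_on S f k"
proof (induction k arbitrary: f)
  case 0
  from higher_differentiable_on_imp_continuous_on[OF 0] show ?case by simp
next
  case (Suc k)
  then show ?case by (metis higher_differentiable_on.simps(2))
qed

lemma higher_differentiable_on_Suc_has_derivative:
  "higher_differentiable_on S f (Suc k) \<Longrightarrow> x \<in> S \<Longrightarrow>
    (f has_derivative frechet_derivative f (at x)) (at x)"
  using frechet_derivative_works by auto

lemma higher_differentiable_on_subset:
  "higher_differentiable_on S f k \<Longrightarrow> T \<subseteq> S \<Longrightarrow> higher_differentiable_on T f k"
  by (induction k arbitrary: f) (auto intro: continuous_on_subset)

lemma higher_differentiable_on_local:
  assumes "\<And>x. x \<in> S \<Longrightarrow> \<exists>T. open T \<and> x \<in> T \<and> higher_differentiable_on T f k"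
  shows "higher_differentiable_on S f k"
  using assms
proof (induction k arbitrary: f)
  case 0
  then show ?case
    by (metis continuous_at_imp_continuous_on continuous_on_eq_continuous_at higher_differentiable_on.simps(1))
next
  case (Suc k)
  have "\<exists>T. open T \<and> x \<in> T \<and> higher_differentiable_on T (\<lambda>x. frechet_derivative f (at x) v) k"
    if "x \<in> S" for x v
    using Suc.prems[OF that] by auto
  then show ?case using Suc by fastforce
qed

lemma higher_differentiable_on_const: "higher_differentiable_on S (\<lambda>x. c) k"
  by (induction k arbitrary: c) auto

lemma higher_differentiable_on_add:
  assumes "open S" "higher_differentiable_on S f k" "higher_differentiable_on S g k"
  shows "higher_differentiable_on S (\<lambda>x. f x + g x) k"
  using assms(2,3)
proof (induction k arbitrary: f g)
  case 0
  then show ?case by (simp add: continuous_on_add)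
next
  case (Suc k)
  show ?case
    by (rule higher_differentiable_on_SucI[OF assms(1)])
       (rule has_derivative_add higher_differentiable_on_Suc_has_derivative Suc | assumption
         | use Suc in auto)+
qed

lemma higher_differentiable_on_bounded_linear:
  assumes "open S" "bounded_linear L" "higher_differentiable_on S f k"
  shows "higher_differentiable_on S (\<lambda>x. L (f x)) k"
  using assms(3)
proof (induction k arbitrary: f)
  case 0
  then show ?case using bounded_linear.continuous_on[OF assms(2)] by auto
next
  case (Suc k)
  show ?case
    by (rule higher_differentiable_on_SucI[OF assms(1)])
       (rule bounded_linear.has_derivative[OF assms(2)] higher_differentiable_on_Suc_has_derivative Suc | assumption
         | use Suc in auto)+
qed

lemma higher_differentiable_on_bilinear:
  assumes "open S" "bounded_bilinear h" "higher_differentiable_on S f k" "higher_differentiable_on S g k"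
  shows "higher_differentiable_on S (\<lambda>x. h (f x) (g x)) k"
  using assms(3,4)
proof (induction k arbitrary: f g)
  case 0
  then show ?case using bounded_bilinear.continuous_on[OF assms(2)] by auto
next
  case (Suc k)
  show ?case
  proof (rule higher_differentiable_on_SucI[OF assms(1)])
    show "((\<lambda>x. h (f x) (g x)) has_derivative
       (\<lambda>v. h (f x) (frechet_derivative g (at x) v) + h (frechet_derivative f (at x) v) (g x))) (at x)"
      if "x \<in> S" for x
      using that Suc.prems
      by (intro bounded_bilinear.FDERIV[OF assms(2)] higher_differentiable_on_Suc_has_derivative)
    show "higher_differentiable_on S (\<lambda>x. h (f x) (frechet_derivative g (at x) v) +
        h (frechet_derivative f (at x) v) (g x)) k" for v
      using Suc.prems higher_differentiable_on_SucD[OF Suc.prems(1)] higher_differentiable_on_SucD[OF Suc.prems(2)]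
      by (intro higher_differentiable_on_add[OF assms(1)] Suc.IH) auto
  qed
qed

text \<open>The derivative of the inverse contains the inverse itself again, multiplied by a
  derivative of \<open>f\<close>; so each order follows from the preceding one for the same
  \<open>f\<close>.\<close>

lemma higher_differentiable_on_inverse:
  fixes f :: "'a::real_normed_vector \<Rightarrow> 'b::real_normed_field"
  assumes "open S" "\<And>x. x \<in> S \<Longrightarrow> f x \<noteq> 0" "higher_differentiable_on S f k"
  shows "higher_differentiable_on S (\<lambda>x. inverse (f x)) k"
  using assms(3)
proof (induction k)
  case 0
  then show ?case using assms(2) by (auto intro: continuous_on_inverse)
next
  case (Suc k)
  have IH: "higher_differentiable_on S (\<lambda>x. inverse (f x)) k"
    using Suc higher_differentiable_on_SucD by blast
  show ?case
  proof (rule higher_differentiable_on_SucI[OF assms(1)])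
    show "((\<lambda>x. inverse (f x)) has_derivative
       (\<lambda>v. - (inverse (f x) * frechet_derivative f (at x) v * inverse (f x)))) (at x)"
      if "x \<in> S" for x
      using that Suc.prems assms(2)
      by (intro Deriv.has_derivative_inverse higher_differentiable_on_Suc_has_derivative)
    show "higher_differentiable_on S (\<lambda>x. - (inverse (f x) * frechet_derivative f (at x) v * inverse (f x))) k" for v
      using IH Suc.prems
      by (intro higher_differentiable_on_bounded_linear[OF assms(1) bounded_linear_minus[OF bounded_linear_ident]]
          higher_differentiable_on_bilinear[OF assms(1) bounded_bilinear_mult]) auto
  qed
qed

lemma higher_differentiable_on_sum:
  assumes "open S" "\<And>i. i \<in> I \<Longrightarrow> higher_differentiable_on S (f i) k"
  shows "higher_differentiable_on S (\<lambda>x. \<Sum>i\<in>I. f i x) k"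
  using assms(2)
  by (induction I rule: infinite_finite_induct)
     (simp_all add: higher_differentiable_on_const higher_differentiable_on_add[OF assms(1)])

text \<open>In the chain rule the direction \<open>frechet_derivative g (at x) v\<close>, along
  which \<open>f\<close> is differentiated, moves with \<open>x\<close>, whereas the recursive
  definition controls derivatives in fixed directions only. Expanding this direction in
  \<open>Basis\<close> separates the two dependences; hence the Euclidean middle space.\<close>

lemma higher_differentiable_on_compose:
  fixes f :: "'b::euclidean_space \<Rightarrow> 'c::real_normed_vector" and g :: "'a::real_normed_vector \<Rightarrow> 'b"
  assumes "open S" "open T" "\<And>x. x \<in> S \<Longrightarrow> g x \<in> T"
    and "higher_differentiable_on T f k" "higher_differentiable_on S g k"
  shows "higher_differentiable_on S (\<lambda>x. f (g x)) k"
  using assms(4,5)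
proof (induction k arbitrary: f)
  case 0
  then show ?case using continuous_on_compose2[of T f S g] assms(3) by (simp add: image_subset_iff)
next
  case (Suc k)
  show ?case
  proof (rule higher_differentiable_on_SucI[OF assms(1)])
    show "((\<lambda>x. f (g x)) has_derivative
       (\<lambda>v. \<Sum>b\<in>Basis. (frechet_derivative g (at x) v \<bullet> b) *\<^sub>R frechet_derivative f (at (g x)) b)) (at x)"
      if "x \<in> S" for x
    proof -
      have f: "(f has_derivative frechet_derivative f (at (g x))) (at (g x))"
        using Suc.prems assms(3)[OF that] by (intro higher_differentiable_on_Suc_has_derivative)
      have g: "(g has_derivative frechet_derivative g (at x)) (at x)"
        using Suc.prems that by (intro higher_differentiable_on_Suc_has_derivative)
      have l: "linear (frechet_derivative f (at (g x)))"
        using f has_derivative_linear by blast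
      have e: "frechet_derivative f (at (g x)) w
         = (\<Sum>b\<in>Basis. (w \<bullet> b) *\<^sub>R frechet_derivative f (at (g x)) b)" for w
      proof -
        have "frechet_derivative f (at (g x)) w
           = frechet_derivative f (at (g x)) (\<Sum>b\<in>Basis. (w \<bullet> b) *\<^sub>R b)"
          by (simp add: euclidean_representation)
        also have "\<dots> = (\<Sum>b\<in>Basis. frechet_derivative f (at (g x)) ((w \<bullet> b) *\<^sub>R b))"
          by (rule linear_sum[OF l])
        finally show ?thesis by (simp add: linear_scale[OF l])
      qed
      have c: "frechet_derivative f (at (g x)) \<circ> frechet_derivative g (at x)
         = (\<lambda>v. \<Sum>b\<in>Basis. (frechet_derivative g (at x) v \<bullet> b) *\<^sub>R frechet_derivative f (at (g x)) b)"
        by (rule ext) (unfold comp_apply, rule e)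
      show ?thesis
        using diff_chain_at[OF g f] unfolding c unfolding o_def .
    qed
    show "higher_differentiable_on S
       (\<lambda>x. \<Sum>b\<in>Basis. (frechet_derivative g (at x) v \<bullet> b) *\<^sub>R frechet_derivative f (at (g x)) b) k" for v
    proof (rule higher_differentiable_on_sum[OF assms(1)],
        rule higher_differentiable_on_bilinear[OF assms(1) bounded_bilinear_scaleR])
      fix b :: 'b
      show "higher_differentiable_on S (\<lambda>x. frechet_derivative g (at x) v \<bullet> b) k"
        using Suc.prems(2)
        by (intro higher_differentiable_on_bounded_linear[OF assms(1) bounded_linear_inner_left]) simp
      show "higher_differentiable_on S (\<lambda>x. frechet_derivative f (at (g x)) b) k"
        using Suc.prems(1) higher_differentiable_on_SucD[OF Suc.prems(2)]
        by (intro Suc.IH[where f="\<lambda>y. frechet_derivative f (at y) b"]) simp_all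
    qed
  qed
qed

section \<open>Closure properties of smooth maps\<close>

lemma smooth_on_cong:
  "open S \<Longrightarrow> (\<And>x. x \<in> S \<Longrightarrow> f x = g x) \<Longrightarrow> smooth_on S f \<Longrightarrow> smooth_on S g"
  unfolding smooth_on_def by (blast intro: higher_differentiable_on_cong)

lemma smooth_on_subset: "smooth_on S f \<Longrightarrow> T \<subseteq> S \<Longrightarrow> smooth_on T f"
  unfolding smooth_on_def by (auto intro: higher_differentiable_on_subset)

lemma smooth_on_local:
  assumes "\<And>x. x \<in> S \<Longrightarrow> \<exists>T. open T \<and> x \<in> T \<and> smooth_on T f"
  shows "smooth_on S f"
  unfolding smooth_on_def
proof
  show "higher_differentiable_on S f k" for k
    by (rule higher_differentiable_on_local) (use assms in \<open>auto simp: smooth_on_def\<close>)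
qed

lemma smooth_on_imp_continuous_on: "smooth_on S f \<Longrightarrow> continuous_on S f"
  unfolding smooth_on_def by (metis higher_differentiable_on.simps(1))

lemma smooth_on_differentiable: "smooth_on S f \<Longrightarrow> x \<in> S \<Longrightarrow> f differentiable (at x)"
  unfolding smooth_on_def by (metis higher_differentiable_on.simps(2))

lemma smooth_on_const: "smooth_on S (\<lambda>x. c)"
  unfolding smooth_on_def by (intro allI higher_differentiable_on_const)

lemma smooth_on_add:
  "open S \<Longrightarrow> smooth_on S f \<Longrightarrow> smooth_on S g \<Longrightarrow> smooth_on S (\<lambda>x. f x + g x)"
  unfolding smooth_on_def by (rule allI, rule higher_differentiable_on_add) simp_all

lemma smooth_on_bounded_linear:
  "open S \<Longrightarrow> bounded_linear L \<Longrightarrow> smooth_on S f \<Longrightarrow> smooth_on S (\<lambda>x. L (f x))"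
  unfolding smooth_on_def by (rule allI, rule higher_differentiable_on_bounded_linear) simp_all

lemma smooth_on_bilinear:
  "open S \<Longrightarrow> bounded_bilinear h \<Longrightarrow> smooth_on S f \<Longrightarrow> smooth_on S g \<Longrightarrow>
    smooth_on S (\<lambda>x. h (f x) (g x))"
  unfolding smooth_on_def by (rule allI, rule higher_differentiable_on_bilinear) simp_all

lemmas smooth_on_mult = smooth_on_bilinear[OF _ bounded_bilinear_mult]
lemmas smooth_on_scaleR = smooth_on_bilinear[OF _ bounded_bilinear_scaleR]
lemmas smooth_on_inner = smooth_on_bilinear[OF _ bounded_bilinear_inner]
lemmas smooth_on_of_real = smooth_on_bounded_linear[OF _ bounded_linear_of_real]
lemmas smooth_on_minus = smooth_on_bounded_linear[OF _ bounded_linear_minus[OF bounded_linear_ident]]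
lemmas smooth_on_vec_nth = smooth_on_bounded_linear[OF _ bounded_linear_vec_nth]

lemma smooth_on_diff:
  "open S \<Longrightarrow> smooth_on S f \<Longrightarrow> smooth_on S g \<Longrightarrow> smooth_on S (\<lambda>x. f x - g x)"
  using smooth_on_add[of S f "\<lambda>x. - g x"] smooth_on_minus[of S g] by simp

lemma smooth_on_inverse:
  fixes f :: "'a::real_normed_vector \<Rightarrow> 'b::real_normed_field"
  shows "open S \<Longrightarrow> (\<And>x. x \<in> S \<Longrightarrow> f x \<noteq> 0) \<Longrightarrow> smooth_on S f \<Longrightarrow> smooth_on S (\<lambda>x. inverse (f x))"
  unfolding smooth_on_def by (rule allI, rule higher_differentiable_on_inverse) simp_all

lemma smooth_on_divide:
  fixes f :: "'a::real_normed_vector \<Rightarrow> 'b::real_normed_field"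
  shows "open S \<Longrightarrow> (\<And>x. x \<in> S \<Longrightarrow> g x \<noteq> 0) \<Longrightarrow> smooth_on S f \<Longrightarrow> smooth_on S g \<Longrightarrow>
    smooth_on S (\<lambda>x. f x / g x)"
  unfolding divide_inverse by (intro smooth_on_mult smooth_on_inverse)

lemma smooth_on_sum:
  "open S \<Longrightarrow> (\<And>i. i \<in> I \<Longrightarrow> smooth_on S (f i)) \<Longrightarrow> smooth_on S (\<lambda>x. \<Sum>i\<in>I. f i x)"
  unfolding smooth_on_def by (rule allI, rule higher_differentiable_on_sum) simp_all

lemma smooth_on_prod:
  fixes f :: "'i \<Rightarrow> 'a::real_normed_vector \<Rightarrow> 'b::{real_normed_algebra, comm_ring_1}"
  shows "open S \<Longrightarrow> (\<And>i. i \<in> I \<Longrightarrow> smooth_on S (f i)) \<Longrightarrow> smooth_on S (\<lambda>x. \<Prod>i\<in>I. f i x)"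
  by (induction I rule: infinite_finite_induct) (simp_all add: smooth_on_const smooth_on_mult)

lemma smooth_on_compose:
  fixes f :: "'b::euclidean_space \<Rightarrow> 'c::real_normed_vector" and g :: "'a::real_normed_vector \<Rightarrow> 'b"
  assumes "open S" "open T" "\<And>x. x \<in> S \<Longrightarrow> g x \<in> T" "smooth_on T f" "smooth_on S g"
  shows "smooth_on S (\<lambda>x. f (g x))"
  using assms higher_differentiable_on_compose[of S T g f] unfolding smooth_on_def by blast

lemma smooth_on_id: "open S \<Longrightarrow> smooth_on S (\<lambda>x. x)"
proof -
  assume S: "open S"
  have "higher_differentiable_on S (\<lambda>x. x) k" for k
    by (cases k) (auto intro!: higher_differentiable_on_SucI[OF S has_derivative_ident]
        higher_differentiable_on_const)
  then show ?thesis by (simp add: smooth_on_def)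
qed

lemma bounded_linear_axis: "bounded_linear (axis i :: 'b::real_normed_vector \<Rightarrow> 'b^'k::finite)"
proof (rule bounded_linear_intro[where K=1])
  show "norm (axis i x) \<le> norm x * 1" for x :: 'b
  proof -
    have "norm (axis i x :: 'b^'k) \<le> (\<Sum>j\<in>UNIV. norm ((axis i x :: 'b^'k) $ j))"
      by (simp add: norm_vec_def L2_set_le_sum)
    also have "\<dots> = (\<Sum>j\<in>UNIV. if j = i then norm x else 0)"
      by (rule sum.cong) (auto simp: axis_def)
    finally show ?thesis by simp
  qed
qed (auto simp: axis_def vec_eq_iff)

lemma vec_lambda_eq_sum_axis:
  fixes f :: "'k::finite \<Rightarrow> 'b::real_normed_vector"
  shows "(\<chi> i. f i) = (\<Sum>i\<in>UNIV. axis i (f i))"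
  by (simp add: vec_eq_iff axis_def if_distrib cong: if_cong)

lemma smooth_on_vec_lambda:
  fixes f :: "'a::real_normed_vector \<Rightarrow> 'k::finite \<Rightarrow> 'b::real_normed_vector"
  shows "open S \<Longrightarrow> (\<And>i. smooth_on S (\<lambda>x. f x i)) \<Longrightarrow> smooth_on S (\<lambda>x. \<chi> i. f x i)"
  unfolding vec_lambda_eq_sum_axis
  by (rule smooth_on_sum, assumption, rule smooth_on_bounded_linear[OF _ bounded_linear_axis]) simp_all

lemma smooth_on_vecI:
  fixes f :: "'a::real_normed_vector \<Rightarrow> 'b::real_normed_vector^'k::finite"
  assumes "open S" "\<And>i. smooth_on S (\<lambda>x. f x $ i)"
  shows "smooth_on S f"
  using smooth_on_vec_lambda[of S "\<lambda>x i. f x $ i"] assms by simp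

section \<open>Partial derivatives and their symmetry\<close>

lemma smooth_on_frechet_derivative:
  "smooth_on S f \<Longrightarrow> smooth_on S (\<lambda>x. frechet_derivative f (at x) v)"
  unfolding smooth_on_def by (metis higher_differentiable_on.simps(2))

lemma smooth_on_pderiv_at: "smooth_on S f \<Longrightarrow> smooth_on S (pderiv_at i f)"
  unfolding pderiv_at_def[abs_def] by (rule smooth_on_frechet_derivative)

lemma differentiable_has_derivative:
  "f differentiable (at x) \<Longrightarrow> (f has_derivative frechet_derivative f (at x)) (at x)"
  using frechet_derivative_works by blast

lemma pderiv_at_eq: "(f has_derivative f') (at x) \<Longrightarrow> pderiv_at i f x = f' (axis i 1)"
  by (simp add: pderiv_at_def frechet_derivative_eq)

lemma pderiv_at_const: "pderiv_at i (\<lambda>x. c) x = 0"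
  by (simp add: pderiv_at_def)

lemma pderiv_at_cong:
  assumes "open S" "x \<in> S" "\<And>y. y \<in> S \<Longrightarrow> f y = g y" "f differentiable (at x)"
  shows "pderiv_at i f x = pderiv_at i g x"
  using frechet_derivative_transform_within_open[OF assms(4,1,2,3)] by (simp add: pderiv_at_def)

lemma differentiable_cong:
  assumes "open S" "x \<in> S" "\<And>y. y \<in> S \<Longrightarrow> f y = g y" "f differentiable (at x)"
  shows "g differentiable (at x)"
  using assms has_derivative_transform_within_open unfolding differentiable_def by blast

lemma pderiv_at_bounded_linear:
  assumes "bounded_linear L" "f differentiable (at x)"
  shows "pderiv_at i (\<lambda>x. L (f x)) x = L (pderiv_at i f x)"
  using pderiv_at_eq[OF bounded_linear.has_derivative[OF assms(1) differentiable_has_derivative[OF assms(2)]]]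
  by (simp add: pderiv_at_def)

lemma differentiable_bounded_linear:
  "bounded_linear L \<Longrightarrow> f differentiable (at x) \<Longrightarrow> (\<lambda>x. L (f x)) differentiable (at x)"
  using bounded_linear.has_derivative differentiable_has_derivative unfolding differentiable_def by blast

lemma pderiv_at_bilinear:
  assumes "bounded_bilinear h" "f differentiable (at x)" "g differentiable (at x)"
  shows "pderiv_at i (\<lambda>x. h (f x) (g x)) x = h (f x) (pderiv_at i g x) + h (pderiv_at i f x) (g x)"
  using pderiv_at_eq[OF bounded_bilinear.FDERIV[OF assms(1)
      differentiable_has_derivative[OF assms(2)] differentiable_has_derivative[OF assms(3)]]]
  by (simp add: pderiv_at_def)

lemma differentiable_bilinear:
  "bounded_bilinear h \<Longrightarrow> f differentiable (at x) \<Longrightarrow> g differentiable (at x) \<Longrightarrow>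
    (\<lambda>x. h (f x) (g x)) differentiable (at x)"
  using bounded_bilinear.FDERIV differentiable_has_derivative unfolding differentiable_def by blast

lemma pderiv_at_add:
  assumes "f differentiable (at x)" "g differentiable (at x)"
  shows "pderiv_at i (\<lambda>x. f x + g x) x = pderiv_at i f x + pderiv_at i g x"
  using pderiv_at_eq[OF has_derivative_add[OF assms[THEN differentiable_has_derivative]]]
  by (simp add: pderiv_at_def)

lemma pderiv_at_sum:
  assumes "\<And>j. j \<in> J \<Longrightarrow> f j differentiable (at x)"
  shows "pderiv_at i (\<lambda>x. \<Sum>j\<in>J. f j x) x = (\<Sum>j\<in>J. pderiv_at i (f j) x)"
  using pderiv_at_eq[OF has_derivative_sum[OF differentiable_has_derivative[OF assms]]]
  by (simp add: pderiv_at_def)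

lemmas pderiv_at_mult = pderiv_at_bilinear[OF bounded_bilinear_mult]
lemmas pderiv_at_scaleR = pderiv_at_bilinear[OF bounded_bilinear_scaleR]
lemmas pderiv_at_minus = pderiv_at_bounded_linear[OF bounded_linear_minus[OF bounded_linear_ident]]
lemmas pderiv_at_vec_nth = pderiv_at_bounded_linear[OF bounded_linear_vec_nth]
lemmas differentiable_vec_nth = differentiable_bounded_linear[OF bounded_linear_vec_nth]

lemma pderiv_at_compose:
  fixes f :: "real^'l::finite \<Rightarrow> 'b::real_normed_vector" and g :: "real^'k::finite \<Rightarrow> real^'l"
  assumes "g differentiable (at x)" "f differentiable (at (g x))"
  shows "pderiv_at i (\<lambda>x. f (g x)) x = (\<Sum>m\<in>UNIV. (pderiv_at i g x $ m) *\<^sub>R pderiv_at m f (g x))"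
proof -
  let ?f' = "frechet_derivative f (at (g x))"
  have f: "(f has_derivative ?f') (at (g x))"
    using assms by (simp add: differentiable_has_derivative)
  have l: "linear ?f'" using f has_derivative_linear by blast
  have "pderiv_at i (\<lambda>x. f (g x)) x = ?f' (pderiv_at i g x)"
    using pderiv_at_eq[OF diff_chain_at[OF differentiable_has_derivative[OF assms(1)] f]]
    by (simp add: o_def pderiv_at_def)
  also have "\<dots> = ?f' (\<Sum>m\<in>UNIV. (pderiv_at i g x $ m) *\<^sub>R axis m 1)"
    using basis_expansion[of "pderiv_at i g x"] by (simp add: scalar_mult_eq_scaleR)
  also have "\<dots> = (\<Sum>m\<in>UNIV. ?f' ((pderiv_at i g x $ m) *\<^sub>R axis m 1))"
    by (rule linear_sum[OF l])
  finally show ?thesis by (simp add: linear_scale[OF l] pderiv_at_def)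
qed

text \<open>Two applications of the mean value theorem. The second difference is the increment over
  \<open>[0, s]\<close> of \<open>\<phi>\<close>, the first difference of \<open>f\<close> along
  \<open>v\<close>; the first application differentiates it along \<open>u\<close>, the second one
  treats the remaining difference along \<open>v\<close>. The bound on \<open>s\<close> keeps the
  whole parallelogram inside the ball.\<close>

lemma second_difference_eq:
  fixes f :: "'a::real_normed_vector \<Rightarrow> real"
  assumes S: "ball x d \<subseteq> S" "smooth_on S f" and s: "s > 0" "s * (norm u + norm v) < d"
  shows "\<exists>y\<in>ball x d. f (x + s *\<^sub>R u + s *\<^sub>R v) - f (x + s *\<^sub>R u) - f (x + s *\<^sub>R v) + f x
     = s * s * frechet_derivative (\<lambda>y. frechet_derivative f (at y) u) (at y) v"
proof -
  define D where "D = (\<lambda>y w. frechet_derivative f (at y) w)"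
  have inb: "x + r *\<^sub>R u + t *\<^sub>R v \<in> ball x d" if "0 \<le> r" "r \<le> s" "0 \<le> t" "t \<le> s" for r t
  proof -
    have "norm (r *\<^sub>R u + t *\<^sub>R v) \<le> r * norm u + t * norm v"
      using norm_triangle_ineq[of "r *\<^sub>R u" "t *\<^sub>R v"] that by simp
    also have "\<dots> \<le> s * norm u + s * norm v"
      using that by (intro add_mono mult_right_mono) auto
    finally have "norm (r *\<^sub>R u + t *\<^sub>R v) < d"
      using s by (simp add: distrib_left)
    then show ?thesis
      by (simp add: dist_norm norm_minus_commute add.assoc)
        (metis add.commute minus_add norm_minus_cancel uminus_add_conv_diff)
  qed
  have der: "((\<lambda>r. f (p + r *\<^sub>R w)) has_derivative (\<lambda>h. h * D (p + r *\<^sub>R w) w)) (at r)"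
    if "p + r *\<^sub>R w \<in> S" for p r w
  proof -
    have f: "(f has_derivative D (p + r *\<^sub>R w)) (at (p + r *\<^sub>R w))"
      using smooth_on_differentiable[OF S(2) that] by (simp add: D_def differentiable_has_derivative)
    have "((\<lambda>r. p + r *\<^sub>R w) has_derivative (\<lambda>h. h *\<^sub>R w)) (at r)"
      by (auto intro!: derivative_eq_intros)
    from diff_chain_at[OF this f] show ?thesis
      using linear_scale[OF has_derivative_linear[OF f]] by (simp add: o_def)
  qed
  have der2: "((\<lambda>t. D (p + t *\<^sub>R w) u) has_derivative
      (\<lambda>h. h * frechet_derivative (\<lambda>y. D y u) (at (p + t *\<^sub>R w)) w)) (at t)"
    if "p + t *\<^sub>R w \<in> S" for p t w
  proof -
    have "smooth_on S (\<lambda>y. D y u)" unfolding D_def by (rule smooth_on_frechet_derivative[OF S(2)])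
    then have f: "((\<lambda>y. D y u) has_derivative frechet_derivative (\<lambda>y. D y u) (at (p + t *\<^sub>R w))) (at (p + t *\<^sub>R w))"
      by (intro differentiable_has_derivative smooth_on_differentiable[OF _ that])
    have "((\<lambda>r. p + r *\<^sub>R w) has_derivative (\<lambda>h. h *\<^sub>R w)) (at t)"
      by (auto intro!: derivative_eq_intros)
    from diff_chain_at[OF this f] show ?thesis
      using linear_scale[OF has_derivative_linear[OF f]] by (simp add: o_def)
  qed
  define \<phi> where "\<phi> = (\<lambda>r. f ((x + s *\<^sub>R v) + r *\<^sub>R u) - f (x + r *\<^sub>R u))"
  have "\<exists>r. 0 < r \<and> r < s \<and> \<phi> s - \<phi> 0 = s * (D ((x + s *\<^sub>R v) + r *\<^sub>R u) u - D (x + r *\<^sub>R u) u)"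
  proof -
    have d: "(\<phi> has_derivative (\<lambda>h. h * D ((x + s *\<^sub>R v) + r *\<^sub>R u) u - h * D (x + r *\<^sub>R u) u)) (at r)"
      if "0 \<le> r" "r \<le> s" for r
      unfolding \<phi>_def using inb[OF that, of s] inb[OF that, of 0] s S(1)
      by (intro has_derivative_diff der) (auto simp: algebra_simps)
    from mvt_simple[OF s(1) has_derivative_at_withinI[OF d]]
    have "\<exists>r\<in>{0<..<s}. \<phi> s - \<phi> 0 = (s - 0) * D ((x + s *\<^sub>R v) + r *\<^sub>R u) u - (s - 0) * D (x + r *\<^sub>R u) u"
      by blast
    then show ?thesis by (auto simp: right_diff_distrib)
  qed
  then obtain r where r: "0 < r" "r < s"
    "\<phi> s - \<phi> 0 = s * (D ((x + s *\<^sub>R v) + r *\<^sub>R u) u - D (x + r *\<^sub>R u) u)" by blast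
  have "x + r *\<^sub>R u + t *\<^sub>R v \<in> S" if "0 \<le> t" "t \<le> s" for t
    using that s(1) r(1,2) inb[of r t] S(1) by auto
  from mvt_simple[OF s(1) has_derivative_at_withinI[OF der2[OF this]]]
  have "\<exists>t\<in>{0<..<s}. D ((x + r *\<^sub>R u) + s *\<^sub>R v) u - D ((x + r *\<^sub>R u) + 0 *\<^sub>R v) u
      = (s - 0) * frechet_derivative (\<lambda>y. D y u) (at ((x + r *\<^sub>R u) + t *\<^sub>R v)) v"
    by blast
  then obtain t where t: "0 < t" "t < s" "D ((x + r *\<^sub>R u) + s *\<^sub>R v) u - D (x + r *\<^sub>R u) u
      = s * frechet_derivative (\<lambda>y. D y u) (at (x + r *\<^sub>R u + t *\<^sub>R v)) v" by auto
  have "f (x + s *\<^sub>R u + s *\<^sub>R v) - f (x + s *\<^sub>R u) - f (x + s *\<^sub>R v) + f x = \<phi> s - \<phi> 0"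
    by (simp add: \<phi>_def algebra_simps)
  also have "\<dots> = s * s * frechet_derivative (\<lambda>y. D y u) (at (x + r *\<^sub>R u + t *\<^sub>R v)) v"
    using r(3) t(3) by (simp add: algebra_simps)
  finally show ?thesis
    using inb[of r t] r t unfolding D_def by (intro bexI[of _ "x + r *\<^sub>R u + t *\<^sub>R v"]) auto
qed

text \<open>The second difference does not change when \<open>u\<close> and \<open>v\<close> are
  exchanged. So the two mixed derivatives agree at two points \<open>y\<close> and \<open>z\<close>
  near \<open>x\<close>, and by continuity they cannot differ at \<open>x\<close>.\<close>

lemma symmetric_second_derivative_real:
  fixes f :: "'a::real_normed_vector \<Rightarrow> real"
  assumes S: "open S" "x \<in> S" "smooth_on S f"
  shows "frechet_derivative (\<lambda>y. frechet_derivative f (at y) u) (at x) v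
       = frechet_derivative (\<lambda>y. frechet_derivative f (at y) v) (at x) u" (is "?F x = ?G x")
proof (rule ccontr)
  assume ne: "?F x \<noteq> ?G x"
  define e where "e = \<bar>?F x - ?G x\<bar> / 2"
  have e: "e > 0" using ne by (simp add: e_def)
  have "continuous_on S ?F" "continuous_on S ?G"
    by (intro smooth_on_imp_continuous_on smooth_on_frechet_derivative S(3))+
  then have "isCont ?F x" "isCont ?G x"
    using S(1,2) continuous_on_eq_continuous_at by blast+
  then obtain d1 d2 where d: "d1 > 0" "\<And>y. dist y x < d1 \<Longrightarrow> dist (?F y) (?F x) < e"
      "d2 > 0" "\<And>y. dist y x < d2 \<Longrightarrow> dist (?G y) (?G x) < e"
    using e unfolding continuous_at_eps_delta by blast
  obtain d0 where d0: "d0 > 0" "ball x d0 \<subseteq> S" using S(1,2) open_contains_ball by blast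
  define d where "d = min d0 (min d1 d2)"
  have dpos: "d > 0" and dS: "ball x d \<subseteq> S" using d d0 by (auto simp: d_def)
  \<comment> \<open>Small enough for the parallelogram to fit into \<open>ball x d\<close>; the
    summand 1 keeps the denominator positive when \<open>u\<close> and \<open>v\<close> are both
    0.\<close>
  define s where "s = d / (2 * (norm u + norm v + 1))"
  have n: "norm u + norm v + 1 > 0" using norm_ge_zero[of u] norm_ge_zero[of v] by linarith
  have s: "s > 0" using dpos n by (simp add: s_def)
  have "s * (norm u + norm v) < s * (2 * (norm u + norm v + 1))"
    using s n by (intro mult_strict_left_mono) auto
  also have "\<dots> = d" using n by (simp add: s_def)
  finally have s2: "s * (norm u + norm v) < d" .
  obtain y where y: "y \<in> ball x d" "f (x + s *\<^sub>R u + s *\<^sub>R v) - f (x + s *\<^sub>R u) - f (x + s *\<^sub>R v) + f x = s * s * ?F y"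
    using second_difference_eq[OF dS S(3) s s2] by blast
  obtain z where z: "z \<in> ball x d" "f (x + s *\<^sub>R v + s *\<^sub>R u) - f (x + s *\<^sub>R v) - f (x + s *\<^sub>R u) + f x = s * s * ?G z"
    using second_difference_eq[OF dS S(3) s, of v u] s2 by (auto simp: add.commute)
  have "s * s * ?F y = s * s * ?G z"
    using y(2) z(2) by (simp add: add.commute add.left_commute algebra_simps)
  then have "?F y = ?G z" using s by simp
  moreover have "dist (?F y) (?F x) < e" "dist (?G z) (?G x) < e"
    using d(2)[of y] d(4)[of z] y(1) z(1) by (auto simp: d_def dist_commute)
  moreover have False if "\<bar>a - p\<bar> < \<bar>p - q\<bar> / 2" "\<bar>a - q\<bar> < \<bar>p - q\<bar> / 2" for a p q :: real
    using that by argo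
  ultimately show False unfolding dist_real_def e_def by metis
qed

lemma pderiv_at_commute:
  fixes f :: "real^'k::finite \<Rightarrow> 'b::euclidean_space"
  assumes S: "open S" "x \<in> S" "smooth_on S f"
  shows "pderiv_at i (pderiv_at j f) x = pderiv_at j (pderiv_at i f) x"
proof (rule euclidean_eqI)
  fix b :: 'b
  let ?fb = "\<lambda>x. f x \<bullet> b"
  have sm: "smooth_on S ?fb"
    by (rule smooth_on_bounded_linear[OF S(1) bounded_linear_inner_left S(3)])
  have 1: "pderiv_at l ?fb y = pderiv_at l f y \<bullet> b" if "y \<in> S" for l y
    using pderiv_at_bounded_linear[OF bounded_linear_inner_left smooth_on_differentiable[OF S(3) that]] .
  have "pderiv_at k (pderiv_at l ?fb) x = pderiv_at k (pderiv_at l f) x \<bullet> b" for k l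
  proof -
    have "pderiv_at k (pderiv_at l ?fb) x = pderiv_at k (\<lambda>y. pderiv_at l f y \<bullet> b) x"
      by (rule pderiv_at_cong[OF S(1,2) 1])
        (auto intro!: smooth_on_differentiable[OF _ S(2)] smooth_on_pderiv_at sm)
    also have "\<dots> = pderiv_at k (pderiv_at l f) x \<bullet> b"
      by (rule pderiv_at_bounded_linear[OF bounded_linear_inner_left])
        (auto intro!: smooth_on_differentiable[OF _ S(2)] smooth_on_pderiv_at S(3))
    finally show ?thesis .
  qed
  moreover have "pderiv_at i (pderiv_at j ?fb) x = pderiv_at j (pderiv_at i ?fb) x"
    unfolding pderiv_at_def[abs_def] by (rule symmetric_second_derivative_real[OF S(1,2) sm])
  ultimately show "pderiv_at i (pderiv_at j f) x \<bullet> b = pderiv_at j (pderiv_at i f) x \<bullet> b" by simp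
qed

section \<open>Bump functions\<close>

text \<open>For \<open>m = 0\<close> this is the classical flat function
  \<open>exp (- 1 / t)\<close>. The powers in the denominator make the family closed under
  differentiation up to linear combinations, so that one induction over all \<open>m\<close> gives
  smoothness.\<close>

definition flat_exp :: "nat \<Rightarrow> real \<Rightarrow> real" where
  "flat_exp m t = (if t > 0 then exp (- (1 / t)) / t ^ m else 0)"

text \<open>With \<open>u = 1 / t\<close> the right-hand limit is that of
  \<open>u ^ m / exp u\<close> at infinity; on the left the function is 0.\<close>

lemma flat_exp_tendsto_0: "((\<lambda>t. flat_exp m t) \<longlongrightarrow> 0) (at 0)"
proof -
  have "((\<lambda>t::real. inverse t ^ m / exp (inverse t)) \<longlongrightarrow> 0) (at_right 0)"
    by (rule filterlim_compose[OF tendsto_power_div_exp_0 filterlim_inverse_at_top_right])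
  then have "((\<lambda>t::real. exp (- (1 / t)) / t ^ m) \<longlongrightarrow> 0) (at_right 0)"
    by (simp add: exp_minus divide_inverse power_inverse mult.commute)
  moreover have "eventually (\<lambda>t. exp (- (1 / t)) / t ^ m = flat_exp m t) (at_right (0::real))"
    by (auto simp: eventually_at_right_less flat_exp_def intro: eventually_mono[OF eventually_at_right_less])
  ultimately have r: "((\<lambda>t. flat_exp m t) \<longlongrightarrow> 0) (at_right 0)"
    using tendsto_cong by fastforce
  have "eventually (\<lambda>t. 0 = flat_exp m t) (at_left (0::real))"
    by (auto simp: flat_exp_def eventually_at_left_real eventually_at_filter)
  then have "((\<lambda>t. flat_exp m t) \<longlongrightarrow> 0) (at_left 0)"
    using tendsto_cong tendsto_const by fastforce
  with r show ?thesis by (simp add: filterlim_split_at)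
qed

lemma flat_exp_has_derivative:
  "(flat_exp m has_derivative (\<lambda>h. h * (flat_exp (m + 2) t - m * flat_exp (m + 1) t))) (at t)"
proof -
  consider "t > 0" | "t < 0" | "t = 0" by linarith
  then show ?thesis
  proof cases
    case 1
    \<comment> \<open>The power rule lowers the exponent by truncated subtraction; restoring it by a
      factor \<open>t\<close> can fail only for exponent 0.\<close>
    have p: "k = 0" if "t ^ k \<noteq> t * t ^ (k - Suc 0)" for k
      using that by (cases k) auto
    have "((\<lambda>t. exp (- (1 / t)) / t ^ m) has_field_derivative
        (exp (- (1 / t)) / t ^ (m + 2) - m * (exp (- (1 / t)) / t ^ (m + 1)))) (at t)"
      using 1 by (cases m) (auto intro!: derivative_eq_intros intro: p simp: field_simps power2_eq_square)
    then have "((\<lambda>t. exp (- (1 / t)) / t ^ m) has_derivative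
        (\<lambda>h. h * (flat_exp (m + 2) t - m * flat_exp (m + 1) t))) (at t)"
      using 1 by (simp add: flat_exp_def has_field_derivative_def mult.commute[of _ "_ - _"] mult_commute_abs)
    then show ?thesis
      by (rule has_derivative_transform_within_open[OF _ open_greaterThan[of 0]])
        (use 1 in \<open>auto simp: flat_exp_def\<close>)
  next
    case 2
    have "((\<lambda>t::real. 0::real) has_derivative (\<lambda>h. 0)) (at t)" by simp
    then have "(flat_exp m has_derivative (\<lambda>h. 0)) (at t)"
      by (rule has_derivative_transform_within_open[OF _ open_lessThan[of 0]])
        (use 2 in \<open>auto simp: flat_exp_def\<close>)
    then show ?thesis using 2 by (simp add: flat_exp_def)
  next
    case 3
    have "((\<lambda>h. flat_exp m h / h) \<longlongrightarrow> 0) (at 0)"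
    proof -
      \<comment> \<open>The difference quotient at 0 belongs to the family again, so the limit
        already known gives derivative 0. At \<open>h = 0\<close> both sides are 0 because division
        by 0 yields 0.\<close>
      have "(\<lambda>h. flat_exp m h / h) = flat_exp (m + 1)"
        by (auto simp: flat_exp_def)
      then show ?thesis using flat_exp_tendsto_0 by metis
    qed
    then have "(flat_exp m has_field_derivative 0) (at 0)"
      by (simp add: DERIV_def flat_exp_def)
    then show ?thesis using 3 by (simp add: flat_exp_def has_field_derivative_def lambda_zero)
  qed
qed

lemma smooth_on_flat_exp: "smooth_on UNIV (flat_exp m)"
proof -
  have "higher_differentiable_on UNIV (flat_exp m) k" for k m
  proof (induction k arbitrary: m)
    case 0
    have "continuous_on UNIV (flat_exp m)"
      by (rule has_derivative_continuous_on, rule flat_exp_has_derivative)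
    then show ?case by simp
  next
    case (Suc k)
    have "higher_differentiable_on UNIV
        (\<lambda>t. v * (flat_exp (m + 2) t + (- real m) * flat_exp (m + 1) t)) k" for v
      by (rule higher_differentiable_on_bilinear[OF open_UNIV bounded_bilinear_mult]
          higher_differentiable_on_add higher_differentiable_on_const open_UNIV Suc)+
    then show ?case
      by (intro higher_differentiable_on_SucI[OF open_UNIV flat_exp_has_derivative]) simp
  qed
  then show ?thesis by (simp add: smooth_on_def)
qed

lemma bump_function:
  fixes x :: "'a::euclidean_space"
  assumes "d > 0"
  obtains \<rho> :: "'a \<Rightarrow> real" where "smooth_on UNIV \<rho>" "\<rho> x = 1" "\<And>y. y \<notin> ball x d \<Longrightarrow> \<rho> y = 0"
proof -
  \<comment> \<open>The squared distance, unlike the distance, is smooth at the centre; the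
    denominator is the value there and normalises it to 1.\<close>
  define \<rho> where "\<rho> y = flat_exp 0 (d\<^sup>2 - (y - x) \<bullet> (y - x)) / flat_exp 0 (d\<^sup>2)" for y
  have "smooth_on UNIV (\<lambda>y. y - x)"
    by (intro smooth_on_diff smooth_on_id smooth_on_const open_UNIV)
  then have "smooth_on UNIV \<rho>" unfolding \<rho>_def divide_inverse
    by (intro smooth_on_mult smooth_on_const open_UNIV smooth_on_diff smooth_on_inner
        smooth_on_compose[OF open_UNIV open_UNIV _ smooth_on_flat_exp])
      (auto intro: smooth_on_id)
  moreover have "\<rho> x = 1" using assms by (simp add: \<rho>_def flat_exp_def)
  moreover have "\<rho> y = 0" if "y \<notin> ball x d" for y
  proof -
    have "d \<le> norm (y - x)" using that by (simp add: dist_norm norm_minus_commute)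
    then have "d\<^sup>2 \<le> (y - x) \<bullet> (y - x)"
      using assms by (simp add: power2_norm_eq_inner[symmetric])
    then show ?thesis by (simp add: \<rho>_def flat_exp_def)
  qed
  ultimately show ?thesis using that by blast
qed

section \<open>Linear algebra\<close>

lemma linear_covec_app: "linear (covec_app a)"
  unfolding covec_app_def
  by (rule linearI) (simp_all add: scaleR_add_right sum.distrib scaleR_sum_right mult.commute)

text \<open>Reindexing by \<open>t\<close> shows that the sum equals its own negative. Fixed points
  of \<open>t\<close> are allowed: there \<open>f\<close> is its own negative, hence 0.\<close>

lemma sum_involution_eq_0:
  fixes f :: "'a \<Rightarrow> 'b::linordered_idom"
  assumes "\<And>x. x \<in> S \<Longrightarrow> t x \<in> S" "\<And>x. x \<in> S \<Longrightarrow> t (t x) = x" "\<And>x. x \<in> S \<Longrightarrow> f (t x) = - f x"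
  shows "(\<Sum>x\<in>S. f x) = 0"
proof -
  have "(\<Sum>x\<in>S. f x) = (\<Sum>x\<in>S. - f x)"
    by (rule sum.reindex_bij_witness[of S t t]) (use assms in auto)
  then show ?thesis by (simp add: sum_negf)
qed

text \<open>Composing a permutation with the transposition of the values \<open>i\<close> and
  \<open>j\<close> leaves all arguments unchanged, as \<open>v i = v j\<close>, and reverses the
  sign.\<close>

lemma wedge_power_alternating:
  assumes "i \<le> 2 * n" "j \<le> 2 * n" "i \<noteq> j" "v i = v j"
  shows "wedge_power n a D v = 0"
proof -
  let ?t = "Transposition.transpose i j"
  have t: "?t permutes {..2 * n}" using assms by (intro permutes_swap_id) auto
  have v: "v (?t k) = v k" for k using assms(4) by (auto simp: Transposition.transpose_def)
  have "(\<Sum>\<sigma> | \<sigma> permutes {..2 * n}. of_int (sign \<sigma>) * covec_app a (v (\<sigma> 0)) *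
        (\<Prod>i<n. D (v (\<sigma> (2 * i + 1))) (v (\<sigma> (2 * i + 2))))) = 0"
  proof (rule sum_involution_eq_0[where t="\<lambda>\<sigma>. ?t \<circ> \<sigma>"])
    fix \<sigma> assume "\<sigma> \<in> {\<sigma>. \<sigma> permutes {..2 * n}}"
    then have \<sigma>: "\<sigma> permutes {..2 * n}" by simp
    show "?t \<circ> \<sigma> \<in> {\<sigma>. \<sigma> permutes {..2 * n}}" using \<sigma> t by (simp add: permutes_compose)
    have "permutation ?t" "permutation \<sigma>" using \<sigma> t by (auto intro: permutes_imp_permutation)
    then have "sign (?t \<circ> \<sigma>) = - sign \<sigma>"
      using assms(3) by (simp add: sign_compose sign_swap_id)
    then show "of_int (sign (?t \<circ> \<sigma>)) * covec_app a (v ((?t \<circ> \<sigma>) 0)) *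
        (\<Prod>i<n. D (v ((?t \<circ> \<sigma>) (2 * i + 1))) (v ((?t \<circ> \<sigma>) (2 * i + 2)))) =
      - (of_int (sign \<sigma>) * covec_app a (v (\<sigma> 0)) *
        (\<Prod>i<n. D (v (\<sigma> (2 * i + 1))) (v (\<sigma> (2 * i + 2)))))"
      by (simp add: v)
  qed (auto simp: o_assoc[symmetric] fun_eq_iff)
  then show ?thesis by (simp add: wedge_power_def)
qed

lemma linear_mult_right_const: "linear f \<Longrightarrow> linear (\<lambda>x. f x * (c::real))"
  by (auto simp: linear_iff algebra_simps)

text \<open>A permutation takes the value \<open>i\<close> at exactly one slot \<open>m\<close>.
  Slot 0 belongs to \<open>a\<close>, and slots \<open>2 * l + 1\<close> and
  \<open>2 * l + 2\<close> to the \<open>l\<close>-th copy of \<open>D\<close>; so \<open>x\<close>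
  enters exactly one factor, and linearly, while all the others are constants.\<close>

lemma linear_wedge_term:
  fixes n :: nat and D :: "real^'k::finite \<Rightarrow> real^'k \<Rightarrow> real"
  assumes D: "bilinear D" and \<sigma>: "\<sigma> permutes {..2 * n}" and i: "i \<le> 2 * n"
  shows "linear (\<lambda>x. covec_app a ((v(i := x)) (\<sigma> 0)) *
     (\<Prod>l<n. D ((v(i := x)) (\<sigma> (2 * l + 1))) ((v(i := x)) (\<sigma> (2 * l + 2)))))"
proof -
  have inj: "\<sigma> p = \<sigma> q \<longleftrightarrow> p = q" for p q using permutes_inj[OF \<sigma>] by (auto dest: injD)
  obtain m where m: "\<sigma> m = i" "m \<le> 2 * n" using \<sigma> i
    by (metis atMost_iff permutes_def permutes_not_in)
  have ne: "\<sigma> p \<noteq> i" if "p \<noteq> m" for p using m(1) inj that by auto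
  show ?thesis
  proof (cases "m = 0")
    case True
    then show ?thesis using m(1)
      by (simp add: ne) (rule linear_mult_right_const[OF linear_covec_app])
  next
    case False
    define l where "l = (m - 1) div 2"
    have l: "l < n" using False m(2) by (auto simp: l_def)
    have m': "m = 2 * l + 1 \<or> m = 2 * l + 2" using False unfolding l_def by presburger
    let ?F = "\<lambda>x l. D ((v(i := x)) (\<sigma> (2 * l + 1))) ((v(i := x)) (\<sigma> (2 * l + 2)))"
    let ?C = "covec_app a (v (\<sigma> 0)) * (\<Prod>l\<in>{..<n} - {l}. D (v (\<sigma> (2 * l + 1))) (v (\<sigma> (2 * l + 2))))"
    have F: "?F x l' = D (v (\<sigma> (2 * l' + 1))) (v (\<sigma> (2 * l' + 2)))" if "l' \<noteq> l" for x l'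
    proof -
      have "2 * l' + 1 \<noteq> m" "2 * l' + 2 \<noteq> m" using that m' by presburger+
      then show ?thesis by (simp add: ne)
    qed
    have "(\<Prod>l<n. ?F x l) = ?F x l * (\<Prod>l\<in>{..<n} - {l}. D (v (\<sigma> (2 * l + 1))) (v (\<sigma> (2 * l + 2))))" for x
      using l F by (simp add: prod.remove[where x=l])
    moreover have "(v(i := x)) (\<sigma> 0) = v (\<sigma> 0)" for x using ne[of 0] False by simp
    ultimately have eq: "(\<lambda>x. covec_app a ((v(i := x)) (\<sigma> 0)) * (\<Prod>l<n. ?F x l)) = (\<lambda>x. ?F x l * ?C)"
      by (simp only: mult.left_commute[of "covec_app a _"])
    have lin: "linear (\<lambda>x. ?F x l)"
      using m' m(1) ne[of "2 * l + 1"] ne[of "2 * l + 2"] D unfolding bilinear_def by auto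
    show ?thesis unfolding eq by (rule linear_mult_right_const[OF lin])
  qed
qed

lemma linear_wedge_power:
  assumes "bilinear D" "i \<le> 2 * n"
  shows "linear (\<lambda>x. wedge_power n a D (v(i := x)))"
proof -
  have "linear (\<lambda>x. \<Sum>\<sigma> | \<sigma> permutes {..2 * n}. (covec_app a ((v(i := x)) (\<sigma> 0)) *
     (\<Prod>l<n. D ((v(i := x)) (\<sigma> (2 * l + 1))) ((v(i := x)) (\<sigma> (2 * l + 2))))) * of_int (sign \<sigma>))"
    by (intro linear_compose_sum ballI linear_mult_right_const linear_wedge_term assms) auto
  from linear_mult_right_const[OF this, of "1 / 2 ^ n"] show ?thesis
    by (simp add: wedge_power_def mult_ac)
qed

text \<open>The slot next to the one of \<open>v i\<close> in the product is exchanged with the slot of \<open>a\<close>: this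
  changes the sign of the permutation, but not the rest of the summand.\<close>

lemma wedge_power_radical:
  assumes D: "\<And>x y. D x y = - D y x" and i: "i \<le> 2 * n"
    and a: "covec_app a (v i) = 0" and rad: "\<And>u. D (v i) u = \<mu> * covec_app a u"
  shows "wedge_power n a D v = 0"
proof -
  define mate where "mate m = (if odd m then Suc m else m - 1)" for m :: nat
  \<comment> \<open>Permutations with \<open>\<sigma> 0 = i\<close> are left fixed: their summand
    contains the factor \<open>covec_app a (v i) = 0\<close>. For the others, \<open>mate\<close>
    exchanges \<open>2 * l + 1\<close> with \<open>2 * l + 2\<close>, the two arguments of one copy
    of \<open>D\<close>.\<close>
  define t where "t \<sigma> = (if \<sigma> 0 = i then \<sigma> else \<sigma> \<circ> Transposition.transpose 0 (mate (inv \<sigma> i)))" for \<sigma>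
  have "(\<Sum>\<sigma> | \<sigma> permutes {..2 * n}. of_int (sign \<sigma>) * covec_app a (v (\<sigma> 0)) *
        (\<Prod>i<n. D (v (\<sigma> (2 * i + 1))) (v (\<sigma> (2 * i + 2))))) = 0"
  proof (rule sum_involution_eq_0[where t=t])
    fix \<sigma> assume "\<sigma> \<in> {\<sigma>. \<sigma> permutes {..2 * n}}"
    then have \<sigma>: "\<sigma> permutes {..2 * n}" by simp
    have inj: "inj \<sigma>" using permutes_inj[OF \<sigma>] .
    define f where "f \<tau> = of_int (sign \<tau>) * covec_app a (v (\<tau> 0)) *
        (\<Prod>i<n. D (v (\<tau> (2 * i + 1))) (v (\<tau> (2 * i + 2))))" for \<tau>
    have "t \<sigma> permutes {..2 * n} \<and> t (t \<sigma>) = \<sigma> \<and> f (t \<sigma>) = - f \<sigma>"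
    proof (cases "\<sigma> 0 = i")
      case True
      then show ?thesis using \<sigma> a by (simp add: t_def f_def)
    next
      case False
      obtain m where m: "\<sigma> m = i" "m \<le> 2 * n" using \<sigma> i
        by (metis atMost_iff permutes_def permutes_not_in)
      have m0: "m \<noteq> 0" using m False by metis
      define l where "l = (m - 1) div 2"
      have l: "l < n" using m0 m(2) by (auto simp: l_def)
      have m': "m = 2 * l + 1 \<or> m = 2 * l + 2" using m0 unfolding l_def by presburger
      let ?k = "mate m"
      have k: "?k = (if m = 2 * l + 1 then 2 * l + 2 else 2 * l + 1)" using m' by (auto simp: mate_def)
      have kl: "?k \<le> 2 * n" "?k \<noteq> 0" "?k \<noteq> m" using k l m' by auto
      have im: "inv \<sigma> i = m" using m(1) inj by (metis inv_f_f)
      let ?r = "Transposition.transpose 0 ?k"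
      have t1: "t \<sigma> = \<sigma> \<circ> ?r" using False im by (simp add: t_def)
      have r: "?r permutes {..2 * n}" using kl by (intro permutes_swap_id) auto
      have tp: "t \<sigma> permutes {..2 * n}" using permutes_compose[OF r \<sigma>] t1 by simp
      have tm: "t \<sigma> m = i" using t1 m(1) m0 kl by (simp add: Transposition.transpose_def)
      have im2: "inv (t \<sigma>) i = m" using tm permutes_inj[OF tp] by (metis inv_f_f)
      have t0: "t \<sigma> 0 = \<sigma> ?k" "t \<sigma> ?k = \<sigma> 0" using t1 by simp_all
      have "t \<sigma> 0 \<noteq> i" using t0 m(1) kl inj by (metis injD)
      then have "t (t \<sigma>) = t \<sigma> \<circ> ?r" using im2 by (simp add: t_def[of "t \<sigma>"])
      then have tt: "t (t \<sigma>) = \<sigma>" using t1 by (simp add: o_assoc[symmetric])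
      have "permutation ?r" "permutation \<sigma>" using \<sigma> r by (auto intro: permutes_imp_permutation)
      then have sgn: "sign (t \<sigma>) = - sign \<sigma>"
        using kl t1 by (simp add: sign_compose sign_swap_id)
      let ?G = "\<lambda>\<tau> l. D (v (\<tau> (2 * l + 1))) (v (\<tau> (2 * l + 2)))"
      have G: "?G (t \<sigma>) l' = ?G \<sigma> l'" if "l' \<noteq> l" for l'
      proof -
        have "2 * l' + 1 \<noteq> ?k" "2 * l' + 2 \<noteq> ?k" using that k by presburger+
        then show ?thesis by (simp add: t1 Transposition.transpose_def)
      qed
      have P: "(\<Prod>l<n. ?G \<tau> l) = ?G \<tau> l * (\<Prod>l\<in>{..<n} - {l}. ?G \<tau> l)" for \<tau>
        using l by (simp add: prod.remove[where x=l])
      have P': "(\<Prod>l\<in>{..<n} - {l}. ?G (t \<sigma>) l) = (\<Prod>l\<in>{..<n} - {l}. ?G \<sigma> l)"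
        using G by (intro prod.cong) auto
      have rad': "D u (v i) = - \<mu> * covec_app a u" for u using D[of u "v i"] rad[of u] by simp
      \<comment> \<open>By \<open>rad\<close>, multiplying \<open>covec_app a x\<close> by
        \<open>D (v i) y\<close> gives \<open>\<mu>\<close> times the values of \<open>a\<close> at
        \<open>x\<close> and at \<open>y\<close>, which is symmetric in \<open>x\<close> and
        \<open>y\<close>; when \<open>v i\<close> is the second argument, only the sign of
        \<open>\<mu>\<close> changes.\<close>
      have "covec_app a (v (t \<sigma> 0)) * ?G (t \<sigma>) l = covec_app a (v (\<sigma> 0)) * ?G \<sigma> l"
      proof (cases "m = 2 * l + 1")
        case True
        then have "\<sigma> (2 * l + 1) = i" "t \<sigma> (2 * l + 1) = i" "?k = 2 * l + 2" using m tm k by auto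
        then show ?thesis using t0 by (simp add: rad mult_ac)
      next
        case False
        then have "\<sigma> (2 * l + 2) = i" "t \<sigma> (2 * l + 2) = i" "?k = 2 * l + 1" using m m' tm k by auto
        then show ?thesis using t0 by (simp add: rad' mult_ac)
      qed
      then have "f (t \<sigma>) = - f \<sigma>"
        unfolding f_def P P' sgn by (simp add: mult.assoc[symmetric])
      then show ?thesis using tp tt by blast
    qed
    then show "t \<sigma> \<in> {\<sigma>. \<sigma> permutes {..2 * n}}" "t (t \<sigma>) = \<sigma>"
      "of_int (sign (t \<sigma>)) * covec_app a (v (t \<sigma> 0)) *
        (\<Prod>i<n. D (v (t \<sigma> (2 * i + 1))) (v (t \<sigma> (2 * i + 2)))) =
      - (of_int (sign \<sigma>) * covec_app a (v (\<sigma> 0)) *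
        (\<Prod>i<n. D (v (\<sigma> (2 * i + 1))) (v (\<sigma> (2 * i + 2)))))"
      by (simp_all add: f_def)
  qed
  then show ?thesis by (simp add: wedge_power_def)
qed

text \<open>Vanishing on the kernel of \<open>a\<close> makes \<open>D w\<close> a multiple of
  \<open>a\<close>, so the wedge power is 0 whenever one of its arguments is \<open>w\<close>. On
  the other hand the vectors \<open>v\<close> form a basis, and replacing one of them by
  \<open>w\<close> multiplies the nonzero value at \<open>v\<close> by the corresponding coordinate
  of \<open>w\<close>. Hence all coordinates of \<open>w\<close> vanish.\<close>

lemma wedge_power_nondegenerate:
  fixes a :: "real^'k::finite"
  assumes card: "CARD('k) = 2 * n + 1" and D: "bilinear D" "\<And>x y. D x y = - D y x"
    and nz: "wedge_power n a D v \<noteq> 0"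
    and w: "covec_app a w = 0" "\<And>u. covec_app a u = 0 \<Longrightarrow> D w u = 0"
  shows "w = 0"
proof -
  interpret a: linear "covec_app a :: real^'k \<Rightarrow> real" by (rule linear_covec_app)
  have lw: "linear (D w)" using D(1) by (simp add: bilinear_def)
  have "\<exists>\<mu>. \<forall>u. D w u = \<mu> * covec_app a u"
  proof (cases "\<exists>e :: real^'k. covec_app a e \<noteq> 0")
    case True
    then obtain e :: "real^'k" where e: "covec_app a e \<noteq> 0" by blast
    have "D w u = D w e / covec_app a e * covec_app a u" for u
    proof -
      have "D w (u - (covec_app a u / covec_app a e) *\<^sub>R e) = 0"
        using e by (intro w(2)) (simp add: a.diff a.scaleR)
      then show ?thesis by (simp add: linear_diff[OF lw] linear_scale[OF lw])
    qed
    then show ?thesis by blast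
  next
    case False
    then show ?thesis using w(2) by auto
  qed
  then obtain \<mu> where lam: "\<And>u. D w u = \<mu> * covec_app a u" by blast
  \<comment> \<open>The \<open>2 * n + 1\<close> arguments are numbered from 0, but coordinates are
    indexed by the type; \<open>h\<close> identifies the two index sets, so that \<open>L\<close> is
    an endomorphism and its injectivity gives surjectivity.\<close>
  have "\<exists>h. bij_betw h (UNIV :: 'k set) {..2 * n}"
    by (rule finite_same_card_bij) (use card in auto)
  then obtain h :: "'k \<Rightarrow> nat" where h: "bij_betw h UNIV {..2 * n}" by blast
  have hl: "h j \<le> 2 * n" for j using h by (auto simp: bij_betw_def)
  have hi: "h j = h j' \<longleftrightarrow> j = j'" for j j' using h by (auto simp: bij_betw_def dest: injD)
  define L where "L c = (\<Sum>j\<in>UNIV. c $ j *\<^sub>R v (h j))" for c :: "real^'k"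
  have linL: "linear L"
    by (rule linearI) (simp_all add: L_def scaleR_add_left sum.distrib scaleR_sum_right)
  have key: "wedge_power n a D (v(h j := L c)) = c $ j * wedge_power n a D v" for j c
  proof -
    let ?W = "\<lambda>x. wedge_power n a D (v(h j := x))"
    have l: "linear ?W" by (rule linear_wedge_power[OF D(1) hl])
    have "?W (L c) = (\<Sum>j'\<in>UNIV. ?W (c $ j' *\<^sub>R v (h j')))"
      unfolding L_def by (rule linear_sum[OF l])
    also have "\<dots> = (\<Sum>j'\<in>UNIV. c $ j' * ?W (v (h j')))"
      using linear_scale[OF l] by simp
    also have "\<dots> = (\<Sum>j'\<in>UNIV. if j' = j then c $ j * wedge_power n a D v else 0)"
    proof (rule sum.cong[OF refl])
      fix j'
      show "c $ j' * ?W (v (h j')) = (if j' = j then c $ j * wedge_power n a D v else 0)"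
      proof (cases "j' = j")
        case False
        then have "?W (v (h j')) = 0"
          by (intro wedge_power_alternating[of "h j" n "h j'"]) (auto simp: hl hi)
        then show ?thesis using False by simp
      qed simp
    qed
    finally show ?thesis by simp
  qed
  have "c = 0" if "L c = 0" for c
  proof -
    have "c $ j = 0" for j
      using key[of j c] that nz linear_0[OF linear_wedge_power[OF D(1) hl]] by simp
    then show ?thesis by (simp add: vec_eq_iff)
  qed
  then have "inj L" using linear_injective_0[OF linL] by blast
  then have "surj L" using linL by (simp add: linear_injective_imp_surjective)
  then obtain c where c: "w = L c" by (metis surjD)
  have "wedge_power n a D (v(h j := w)) = 0" for j
    by (rule wedge_power_radical[OF D(2) hl[of j], where \<mu>=\<mu>]) (simp_all add: w(1) lam)
  then have "c = 0" using key[of _ c] c nz by (simp add: vec_eq_iff)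
  then show ?thesis using c by (simp add: L_def)
qed

section \<open>Complexification of the form, and solving for vectors in the kernel by Cramer's
  rule\<close>

definition cform :: "real^'k::finite^'k \<Rightarrow> complex^'k \<Rightarrow> complex^'k \<Rightarrow> complex" where
  "cform M u w = (\<Sum>i\<in>UNIV. \<Sum>j\<in>UNIV. of_real (M $ i $ j) * u $ i * w $ j)"

definition nondegenerate_on_kernel :: "real^'k::finite^'k \<Rightarrow> real^'k \<Rightarrow> bool" where
  "nondegenerate_on_kernel M a \<longleftrightarrow> (\<forall>i j. M $ i $ j = - M $ j $ i) \<and>
     (\<forall>w::real^'k. covec_app a w = 0 \<longrightarrow>
        (\<forall>u::real^'k. covec_app a u = 0 \<longrightarrow> (\<Sum>i\<in>UNIV. \<Sum>j\<in>UNIV. M $ i $ j * w $ i * u $ j) = 0) \<longrightarrow>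
        w = 0)"

lemma covec_app_complex: "covec_app a v = (\<Sum>i\<in>UNIV. of_real (a $ i) * v $ i :: complex)"
  by (simp add: covec_app_def scaleR_conv_of_real)

lemma covec_app_vector_scalar_mult: "covec_app a (c *s v) = c * (covec_app a v :: complex)"
  by (simp add: covec_app_complex sum_distrib_left mult_ac)

lemma covec_app_add: "covec_app a (u + v) = covec_app a u + covec_app a v"
  and covec_app_diff: "covec_app a (u - v) = covec_app a u - covec_app a v"
  and covec_app_minus: "covec_app a (- v) = - covec_app a v"
  and covec_app_0: "covec_app a 0 = 0"
  using linear_add[OF linear_covec_app] linear_diff[OF linear_covec_app]
    linear_neg[OF linear_covec_app] linear_0[OF linear_covec_app] by auto

lemma cform_sum: "cform M u w = (\<Sum>j\<in>UNIV. (\<Sum>i\<in>UNIV. of_real (M $ i $ j) * u $ i) * w $ j)"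
  unfolding cform_def by (subst sum.swap) (simp add: sum_distrib_right)

lemma cform_diff_left: "cform M (u - v) w = cform M u w - cform M v w"
  by (simp add: cform_def algebra_simps sum_subtractf)

lemma cform_smult_left: "cform M (c *s u) w = c * cform M u w"
  by (simp add: cform_def sum_distrib_left mult_ac)

text \<open>As \<open>M\<close> and \<open>a\<close> are real, testing against real vectors
  separates the condition into one for the real part of \<open>w\<close> and one for the imaginary
  part.\<close>

lemma nondegenerate_on_kernel_complex:
  assumes M: "nondegenerate_on_kernel M a" and w: "covec_app a w = (0::complex)"
    and z: "\<And>t. covec_app a t = (0::complex) \<Longrightarrow> cform M w t = 0"
  shows "w = 0"
proof -
  have c: "cform M w (\<chi> i. of_real (u $ i)) = 0" if "covec_app a u = 0" for u :: "real^'a"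
  proof (rule z)
    have "covec_app a (\<chi> i. complex_of_real (u $ i)) = of_real (covec_app a u)"
      by (simp add: covec_app_complex covec_app_def)
    then show "covec_app a (\<chi> i. complex_of_real (u $ i)) = 0" using that by simp
  qed
  have nd: "v = 0" if "covec_app a v = 0"
      "\<And>u. covec_app a u = 0 \<Longrightarrow> (\<Sum>i\<in>UNIV. \<Sum>j\<in>UNIV. M $ i $ j * v $ i * u $ j) = 0"
    for v :: "real^'a"
    using M that unfolding nondegenerate_on_kernel_def by blast
  have "(\<chi> i. Re (w $ i)) = 0"
  proof -
    have "covec_app a (\<chi> i. Re (w $ i)) = Re (covec_app a w)"
      by (simp add: covec_app_def)
    moreover have "(\<Sum>i\<in>UNIV. \<Sum>j\<in>UNIV. M $ i $ j * (\<chi> i. Re (w $ i)) $ i * u $ j)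
        = Re (cform M w (\<chi> i. of_real (u $ i)))" for u :: "real^'a"
      by (simp add: cform_def)
    ultimately show ?thesis using w c by (intro nd) simp_all
  qed
  moreover have "(\<chi> i. Im (w $ i)) = 0"
  proof -
    have "covec_app a (\<chi> i. Im (w $ i)) = Im (covec_app a w)"
      by (simp add: covec_app_def)
    moreover have "(\<Sum>i\<in>UNIV. \<Sum>j\<in>UNIV. M $ i $ j * (\<chi> i. Im (w $ i)) $ i * u $ j)
        = Im (cform M w (\<chi> i. of_real (u $ i)))" for u :: "real^'a"
      by (simp add: cform_def)
    ultimately show ?thesis using w c by (intro nd) simp_all
  qed
  ultimately show ?thesis by (simp add: vec_eq_iff complex_eq_iff)
qed

text \<open>If \<open>M\<close> is nondegenerate on the kernel of \<open>a\<close>, then \<open>M + a \<otimes> a\<close> is nondegenerate on the whole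
  space, so that Cramer's rule applies to it. It is transposed here to act on the left argument of the
  form.\<close>

definition augmented_matrix :: "real^'k::finite^'k \<Rightarrow> real^'k \<Rightarrow> complex^'k^'k" where
  "augmented_matrix M a = (\<chi> j i. of_real (M $ i $ j + a $ i * a $ j))"

lemma augmented_matrix_mult:
  "(augmented_matrix M a *v u) $ j = (\<Sum>i\<in>UNIV. of_real (M $ i $ j) * u $ i) + of_real (a $ j) * covec_app a u"
  by (simp add: augmented_matrix_def matrix_vector_mult_def covec_app_complex algebra_simps
      sum.distrib sum_distrib_left)

text \<open>The complex form is bilinear, without conjugation, so skewness of \<open>M\<close> alone
  makes it vanish on the diagonal.\<close>

lemma skew_sum_eq_0:
  fixes u :: "complex^'k::finite"
  assumes "\<And>i j. M $ i $ j = - M $ j $ i"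
  shows "cform M u u = 0"
proof -
  have "cform M u u = - cform M u u"
    unfolding cform_def
    by (subst sum.swap, subst assms) (simp add: sum_negf mult_ac)
  then show ?thesis by simp
qed

lemma augmented_matrix_form:
  assumes "augmented_matrix M a *v u = b"
  shows "cform M u w + covec_app a u * covec_app a w = (\<Sum>j\<in>UNIV. b $ j * w $ j)"
  by (simp add: assms[symmetric] augmented_matrix_mult cform_sum covec_app_complex algebra_simps
      sum.distrib sum_distrib_left sum_distrib_right)

text \<open>Let \<open>u\<close> be in the kernel. Testing the equation against \<open>u\<close>
  itself removes the skew part and leaves the square of \<open>covec_app a u\<close>, so
  \<open>u\<close> lies in the kernel of \<open>a\<close>; the equation then says that
  \<open>cform M u\<close> vanishes identically.\<close>

lemma augmented_matrix_det:
  assumes M: "nondegenerate_on_kernel M a"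
  shows "det (augmented_matrix M a) \<noteq> 0"
proof -
  have sk: "M $ i $ j = - M $ j $ i" for i j using M unfolding nondegenerate_on_kernel_def by blast
  have "u = 0" if u: "augmented_matrix M a *v u = 0" for u
  proof (rule nondegenerate_on_kernel_complex[OF M])
    have eq: "cform M u w + covec_app a u * covec_app a w = 0" for w
      using augmented_matrix_form[OF u, of w] by simp
    then show 1: "covec_app a u = 0" using eq[of u] skew_sum_eq_0[OF sk] by simp
    show "cform M u t = 0" for t using eq[of t] 1 by simp
  qed
  then have "invertible (augmented_matrix M a)"
    using matrix_left_invertible_ker[of "augmented_matrix M a"] invertible_left_inverse by blast
  then show ?thesis by (simp add: invertible_det_nz)
qed

text \<open>An explicit quotient of determinants, so that smooth dependence of the solution on the
  matrix and the right-hand side can be read off.\<close>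

definition cramer_solution :: "complex^'k^'k \<Rightarrow> complex^'k \<Rightarrow> complex^'k::finite" where
  "cramer_solution N b = (\<chi> k. det (\<chi> i j. if j = k then b $ i else N $ i $ j) / det N)"

lemma cramer_solution: "det N \<noteq> 0 \<Longrightarrow> N *v cramer_solution N b = b"
  using cramer[of N "cramer_solution N b" b] by (simp add: cramer_solution_def)

text \<open>The second solution is the Reeb vector; subtracting a multiple of it moves the first one into
  the kernel of \<open>a\<close>.\<close>

definition kernel_solution :: "real^'k^'k \<Rightarrow> real^'k \<Rightarrow> complex^'k \<Rightarrow> complex^'k::finite" where
  "kernel_solution M a b = (let N = augmented_matrix M a; u = cramer_solution N b in
     u - covec_app a u *s cramer_solution N (\<chi> j. of_real (a $ j)))"

lemma kernel_solution:
  assumes M: "nondegenerate_on_kernel M a"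
  shows "covec_app a (kernel_solution M a b) = 0"
    and "covec_app a t = 0 \<Longrightarrow> cform M (kernel_solution M a b) t = (\<Sum>j\<in>UNIV. b $ j * t $ j)"
proof -
  have sk: "M $ i $ j = - M $ j $ i" for i j using M unfolding nondegenerate_on_kernel_def by blast
  let ?N = "augmented_matrix M a"
  define u where "u = cramer_solution ?N b"
  define r where "r = cramer_solution ?N (\<chi> j. of_real (a $ j))"
  have u: "cform M u w + covec_app a u * covec_app a w = (\<Sum>j\<in>UNIV. b $ j * w $ j)" for w
    unfolding u_def by (rule augmented_matrix_form[OF cramer_solution[OF augmented_matrix_det[OF M]]])
  have r: "cform M r w + covec_app a r * covec_app a w = covec_app a w" for w
    unfolding r_def
    using augmented_matrix_form[OF cramer_solution[OF augmented_matrix_det[OF M]], of "\<chi> j. of_real (a $ j)" w]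
    by (simp add: covec_app_complex)
  have sol: "kernel_solution M a b = u - covec_app a u *s r"
    by (simp add: kernel_solution_def u_def r_def Let_def)
  have ker: "cform M r t = 0" if "covec_app a t = 0" for t using r[of t] that by simp
  \<comment> \<open>Testing the equation of \<open>r\<close> against \<open>r\<close> shows that
    \<open>covec_app a r\<close> is 0 or 1. The value 0 forces \<open>r = 0\<close> by
    nondegeneracy; then the equation says that \<open>a\<close> vanishes on every vector, in
    particular on \<open>u\<close>.\<close>
  have "covec_app a u * covec_app a r = covec_app a u"
  proof (cases "covec_app a r = 0")
    case True
    then have "r = 0" using nondegenerate_on_kernel_complex[OF M] ker by blast
    then have "covec_app a u = 0" using r[of u] by (simp add: cform_def covec_app_0)
    then show ?thesis by simp
  next
    case False
    then show ?thesis using r[of r] skew_sum_eq_0[OF sk, of r] by simp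
  qed
  then show "covec_app a (kernel_solution M a b) = 0"
    by (simp add: sol covec_app_diff covec_app_vector_scalar_mult)
  show "cform M (kernel_solution M a b) t = (\<Sum>j\<in>UNIV. b $ j * t $ j)" if "covec_app a t = 0"
    using u[of t] ker[OF that] that by (simp add: sol cform_diff_left cform_smult_left)
qed

lemma smooth_on_det:
  fixes N :: "'a::real_normed_vector \<Rightarrow> complex^'k::finite^'k"
  assumes S: "open S" and N: "\<And>i j. smooth_on S (\<lambda>x. N x $ i $ j)"
  shows "smooth_on S (\<lambda>x. det (N x))"
  unfolding det_def
  by (intro smooth_on_sum[OF S] smooth_on_mult[OF S] smooth_on_const smooth_on_prod[OF S] N)

lemma smooth_on_cramer_solution:
  fixes N :: "'a::real_normed_vector \<Rightarrow> complex^'k::finite^'k"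
  assumes S: "open S" and N: "\<And>i j. smooth_on S (\<lambda>x. N x $ i $ j)" and b: "\<And>i. smooth_on S (\<lambda>x. b x $ i)"
    and nz: "\<And>x. x \<in> S \<Longrightarrow> det (N x) \<noteq> 0"
  shows "smooth_on S (\<lambda>x. cramer_solution (N x) (b x) $ k)"
proof -
  have "smooth_on S (\<lambda>x. det (\<chi> i j. if j = k then b x $ i else N x $ i $ j))"
  proof (rule smooth_on_det[OF S])
    show "smooth_on S (\<lambda>x. (\<chi> i j. if j = k then b x $ i else N x $ i $ j) $ i $ j)" for i j
      using N b by (cases "j = k") simp_all
  qed
  then show ?thesis unfolding cramer_solution_def using smooth_on_det[OF S N] nz
    by (simp add: smooth_on_divide[OF S])
qed

lemma smooth_on_kernel_solution:
  fixes M :: "'a::real_normed_vector \<Rightarrow> real^'k::finite^'k"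
  assumes S: "open S" and M: "\<And>i j. smooth_on S (\<lambda>x. M x $ i $ j)"
    and a: "\<And>i. smooth_on S (\<lambda>x. a x $ i)" and b: "\<And>i. smooth_on S (\<lambda>x. b x $ i)"
    and nd: "\<And>x. x \<in> S \<Longrightarrow> nondegenerate_on_kernel (M x) (a x)"
  shows "smooth_on S (\<lambda>x. kernel_solution (M x) (a x) (b x))"
proof -
  have N: "smooth_on S (\<lambda>x. augmented_matrix (M x) (a x) $ i $ j)" for i j
    unfolding augmented_matrix_def
    using smooth_on_of_real[OF S smooth_on_add[OF S M smooth_on_mult[OF S a a]]] by simp
  have 1: "smooth_on S (\<lambda>x. cramer_solution (augmented_matrix (M x) (a x)) (b x) $ k)" for k
    by (rule smooth_on_cramer_solution[OF S N b augmented_matrix_det[OF nd]])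
  have 2: "smooth_on S (\<lambda>x. cramer_solution (augmented_matrix (M x) (a x)) (\<chi> j. of_real (a x $ j)) $ k)" for k
    by (rule smooth_on_cramer_solution[OF S N _ augmented_matrix_det[OF nd]])
      (use smooth_on_of_real[OF S a] in simp_all)
  have 3: "smooth_on S (\<lambda>x. covec_app (a x) (cramer_solution (augmented_matrix (M x) (a x)) (b x)))"
    unfolding covec_app_def by (intro smooth_on_sum[OF S] smooth_on_scaleR[OF S] a 1)
  have "smooth_on S (\<lambda>x. kernel_solution (M x) (a x) (b x) $ k)" for k
    unfolding kernel_solution_def Let_def
    using smooth_on_diff[OF S 1 smooth_on_mult[OF S 3 2]] by simp
  then show ?thesis by (rule smooth_on_vecI[OF S])
qed

section \<open>Charts and tangent vectors\<close>

locale smooth_manifold =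
  fixes A :: "('m::t2_space, 'k::finite) chart set"
  assumes atlas: "smooth_atlas A"
begin

lemma charts_atD: "c \<in> charts_at A p \<Longrightarrow> c \<in> A" "c \<in> charts_at A p \<Longrightarrow> p \<in> cdom c"
  by (auto simp: charts_at_def)

lemma charts_atI: "c \<in> A \<Longrightarrow> p \<in> cdom c \<Longrightarrow> c \<in> charts_at A p"
  by (auto simp: charts_at_def)

lemma ex_chart: "\<exists>c. c \<in> charts_at A p"
  using atlas unfolding smooth_atlas_def charts_at_def by blast

lemma homeo: "c \<in> A \<Longrightarrow> homeomorphism (cdom c) (cmap c ` cdom c) (cmap c) (cinv c)"
  using atlas unfolding smooth_atlas_def is_chart_def by blast

lemma open_cdom: "c \<in> A \<Longrightarrow> open (cdom c)"
  using atlas unfolding smooth_atlas_def is_chart_def by blast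

lemma open_cmap_cdom: "c \<in> A \<Longrightarrow> open (cmap c ` cdom c)"
  using atlas unfolding smooth_atlas_def is_chart_def by blast

lemma cinv_cmap [simp]: "c \<in> A \<Longrightarrow> p \<in> cdom c \<Longrightarrow> cinv c (cmap c p) = p"
  using homeo unfolding homeomorphism_def by blast

lemma open_cmap_image:
  assumes "c \<in> A" "open W"
  shows "open (cmap c ` (cdom c \<inter> W))"
proof -
  have "openin (top_of_set (cdom c)) (cdom c \<inter> W)" using assms(2) by auto
  from homeomorphism_imp_open_map[OF homeo[OF assms(1)] this] show ?thesis
    using open_cmap_cdom[OF assms(1)] openin_open_trans by blast
qed

lemma open_overlap: "c \<in> A \<Longrightarrow> c' \<in> A \<Longrightarrow> open (cmap c ` (cdom c \<inter> cdom c'))"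
  by (simp add: open_cmap_image open_cdom)

lemma smooth_transition:
  "c \<in> A \<Longrightarrow> c' \<in> A \<Longrightarrow> smooth_on (cmap c ` (cdom c \<inter> cdom c')) (transition c c')"
  using atlas unfolding smooth_atlas_def by blast

lemma transition_cmap [simp]:
  "c \<in> A \<Longrightarrow> p \<in> cdom c \<Longrightarrow> transition c c' (cmap c p) = cmap c' p"
  by (simp add: transition_def)

lemma differentiable_transition:
  "c \<in> charts_at A p \<Longrightarrow> c' \<in> charts_at A p \<Longrightarrow> transition c c' differentiable (at (cmap c p))"
  by (rule smooth_on_differentiable[OF smooth_transition]) (auto simp: charts_at_def)

lemma jac_cocycle:
  assumes c: "c \<in> charts_at A p" "c' \<in> charts_at A p" "c'' \<in> charts_at A p"
  shows "jac c c'' p $ i $ j = (\<Sum>m\<in>UNIV. jac c' c'' p $ i $ m * jac c c' p $ m $ j)"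
proof -
  note cA = charts_atD[OF c(1)] charts_atD[OF c(2)] charts_atD[OF c(3)]
  \<comment> \<open>Outside the common domain of the three charts the transition maps take arbitrary
    values, so their composition rule is available only on this open set.\<close>
  let ?S = "cmap c ` (cdom c \<inter> (cdom c' \<inter> cdom c''))"
  have S: "open ?S" by (rule open_cmap_image) (auto simp: cA open_cdom)
  have x: "cmap c p \<in> ?S" using cA by auto
  have d: "transition c' c'' differentiable (at (transition c c' (cmap c p)))"
    using differentiable_transition[OF c(2,3)] cA by simp
  have "pderiv_at j (transition c c'') (cmap c p) = pderiv_at j (\<lambda>x. transition c' c'' (transition c c' x)) (cmap c p)"
    by (rule pderiv_at_cong[OF S x _ differentiable_transition[OF c(1,3)]]) (use cA in auto)
  also have "\<dots> = (\<Sum>m\<in>UNIV. (pderiv_at j (transition c c') (cmap c p) $ m) *\<^sub>R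
      pderiv_at m (transition c' c'') (transition c c' (cmap c p)))"
    by (rule pderiv_at_compose[OF differentiable_transition[OF c(1,2)] d])
  finally show ?thesis using cA by (simp add: jac_def mult.commute)
qed

lemma jac_self:
  assumes c: "c \<in> charts_at A p"
  shows "jac c c p $ i $ j = (if i = j then 1 else 0)"
proof -
  note cA = charts_atD[OF c]
  have "pderiv_at j (transition c c) (cmap c p) = pderiv_at j (\<lambda>x. x) (cmap c p)"
    by (rule pderiv_at_cong[OF open_cmap_cdom _ _ differentiable_transition[OF c c]]) (use cA in auto)
  also have "\<dots> = axis j 1" by (simp add: pderiv_at_def)
  finally show ?thesis by (simp add: jac_def axis_def)
qed

text \<open>Represents the tangent vector with coordinates \<open>u\<close> in the chart
  \<open>c\<close>; the cocycle rule for the Jacobians makes its coordinates in the other charts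
  consistent.\<close>

definition tangent_vec :: "'m \<Rightarrow> ('m, 'k) chart \<Rightarrow> 'f::real_vector^'k \<Rightarrow> ('m, 'k) chart \<Rightarrow> 'f^'k" where
  "tangent_vec p c u = (\<lambda>c'. if c' \<in> charts_at A p then \<chi> i. \<Sum>j\<in>UNIV. jac c c' p $ i $ j *\<^sub>R u $ j else 0)"

lemma tangent_vec_self [simp]:
  "c \<in> charts_at A p \<Longrightarrow> tangent_vec p c u c = u"
  by (simp add: tangent_vec_def vec_eq_iff jac_self if_distrib[of "\<lambda>r. r *\<^sub>R _"] cong: if_cong)

lemma tangent_spaceI:
  assumes "\<And>c c' i. c \<in> charts_at A p \<Longrightarrow> c' \<in> charts_at A p \<Longrightarrow>
      v c' $ i = (\<Sum>j\<in>UNIV. jac c c' p $ i $ j *\<^sub>R v c $ j)"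
    and "\<And>c. c \<notin> charts_at A p \<Longrightarrow> v c = 0"
  shows "v \<in> tangent_space A p"
  using assms unfolding tangent_space_def by blast

lemma tangent_vec_in_tangent_space:
  assumes c: "c \<in> charts_at A p"
  shows "tangent_vec p c u \<in> tangent_space A p"
proof -
  have "tangent_vec p c u c2 $ i = (\<Sum>m\<in>UNIV. jac c1 c2 p $ i $ m *\<^sub>R tangent_vec p c u c1 $ m)"
    if "c1 \<in> charts_at A p" "c2 \<in> charts_at A p" for c1 c2 i
  proof -
    have "tangent_vec p c u c2 $ i = (\<Sum>j\<in>UNIV. \<Sum>m\<in>UNIV. (jac c1 c2 p $ i $ m * jac c c1 p $ m $ j) *\<^sub>R u $ j)"
      using that by (simp add: tangent_vec_def jac_cocycle[OF c that] scaleR_sum_left)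
    also have "\<dots> = (\<Sum>m\<in>UNIV. jac c1 c2 p $ i $ m *\<^sub>R (\<Sum>j\<in>UNIV. jac c c1 p $ m $ j *\<^sub>R u $ j))"
      by (subst sum.swap) (simp add: scaleR_sum_right)
    finally show ?thesis using that by (simp add: tangent_vec_def)
  qed
  moreover have "tangent_vec p c u c' = 0" if "c' \<notin> charts_at A p" for c'
    using that unfolding tangent_vec_def by simp
  ultimately show ?thesis by (rule tangent_spaceI)
qed

lemma tangent_space_change:
  "v \<in> tangent_space A p \<Longrightarrow> c \<in> charts_at A p \<Longrightarrow> c' \<in> charts_at A p \<Longrightarrow>
    v c' $ i = (\<Sum>j\<in>UNIV. jac c c' p $ i $ j *\<^sub>R v c $ j)"
  unfolding tangent_space_def by blast

lemma tangent_space_eqI: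
  assumes "v \<in> tangent_space A p" "w \<in> tangent_space A p" "c \<in> charts_at A p" "v c = w c"
  shows "v = w"
proof
  fix c'
  show "v c' = w c'"
  proof (cases "c' \<in> charts_at A p")
    case True
    show ?thesis unfolding vec_eq_iff
      using tangent_space_change[OF assms(1,3) True] tangent_space_change[OF assms(2,3) True] assms(4)
      by simp
  next
    case False
    then have "v c' = 0" "w c' = 0" using assms(1,2) unfolding tangent_space_def by blast+
    then show ?thesis by simp
  qed
qed

lemma covec_app_change:
  assumes v: "v \<in> tangent_space A p" and a: "a \<in> cotangent_space A p"
    and c: "c \<in> charts_at A p" "c' \<in> charts_at A p"
  shows "covec_app (a c) (v c) = covec_app (a c') (v c')"
proof -
  have "a c $ j = (\<Sum>i\<in>UNIV. jac c c' p $ i $ j * a c' $ i)" for j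
    using a c unfolding cotangent_space_def by blast
  then have "covec_app (a c) (v c) = (\<Sum>j\<in>UNIV. \<Sum>i\<in>UNIV. (jac c c' p $ i $ j * a c' $ i) *\<^sub>R v c $ j)"
    unfolding covec_app_def by (simp add: scaleR_sum_left)
  also have "\<dots> = (\<Sum>i\<in>UNIV. a c' $ i *\<^sub>R (\<Sum>j\<in>UNIV. jac c c' p $ i $ j *\<^sub>R v c $ j))"
    by (subst sum.swap) (simp add: scaleR_sum_right mult.commute)
  also have "\<dots> = covec_app (a c') (v c')"
    using tangent_space_change[OF v c] unfolding covec_app_def by simp
  finally show ?thesis .
qed

text \<open>The Jacobian from the chain rule cancels against the one in the transformation law of
  \<open>v\<close>. In \<open>CVectI\<close> this is applied to the function
  \<open>\<alpha>(E)\<close>, to compare two charts.\<close>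

lemma directional_derivative_change:
  fixes F :: "'m \<Rightarrow> complex"
  assumes v: "v \<in> tangent_space A p" and c: "c \<in> charts_at A p" "c' \<in> charts_at A p"
    and d: "(\<lambda>x. F (cinv c' x)) differentiable (at (cmap c' p))"
  shows "(\<Sum>i\<in>UNIV. v c $ i * pderiv_at i (\<lambda>x. F (cinv c x)) (cmap c p)) =
         (\<Sum>i\<in>UNIV. v c' $ i * pderiv_at i (\<lambda>x. F (cinv c' x)) (cmap c' p))"
proof -
  note cA = charts_atD[OF c(1)] charts_atD[OF c(2)]
  let ?S = "cmap c ` (cdom c \<inter> cdom c')"
  let ?D = "\<lambda>m. pderiv_at m (\<lambda>x. F (cinv c' x)) (cmap c' p)"
  have S: "open ?S" by (simp add: cA open_overlap)
  have x: "cmap c p \<in> ?S" using cA by auto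
  have d': "(\<lambda>x. F (cinv c' x)) differentiable (at (transition c c' (cmap c p)))"
    using d cA by simp
  have "(\<lambda>x. F (cinv c' (transition c c' x))) differentiable (at (cmap c p))"
    using differentiable_chain_at[OF differentiable_transition[OF c] d'] by (simp add: o_def)
  then have "pderiv_at i (\<lambda>x. F (cinv c' (transition c c' x))) (cmap c p) = pderiv_at i (\<lambda>x. F (cinv c x)) (cmap c p)" for i
    by (rule pderiv_at_cong[OF S x, rotated]) (use cA in auto)
  then have "pderiv_at i (\<lambda>x. F (cinv c x)) (cmap c p) = (\<Sum>m\<in>UNIV. jac c c' p $ m $ i *\<^sub>R ?D m)" for i
    using pderiv_at_compose[OF differentiable_transition[OF c] d'] cA by (simp add: jac_def)
  then have "(\<Sum>i\<in>UNIV. v c $ i * pderiv_at i (\<lambda>x. F (cinv c x)) (cmap c p))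
     = (\<Sum>m\<in>UNIV. (\<Sum>i\<in>UNIV. jac c c' p $ m $ i *\<^sub>R v c $ i) * ?D m)"
    by (simp add: sum_distrib_left sum_distrib_right, subst sum.swap)
      (simp add: scaleR_conv_of_real mult_ac)
  then show ?thesis using tangent_space_change[OF v c] by simp
qed

section \<open>Vector fields\<close>

lemma VectD: "X \<in> Vect A \<Longrightarrow> X p \<in> tangent_space A p"
  "X \<in> Vect A \<Longrightarrow> c \<in> A \<Longrightarrow> smooth_on (cmap c ` cdom c) (local_rep c X)"
  by (auto simp: Vect_def)

lemma differentiable_local_rep:
  "X \<in> Vect A \<Longrightarrow> c \<in> charts_at A p \<Longrightarrow> local_rep c X differentiable (at (cmap c p))"
  by (rule smooth_on_differentiable[OF VectD(2)]) (auto simp: charts_at_def)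

lemma local_rep_cmap [simp]: "c \<in> charts_at A p \<Longrightarrow> local_rep c X (cmap c p) = X p c"
  by (simp add: local_rep_def charts_at_def)

text \<open>Obtained by differentiating the transformation law of \<open>X\<close> on the overlap of
  the charts. The last term, with second derivatives of the transition map, is the part that is not
  tensorial.\<close>

lemma pderiv_at_local_rep_change:
  assumes X: "X \<in> Vect A" and c: "c \<in> charts_at A p" "c' \<in> charts_at A p"
  shows "(\<Sum>m\<in>UNIV. jac c c' p $ m $ l *\<^sub>R (pderiv_at m (local_rep c' X) (cmap c' p) $ i)) =
    (\<Sum>j\<in>UNIV. jac c c' p $ i $ j *\<^sub>R (pderiv_at l (local_rep c X) (cmap c p) $ j)
       + (pderiv_at l (pderiv_at j (transition c c')) (cmap c p) $ i) *\<^sub>R (X p c $ j))"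
proof -
  note cA = charts_atD[OF c(1)] charts_atD[OF c(2)]
  let ?S = "cmap c ` (cdom c \<inter> cdom c')" and ?x = "cmap c p" and ?\<phi> = "transition c c'"
  have S: "open ?S" by (simp add: cA open_overlap)
  have x: "?x \<in> ?S" using cA by auto
  have sm: "smooth_on ?S ?\<phi>" using cA by (simp add: smooth_transition)
  have rep: "local_rep c' X (?\<phi> y) $ i = (\<Sum>j\<in>UNIV. (pderiv_at j ?\<phi> y $ i) *\<^sub>R (local_rep c X y $ j))"
    if "y \<in> ?S" for y
  proof -
    from that obtain q where q: "q \<in> cdom c" "q \<in> cdom c'" "y = cmap c q" by auto
    then have cq: "c \<in> charts_at A q" "c' \<in> charts_at A q" using cA by (auto simp: charts_at_def)
    show ?thesis
      using tangent_space_change[OF VectD(1)[OF X] cq, of i] q cq cA by (simp add: jac_def)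
  qed
  have dX: "local_rep c X differentiable (at ?x)" by (rule differentiable_local_rep[OF X c(1)])
  have dX': "local_rep c' X differentiable (at (?\<phi> ?x))"
    using differentiable_local_rep[OF X c(2)] cA by simp
  have dp: "pderiv_at j ?\<phi> differentiable (at ?x)" for j
    by (rule smooth_on_differentiable[OF smooth_on_pderiv_at[OF sm] x])
  have dc: "(\<lambda>y. local_rep c' X (?\<phi> y)) differentiable (at ?x)"
    using differentiable_chain_at[OF differentiable_transition[OF c] dX'] by (simp add: o_def)
  have "pderiv_at l (\<lambda>y. local_rep c' X (?\<phi> y) $ i) ?x
      = (\<Sum>m\<in>UNIV. jac c c' p $ m $ l *\<^sub>R (pderiv_at m (local_rep c' X) (cmap c' p) $ i))"
    using pderiv_at_vec_nth[OF dc] pderiv_at_compose[OF differentiable_transition[OF c] dX'] cA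
    by (simp add: jac_def)
  moreover have "pderiv_at l (\<lambda>y. local_rep c' X (?\<phi> y) $ i) ?x
      = pderiv_at l (\<lambda>y. \<Sum>j\<in>UNIV. (pderiv_at j ?\<phi> y $ i) *\<^sub>R (local_rep c X y $ j)) ?x"
    by (rule pderiv_at_cong[OF S x rep differentiable_vec_nth[OF dc]])
  moreover have "pderiv_at l (\<lambda>y. \<Sum>j\<in>UNIV. (pderiv_at j ?\<phi> y $ i) *\<^sub>R (local_rep c X y $ j)) ?x
     = (\<Sum>j\<in>UNIV. pderiv_at l (\<lambda>y. (pderiv_at j ?\<phi> y $ i) *\<^sub>R (local_rep c X y $ j)) ?x)"
    by (rule pderiv_at_sum)
      (rule differentiable_bilinear[OF bounded_bilinear_scaleR] differentiable_vec_nth dp dX)+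
  moreover have "pderiv_at l (\<lambda>y. (pderiv_at j ?\<phi> y $ i) *\<^sub>R (local_rep c X y $ j)) ?x =
      jac c c' p $ i $ j *\<^sub>R (pderiv_at l (local_rep c X) ?x $ j)
       + (pderiv_at l (pderiv_at j ?\<phi>) ?x $ i) *\<^sub>R (X p c $ j)" for j
    using pderiv_at_scaleR[OF differentiable_vec_nth[OF dp] differentiable_vec_nth[OF dX]]
      pderiv_at_vec_nth[OF dp] pderiv_at_vec_nth[OF dX] c cA by (simp add: jac_def)
  ultimately show ?thesis by simp
qed

lemma bracket_at: "c \<in> charts_at A p \<Longrightarrow> bracket A X Y p c $ j =
   (\<Sum>i\<in>UNIV. X p c $ i * pderiv_at i (local_rep c Y) (cmap c p) $ j
            - Y p c $ i * pderiv_at i (local_rep c X) (cmap c p) $ j)"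
  by (simp add: bracket_def)

text \<open>The obstruction to being a vector is the Hessian of the transition map evaluated on
  \<open>X\<close> and \<open>Y\<close>. It is symmetric in \<open>X\<close> and \<open>Y\<close>,
  hence cancels in the bracket.\<close>

lemma derivative_along_change:
  assumes X: "X \<in> Vect A" and Y: "Y \<in> Vect A" and c: "c \<in> charts_at A p" "c' \<in> charts_at A p"
  shows "(\<Sum>m\<in>UNIV. X p c' $ m * pderiv_at m (local_rep c' Y) (cmap c' p) $ i) =
    (\<Sum>j\<in>UNIV. jac c c' p $ i $ j *\<^sub>R (\<Sum>l\<in>UNIV. X p c $ l * pderiv_at l (local_rep c Y) (cmap c p) $ j))
    + (\<Sum>l\<in>UNIV. \<Sum>j\<in>UNIV. (pderiv_at l (pderiv_at j (transition c c')) (cmap c p) $ i) *\<^sub>R (X p c $ l * Y p c $ j))"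
proof -
  have "(\<Sum>m\<in>UNIV. X p c' $ m * pderiv_at m (local_rep c' Y) (cmap c' p) $ i) =
    (\<Sum>m\<in>UNIV. \<Sum>l\<in>UNIV. X p c $ l * (jac c c' p $ m $ l *\<^sub>R pderiv_at m (local_rep c' Y) (cmap c' p) $ i))"
    by (simp add: tangent_space_change[OF VectD(1)[OF X] c] sum_distrib_right)
  also have "\<dots> = (\<Sum>l\<in>UNIV. X p c $ l *
      (\<Sum>m\<in>UNIV. jac c c' p $ m $ l *\<^sub>R (pderiv_at m (local_rep c' Y) (cmap c' p) $ i)))"
    by (subst sum.swap) (simp add: sum_distrib_left)
  also have "\<dots> = (\<Sum>l\<in>UNIV. \<Sum>j\<in>UNIV. X p c $ l * (jac c c' p $ i $ j *\<^sub>R (pderiv_at l (local_rep c Y) (cmap c p) $ j)))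
    + (\<Sum>l\<in>UNIV. \<Sum>j\<in>UNIV. (pderiv_at l (pderiv_at j (transition c c')) (cmap c p) $ i) *\<^sub>R (X p c $ l * Y p c $ j))"
    by (simp add: pderiv_at_local_rep_change[OF Y c] sum_distrib_left distrib_left sum.distrib)
  also have "(\<Sum>l\<in>UNIV. \<Sum>j\<in>UNIV. X p c $ l * (jac c c' p $ i $ j *\<^sub>R (pderiv_at l (local_rep c Y) (cmap c p) $ j)))
     = (\<Sum>j\<in>UNIV. jac c c' p $ i $ j *\<^sub>R (\<Sum>l\<in>UNIV. X p c $ l * pderiv_at l (local_rep c Y) (cmap c p) $ j))"
    by (subst sum.swap) (simp add: scaleR_sum_right)
  finally show ?thesis .
qed

lemma bracket_in_tangent_space:
  assumes X: "X \<in> Vect A" and Y: "Y \<in> Vect A"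
  shows "bracket A X Y p \<in> tangent_space A p"
proof -
  have "bracket A X Y p c' $ i = (\<Sum>j\<in>UNIV. jac c c' p $ i $ j *\<^sub>R bracket A X Y p c $ j)"
    if c: "c \<in> charts_at A p" "c' \<in> charts_at A p" for c c' i
  proof -
    note cA = charts_atD[OF c(1)] charts_atD[OF c(2)]
    let ?H = "\<lambda>l j. pderiv_at l (pderiv_at j (transition c c')) (cmap c p) $ i"
    have H: "?H l j = ?H j l" for l j
      using pderiv_at_commute[OF open_overlap _ smooth_transition, of c c' "cmap c p" l j] cA by auto
    have "(\<Sum>l\<in>UNIV. \<Sum>j\<in>UNIV. ?H l j *\<^sub>R (X p c $ l * Y p c $ j))
        = (\<Sum>l\<in>UNIV. \<Sum>j\<in>UNIV. ?H l j *\<^sub>R (Y p c $ l * X p c $ j))"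
      by (subst sum.swap, subst H) (simp add: mult.commute)
    then show ?thesis
      using derivative_along_change[OF X Y c, of i] derivative_along_change[OF Y X c, of i]
      by (simp add: bracket_at[OF c(1)] bracket_at[OF c(2)] sum_subtractf scaleR_diff_right)
  qed
  moreover have "bracket A X Y p c = 0" if "c \<notin> charts_at A p" for c
    using that unfolding bracket_def by simp
  ultimately show ?thesis by (rule tangent_spaceI)
qed

lemma local_rep_bracket:
  assumes c: "c \<in> A" and x: "x \<in> cmap c ` cdom c"
  shows "local_rep c (bracket A X Y) x $ j =
   (\<Sum>i\<in>UNIV. local_rep c X x $ i * pderiv_at i (local_rep c Y) x $ j
            - local_rep c Y x $ i * pderiv_at i (local_rep c X) x $ j)"
proof -
  from x obtain p where p: "p \<in> cdom c" "x = cmap c p" by auto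
  then have "c \<in> charts_at A p" using c by (simp add: charts_at_def)
  then show ?thesis using p by (simp add: bracket_at)
qed

lemma bracket_in_Vect:
  assumes X: "X \<in> Vect A" and Y: "Y \<in> Vect A"
  shows "bracket A X Y \<in> Vect A"
proof -
  have "smooth_on (cmap c ` cdom c) (local_rep c (bracket A X Y))" if c: "c \<in> A" for c
  proof (rule smooth_on_vecI[OF open_cmap_cdom[OF c]])
    fix j
    have S: "open (cmap c ` cdom c)" by (rule open_cmap_cdom[OF c])
    have "smooth_on (cmap c ` cdom c) (\<lambda>x. \<Sum>i\<in>UNIV. local_rep c X x $ i * pderiv_at i (local_rep c Y) x $ j
            - local_rep c Y x $ i * pderiv_at i (local_rep c X) x $ j)"
      by (intro smooth_on_sum[OF S] smooth_on_diff[OF S] smooth_on_mult[OF S] smooth_on_vec_nth[OF S]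
          smooth_on_pderiv_at VectD(2) X Y c)
    then show "smooth_on (cmap c ` cdom c) (\<lambda>x. local_rep c (bracket A X Y) x $ j)"
      by (rule smooth_on_cong[OF S, rotated]) (simp add: local_rep_bracket[OF c])
  qed
  then show ?thesis using bracket_in_tangent_space[OF X Y] by (simp add: Vect_def)
qed

lemma tangent_space_add:
  assumes "v \<in> tangent_space A p" "w \<in> tangent_space A p"
  shows "(\<lambda>c. v c + w c) \<in> tangent_space A p"
proof (rule tangent_spaceI)
  show "(v c' + w c') $ i = (\<Sum>j\<in>UNIV. jac c c' p $ i $ j *\<^sub>R (v c + w c) $ j)"
    if "c \<in> charts_at A p" "c' \<in> charts_at A p" for c c' i
    using tangent_space_change[OF assms(1) that] tangent_space_change[OF assms(2) that]
    by (simp add: scaleR_add_right sum.distrib)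
  show "v c + w c = 0" if "c \<notin> charts_at A p" for c
  proof -
    have "v c = 0" "w c = 0" using assms that unfolding tangent_space_def by blast+
    then show ?thesis by simp
  qed
qed

lemma tangent_space_smult:
  fixes r :: complex
  assumes "v \<in> tangent_space A p"
  shows "(\<lambda>c. r *s v c) \<in> tangent_space A p"
proof (rule tangent_spaceI)
  show "(r *s v c') $ i = (\<Sum>j\<in>UNIV. jac c c' p $ i $ j *\<^sub>R (r *s v c) $ j)"
    if "c \<in> charts_at A p" "c' \<in> charts_at A p" for c c' i
    using tangent_space_change[OF assms that] by (simp add: sum_distrib_left)
  show "r *s v c = 0" if "c \<notin> charts_at A p" for c
  proof -
    have "v c = 0" using assms that unfolding tangent_space_def by blast
    then show ?thesis by simp
  qed
qed

section \<open>Module operations and the laws of the Lie bracket\<close>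

lemma vf_add_in_Vect: "X \<in> Vect A \<Longrightarrow> Y \<in> Vect A \<Longrightarrow> vf_add X Y \<in> Vect A"
  unfolding Vect_def vf_add_def local_rep_def
  by (auto intro!: tangent_space_add smooth_on_add open_cmap_cdom)

lemma vf_mult_in_Vect:
  assumes f: "smooth_fun_on A UNIV f" and X: "X \<in> Vect A"
  shows "vf_mult f X \<in> Vect A"
proof -
  have "smooth_on (cmap c ` cdom c) (local_rep c (vf_mult f X))" if c: "c \<in> A" for c
  proof -
    have S: "open (cmap c ` cdom c)" using c by (rule open_cmap_cdom)
    have "smooth_on (cmap c ` cdom c) (\<lambda>x. f (cinv c x))"
      using f c unfolding smooth_fun_on_def by (metis Int_UNIV_right)
    from smooth_on_mult[OF S this smooth_on_vec_nth[OF S VectD(2)[OF X c]]]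
    show ?thesis
      by (intro smooth_on_vecI[OF S]) (simp add: local_rep_def vf_mult_def)
  qed
  then show ?thesis using tangent_space_smult[OF VectD(1)[OF X]]
    unfolding Vect_def vf_mult_def by blast
qed

lemma smooth_fun_on_const: "smooth_fun_on A W (\<lambda>_. r)"
  by (simp add: smooth_fun_on_def smooth_on_const)

lemma vf_minus_eq_mult: "vf_minus X = vf_mult (\<lambda>_. - 1) X"
  by (simp add: vf_minus_def vf_mult_def vec_eq_iff fun_eq_iff)

lemma vf_minus_in_Vect: "X \<in> Vect A \<Longrightarrow> vf_minus X \<in> Vect A"
  unfolding vf_minus_eq_mult by (rule vf_mult_in_Vect[OF smooth_fun_on_const])

lemma vf_eqI:
  assumes "X \<in> Vect A" "Y \<in> Vect A" "\<And>p c. c \<in> charts_at A p \<Longrightarrow> X p c = Y p c"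
  shows "X = Y"
proof
  fix p
  obtain c where "c \<in> charts_at A p" using ex_chart by blast
  then show "X p = Y p"
    by (intro tangent_space_eqI[OF VectD(1)[OF assms(1)] VectD(1)[OF assms(2)] _ assms(3)])
qed

lemma bracket_skew: "bracket A X Y = vf_minus (bracket A Y X)"
  by (auto simp: bracket_def vf_minus_def fun_eq_iff vec_eq_iff sum_negf[symmetric])

lemma bracket_add_right:
  assumes "X \<in> Vect A" "Y \<in> Vect A" "Z \<in> Vect A"
  shows "bracket A X (vf_add Y Z) = vf_add (bracket A X Y) (bracket A X Z)"
proof (rule vf_eqI)
  fix p c assume c: "c \<in> charts_at A p"
  have "pderiv_at i (local_rep c (vf_add Y Z)) (cmap c p)
      = pderiv_at i (local_rep c Y) (cmap c p) + pderiv_at i (local_rep c Z) (cmap c p)" for i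
    using pderiv_at_add[OF differentiable_local_rep[OF assms(2) c] differentiable_local_rep[OF assms(3) c]]
    by (simp add: local_rep_def[abs_def] vf_add_def)
  then show "bracket A X (vf_add Y Z) p c = vf_add (bracket A X Y) (bracket A X Z) p c"
    by (simp add: vec_eq_iff bracket_at[OF c] vf_add_def sum.distrib[symmetric] algebra_simps)
qed (intro bracket_in_Vect vf_add_in_Vect assms)+

lemma vf_minus_add: "vf_minus (vf_add X Y) = vf_add (vf_minus X) (vf_minus Y)"
  by (simp add: vf_minus_def vf_add_def)

lemma bracket_add_left:
  assumes "X \<in> Vect A" "Y \<in> Vect A" "Z \<in> Vect A"
  shows "bracket A (vf_add X Y) Z = vf_add (bracket A X Z) (bracket A Y Z)"
  using bracket_add_right[OF assms(3,1,2)] bracket_skew vf_minus_add by metis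

text \<open>The Leibniz correction is a multiple of the field that \<open>f\<close> multiplies. A
  contact form does not see it when this field is tangent to \<open>\<xi>\<close>; balancedness of
  \<open>B\<close> rests on this.\<close>

lemma bracket_mult_left:
  assumes f: "smooth_fun_on A UNIV f" and X: "X \<in> Vect A" and Y: "Y \<in> Vect A" and c: "c \<in> charts_at A p"
  shows "bracket A (vf_mult f X) Y p c = f p *s bracket A X Y p c -
    (\<Sum>i\<in>UNIV. Y p c $ i * pderiv_at i (\<lambda>x. f (cinv c x)) (cmap c p)) *s X p c"
proof -
  note cA = charts_atD[OF c]
  have df: "(\<lambda>x. f (cinv c x)) differentiable (at (cmap c p))"
    by (rule smooth_on_differentiable[where S="cmap c ` (cdom c \<inter> UNIV)"])
      (use f cA in \<open>auto simp: smooth_fun_on_def\<close>)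
  have dX: "local_rep c X differentiable (at (cmap c p))" by (rule differentiable_local_rep[OF X c])
  have fX: "vf_mult f X \<in> Vect A" by (rule vf_mult_in_Vect[OF f X])
  have "pderiv_at i (local_rep c (vf_mult f X)) (cmap c p) $ j
      = f p * pderiv_at i (local_rep c X) (cmap c p) $ j + pderiv_at i (\<lambda>x. f (cinv c x)) (cmap c p) * X p c $ j" for i j
  proof -
    have "pderiv_at i (local_rep c (vf_mult f X)) (cmap c p) $ j
        = pderiv_at i (\<lambda>x. f (cinv c x) * local_rep c X x $ j) (cmap c p)"
      using pderiv_at_vec_nth[OF differentiable_local_rep[OF fX c]]
      by (simp add: local_rep_def vf_mult_def)
    also have "\<dots> = f p * pderiv_at i (local_rep c X) (cmap c p) $ j + pderiv_at i (\<lambda>x. f (cinv c x)) (cmap c p) * X p c $ j"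
      using pderiv_at_mult[OF df differentiable_vec_nth[OF dX]] pderiv_at_vec_nth[OF dX] c cA by simp
    finally show ?thesis .
  qed
  then show ?thesis
    by (simp add: vec_eq_iff bracket_at[OF c] vf_mult_def algebra_simps sum.distrib sum_subtractf
        sum_distrib_left sum_distrib_right)
qed

lemma bracket_scale_left:
  assumes X: "X \<in> Vect A" and Y: "Y \<in> Vect A"
  shows "bracket A (vf_mult (\<lambda>_. r) X) Y = vf_mult (\<lambda>_. r) (bracket A X Y)"
proof (rule vf_eqI)
  fix p c assume c: "c \<in> charts_at A p"
  show "bracket A (vf_mult (\<lambda>_. r) X) Y p c = vf_mult (\<lambda>_. r) (bracket A X Y) p c"
    unfolding bracket_mult_left[OF smooth_fun_on_const X Y c] by (simp add: vf_mult_def pderiv_at_const)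
qed (intro bracket_in_Vect vf_mult_in_Vect smooth_fun_on_const X Y)+

lemma vf_minus_mult: "vf_minus (vf_mult f X) = vf_mult f (vf_minus X)"
  by (simp add: vf_minus_def vf_mult_def vec_eq_iff fun_eq_iff)

lemma bracket_scale_right:
  assumes X: "X \<in> Vect A" and Y: "Y \<in> Vect A"
  shows "bracket A X (vf_mult (\<lambda>_. r) Y) = vf_mult (\<lambda>_. r) (bracket A X Y)"
  using bracket_scale_left[OF Y X] bracket_skew vf_minus_mult by metis

text \<open>With this expansion the Jacobi identity is a cancellation of summands, since \<open>D2\<close> is
  symmetric in its first two arguments.\<close>

lemma bracket_bracket_at:
  assumes W: "W \<in> Vect A" and X: "X \<in> Vect A" and Y: "Y \<in> Vect A" and c: "c \<in> charts_at A p"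
  defines "D \<equiv> \<lambda>X Y Z j. \<Sum>l\<in>UNIV. \<Sum>i\<in>UNIV. X p c $ l *
      (pderiv_at l (local_rep c Y) (cmap c p) $ i * pderiv_at i (local_rep c Z) (cmap c p) $ j)"
    and "D2 \<equiv> \<lambda>X Y Z j. \<Sum>l\<in>UNIV. \<Sum>i\<in>UNIV. X p c $ l * (Y p c $ i *
      pderiv_at l (pderiv_at i (local_rep c Z)) (cmap c p) $ j)"
  shows "bracket A W (bracket A X Y) p c $ j = D W X Y j + D2 W X Y j - D W Y X j - D2 W Y X j
      - D X Y W j + D Y X W j"
proof -
  note cA = charts_atD[OF c]
  let ?S = "cmap c ` cdom c" and ?x = "cmap c p"
  have S: "open ?S" using cA by (simp add: open_cmap_cdom)
  have x: "?x \<in> ?S" using cA by auto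
  have d: "local_rep c X differentiable (at ?x)" "pderiv_at i (local_rep c X) differentiable (at ?x)"
    if "X \<in> Vect A" for X i
    using smooth_on_differentiable[OF _ x] smooth_on_pderiv_at VectD(2)[OF that cA(1)] by blast+
  let ?t = "\<lambda>X Y i y. local_rep c X y $ i * pderiv_at i (local_rep c Y) y $ j"
  have dt: "?t X Y i differentiable (at ?x)" if "X \<in> Vect A" "Y \<in> Vect A" for X Y i
    by (intro differentiable_bilinear[OF bounded_bilinear_mult] differentiable_vec_nth d that)
  have pt: "pderiv_at l (?t X Y i) ?x =
      X p c $ i * pderiv_at l (pderiv_at i (local_rep c Y)) ?x $ j +
      pderiv_at l (local_rep c X) ?x $ i * pderiv_at i (local_rep c Y) ?x $ j"
    if "X \<in> Vect A" "Y \<in> Vect A" for X Y i l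
    using pderiv_at_mult[OF differentiable_vec_nth[OF d(1)[OF that(1)]] differentiable_vec_nth[OF d(2)[OF that(2)]]]
      pderiv_at_vec_nth[OF d(1)[OF that(1)]] pderiv_at_vec_nth[OF d(2)[OF that(2)]] c by simp
  have pb: "pderiv_at l (local_rep c (bracket A X Y)) ?x $ j =
     (\<Sum>i\<in>UNIV. pderiv_at l (?t X Y i) ?x - pderiv_at l (?t Y X i) ?x)" for l
  proof -
    have dB: "(\<lambda>y. local_rep c (bracket A X Y) y $ j) differentiable (at ?x)"
      by (intro differentiable_vec_nth d bracket_in_Vect X Y)
    have "pderiv_at l (local_rep c (bracket A X Y)) ?x $ j = pderiv_at l (\<lambda>y. local_rep c (bracket A X Y) y $ j) ?x"
      using pderiv_at_vec_nth[OF d(1)[OF bracket_in_Vect[OF X Y]]] by simp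
    also have "\<dots> = pderiv_at l (\<lambda>y. \<Sum>i\<in>UNIV. ?t X Y i y + - ?t Y X i y) ?x"
      by (rule pderiv_at_cong[OF S x _ dB]) (simp add: local_rep_bracket[OF cA(1)])
    also have "\<dots> = (\<Sum>i\<in>UNIV. pderiv_at l (\<lambda>y. ?t X Y i y + - ?t Y X i y) ?x)"
      by (intro pderiv_at_sum differentiable_add differentiable_minus dt X Y)
    also have "\<dots> = (\<Sum>i\<in>UNIV. pderiv_at l (?t X Y i) ?x - pderiv_at l (?t Y X i) ?x)"
      using pderiv_at_add[OF dt[OF X Y] differentiable_minus[OF dt[OF Y X]]] pderiv_at_minus[OF dt[OF Y X]] by simp
    finally show ?thesis .
  qed
  have 1: "(\<Sum>l\<in>UNIV. W p c $ l * pderiv_at l (local_rep c (bracket A X Y)) ?x $ j)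
      = D W X Y j + D2 W X Y j - D W Y X j - D2 W Y X j"
    by (simp add: pb pt[OF X Y] pt[OF Y X] D_def D2_def sum_distrib_left algebra_simps sum.distrib sum_subtractf)
  have "(\<Sum>l\<in>UNIV. bracket A X Y p c $ l * pderiv_at l (local_rep c W) ?x $ j) =
     (\<Sum>l\<in>UNIV. \<Sum>i\<in>UNIV. X p c $ i * (pderiv_at i (local_rep c Y) ?x $ l * pderiv_at l (local_rep c W) ?x $ j))
   - (\<Sum>l\<in>UNIV. \<Sum>i\<in>UNIV. Y p c $ i * (pderiv_at i (local_rep c X) ?x $ l * pderiv_at l (local_rep c W) ?x $ j))"
    by (simp add: bracket_at[OF c] sum_distrib_right left_diff_distrib mult.assoc sum_subtractf)
  also have "\<dots> = D X Y W j - D Y X W j"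
    unfolding D_def by (subst sum.swap, subst (2) sum.swap) (rule refl)
  finally show ?thesis
    using 1 by (simp add: bracket_at[OF c, of W "bracket A X Y"] sum_subtractf)
qed

lemma jacobi_identity:
  assumes V: "V \<in> Vect A" and X: "X \<in> Vect A" and Y: "Y \<in> Vect A"
  shows "bracket A V (bracket A X Y) = vf_add (bracket A (bracket A V X) Y) (bracket A X (bracket A V Y))"
proof (rule vf_eqI)
  fix p c assume c: "c \<in> charts_at A p"
  note cA = charts_atD[OF c]
  define D2 where "D2 X Y Z j = (\<Sum>l\<in>UNIV. \<Sum>i\<in>UNIV. X p c $ l * (Y p c $ i *
      pderiv_at l (pderiv_at i (local_rep c Z)) (cmap c p) $ j))" for X Y Z :: "('m, 'k) vfield" and j
  have D2: "D2 X Y Z j = D2 Y X Z j" if "Z \<in> Vect A" for X Y Z j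
  proof -
    have "pderiv_at l (pderiv_at i (local_rep c Z)) (cmap c p) = pderiv_at i (pderiv_at l (local_rep c Z)) (cmap c p)" for l i
      by (rule pderiv_at_commute[OF open_cmap_cdom[OF cA(1)] _ VectD(2)[OF that cA(1)]]) (use cA in auto)
    then show ?thesis unfolding D2_def by (subst sum.swap) (simp add: mult.left_commute)
  qed
  \<comment> \<open>Turns the inner bracket to the right, so that the expansion applies to all three
    double brackets.\<close>
  have "bracket A (bracket A V X) Y p c $ j = - bracket A Y (bracket A V X) p c $ j" for j
    by (subst bracket_skew) (simp add: vf_minus_def)
  then show "bracket A V (bracket A X Y) p c = vf_add (bracket A (bracket A V X) Y) (bracket A X (bracket A V Y)) p c"
    using bracket_bracket_at[OF V X Y c, folded D2_def] bracket_bracket_at[OF Y V X c, folded D2_def]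
      bracket_bracket_at[OF X V Y c, folded D2_def] D2[OF V, of X Y] D2[OF X, of Y V] D2[OF Y, of X V]
    by (simp add: vec_eq_iff vf_add_def)
qed (intro bracket_in_Vect vf_add_in_Vect V X Y)+

text \<open>The Jacobian is made of derivatives in the coordinates of \<open>c\<close>, but
  smoothness is wanted in those of \<open>c'\<close>; the transition from \<open>c'\<close> back to
  \<open>c\<close> connects them.\<close>

lemma smooth_on_jac:
  assumes "c \<in> A" "c' \<in> A"
  shows "smooth_on (cmap c' ` (cdom c' \<inter> cdom c)) (\<lambda>y. jac c c' (cinv c' y) $ i $ j)"
proof -
  let ?S = "cmap c' ` (cdom c' \<inter> cdom c)" and ?T = "cmap c ` (cdom c \<inter> cdom c')"
  have S: "open ?S" "open ?T" using assms by (simp_all add: open_overlap)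
  have "smooth_on ?S (\<lambda>y. pderiv_at j (transition c c') (transition c' c y))"
    by (rule smooth_on_compose[OF S _ smooth_on_pderiv_at[OF smooth_transition] smooth_transition])
      (use assms in auto)
  from smooth_on_vec_nth[OF S(1) this] show ?thesis
    by (simp add: jac_def transition_def)
qed

text \<open>The local field \<open>f\<close>, given in coordinates, is multiplied by a bump function
  and extended by 0. The statement keeps \<open>\<rho>\<close> so that the extension is visibly a
  multiple of \<open>f\<close> at each point: linear conditions on \<open>f\<close>, such as lying
  in the kernel of a contact form, survive.\<close>

lemma bump_extension:
  fixes f :: "real^'k \<Rightarrow> complex^'k"
  assumes c: "c \<in> A" and U: "open U" "U \<subseteq> cmap c ` cdom c" and f: "smooth_on U f" and x: "x \<in> U"
  obtains Y \<rho> where "Y \<in> Vect A" "\<rho> x = (1::real)"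
    "\<And>q. q \<in> cdom c \<Longrightarrow> cmap c q \<in> U \<Longrightarrow> Y q c = \<rho> (cmap c q) *\<^sub>R f (cmap c q)"
    "\<And>q. \<not> (q \<in> cdom c \<and> cmap c q \<in> U) \<Longrightarrow> Y q = (\<lambda>_. 0)"
proof -
  \<comment> \<open>A closed ball is taken, so that its preimage \<open>K\<close> in the manifold is
    compact and still contained in \<open>G\<close>.\<close>
  obtain d where d: "d > 0" "cball x d \<subseteq> U" using U(1) x open_contains_cball by blast
  obtain \<rho> :: "real^'k \<Rightarrow> real" where \<rho>: "smooth_on UNIV \<rho>" "\<rho> x = 1" "\<And>y. y \<notin> ball x d \<Longrightarrow> \<rho> y = 0"
    using bump_function[OF d(1)] by blast
  define g where "g y = \<rho> y *\<^sub>R f y" for y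
  have g: "smooth_on U g" unfolding g_def
    by (rule smooth_on_scaleR[OF U(1) smooth_on_subset[OF \<rho>(1)] f]) simp
  define G where "G = cinv c ` U"
  define Y where "Y q = (if q \<in> G then tangent_vec q c (g (cmap c q)) else (\<lambda>_. 0))" for q
  have contc: "continuous_on (cmap c ` cdom c) (cinv c)" "continuous_on (cdom c) (cmap c)"
    using homeo[OF c] unfolding homeomorphism_def by blast+
  have Gc: "G \<subseteq> cdom c" and cG: "\<And>q. q \<in> G \<Longrightarrow> cmap c q \<in> U" using U(2) c by (auto simp: G_def)
  have Giff: "q \<in> G \<longleftrightarrow> q \<in> cdom c \<and> cmap c q \<in> U" for q
    using Gc cG c unfolding G_def by (metis cinv_cmap image_eqI subsetD)
  have "G = cdom c \<inter> cmap c -` U" using Giff by auto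
  then have oG: "open G" using contc(2) open_cdom[OF c] U(1) continuous_on_open_vimage
    by (metis inf_commute)
  define K where "K = cinv c ` cball x d"
  have "compact K" unfolding K_def
    by (rule compact_continuous_image) (use contc(1) d U in \<open>auto intro: continuous_on_subset\<close>)
  \<comment> \<open>Here the Hausdorff property enters: a compact set is closed.\<close>
  then have oK: "open (- K)" by (simp add: compact_imp_closed open_Compl)
  have YK: "Y q = (\<lambda>_. 0)" if "q \<notin> K" for q
  proof (cases "q \<in> G")
    case True
    then have q: "q \<in> cdom c" "cmap c q \<in> U" using Giff by auto
    then have "cmap c q \<notin> ball x d" using that c unfolding K_def
      by (metis ball_subset_cball cinv_cmap image_eqI subsetD)
    then have "g (cmap c q) = 0" by (simp add: g_def \<rho>(3))
    then show ?thesis using True by (simp add: Y_def tangent_vec_def fun_eq_iff vec_eq_iff)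
  qed (simp add: Y_def)
  have tan: "Y q \<in> tangent_space A q" for q
  proof (cases "q \<in> G")
    case True
    then have "c \<in> charts_at A q" using Giff c by (simp add: charts_at_def)
    then show ?thesis using True by (simp add: Y_def tangent_vec_in_tangent_space)
  next
    case False
    then show ?thesis unfolding Y_def by (simp, intro tangent_spaceI) auto
  qed
  have "smooth_on (cmap c' ` cdom c') (local_rep c' Y)" if c': "c' \<in> A" for c'
  proof (rule smooth_on_local)
    fix y assume y: "y \<in> cmap c' ` cdom c'"
    then obtain q where q: "q \<in> cdom c'" "y = cmap c' q" by auto
    \<comment> \<open>The open sets \<open>G\<close> and \<open>- K\<close> cover the manifold. On
      the first the field is given by Jacobians and \<open>g\<close>, on the second it is 0.\<close>
    show "\<exists>T. open T \<and> y \<in> T \<and> smooth_on T (local_rep c' Y)"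
    proof (cases "q \<in> G")
      case True
      let ?T = "cmap c' ` (cdom c' \<inter> G)"
      have T: "open ?T" by (rule open_cmap_image[OF c' oG])
      have sub: "?T \<subseteq> cmap c' ` (cdom c' \<inter> cdom c)" using Gc by auto
      have "smooth_on ?T (\<lambda>y. \<Sum>j\<in>UNIV. jac c c' (cinv c' y) $ i $ j *\<^sub>R g (transition c' c y) $ j)" for i
      proof (rule smooth_on_sum[OF T], rule smooth_on_scaleR[OF T], goal_cases)
        case (1 j)
        show ?case by (rule smooth_on_subset[OF smooth_on_jac[OF c c'] sub])
      next
        case (2 j)
        show ?case
          by (rule smooth_on_vec_nth[OF T], rule smooth_on_compose[OF T U(1) _ g
                smooth_on_subset[OF smooth_transition[OF c' c] sub]]) (use c' cG in auto)
      qed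
      then have "smooth_on ?T (\<lambda>y. \<chi> i. \<Sum>j\<in>UNIV. jac c c' (cinv c' y) $ i $ j *\<^sub>R g (transition c' c y) $ j)"
        by (rule smooth_on_vec_lambda[OF T])
      moreover have "(\<chi> i. \<Sum>j\<in>UNIV. jac c c' (cinv c' z) $ i $ j *\<^sub>R g (transition c' c z) $ j) = local_rep c' Y z"
        if "z \<in> ?T" for z
        using that c' by (auto simp: local_rep_def Y_def tangent_vec_def charts_at_def)
      ultimately have "smooth_on ?T (local_rep c' Y)" by (rule smooth_on_cong[OF T, rotated])
      then show ?thesis using T q True by blast
    next
      case False
      then have "q \<notin> K" using d(2) unfolding K_def G_def by auto
      let ?T = "cmap c' ` (cdom c' \<inter> - K)"
      have T: "open ?T" by (rule open_cmap_image[OF c' oK])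
      have "smooth_on ?T (local_rep c' Y)"
        by (rule smooth_on_cong[OF T _ smooth_on_const[of _ 0]]) (use c' YK in \<open>auto simp: local_rep_def\<close>)
      then show ?thesis using T q \<open>q \<notin> K\<close> by blast
    qed
  qed
  then have "Y \<in> Vect A" using tan by (simp add: Vect_def)
  moreover have "Y q c = \<rho> (cmap c q) *\<^sub>R f (cmap c q)" if "q \<in> cdom c" "cmap c q \<in> U" for q
    using that c Giff by (simp add: Y_def charts_atI g_def)
  ultimately show ?thesis using that \<rho>(2) Giff by (metis Y_def)
qed

end

section \<open>Contact structures\<close>

locale contact_manifold = smooth_manifold A
  for A :: "('m::t2_space, 'k::finite) chart set" +
  fixes n :: nat and \<xi> :: "('m, 'k) distrib"
  assumes dim: "CARD('k) = 2 * n + 1"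
    and contact: "contact_structure A n \<xi>"
begin

abbreviation "is_contact_form \<equiv> contact_form A n \<xi>"
abbreviation "TV \<equiv> TVect A n \<xi>"
abbreviation "CV \<equiv> CVect A n \<xi>"

lemma ex_contact_form: "\<exists>W \<alpha>. p \<in> W \<and> is_contact_form W \<alpha>"
  using contact unfolding contact_structure_def by blast

lemma contact_formD:
  assumes "is_contact_form W \<alpha>"
  shows "open W" "p \<in> W \<Longrightarrow> \<alpha> p \<in> cotangent_space A p"
    "c \<in> A \<Longrightarrow> smooth_on (cmap c ` (cdom c \<inter> W)) (local_rep c \<alpha>)"
    "p \<in> W \<Longrightarrow> \<xi> p = {v \<in> tangent_space A p. \<forall>c\<in>charts_at A p. covec_app (\<alpha> p c) (v c) = 0}"
    "p \<in> W \<Longrightarrow> c \<in> charts_at A p \<Longrightarrow> \<exists>v. wedge_power n (\<alpha> p c) (ext_deriv c \<alpha> p) v \<noteq> 0"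
  using assms unfolding contact_form_def one_form_on_def by blast+

lemma open_contact_domain:
  "is_contact_form W \<alpha> \<Longrightarrow> c \<in> A \<Longrightarrow> open (cmap c ` (cdom c \<inter> W))"
  by (rule open_cmap_image[OF _ contact_formD(1)])

lemma differentiable_contact_form:
  "is_contact_form W \<alpha> \<Longrightarrow> p \<in> W \<Longrightarrow> c \<in> charts_at A p \<Longrightarrow>
    local_rep c \<alpha> differentiable (at (cmap c p))"
  by (rule smooth_on_differentiable[OF contact_formD(3)]) (auto simp: charts_at_def)

text \<open>The coefficients of \<open>d\<alpha>\<close> in the chart, kept as a matrix so that
  \<open>cform\<close> can extend the form to complex vectors.\<close>

definition form_matrix :: "('m, 'k) chart \<Rightarrow> ('m, 'k) rform \<Rightarrow> 'm \<Rightarrow> real^'k^'k" where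
  "form_matrix c \<alpha> p = (\<chi> i j. pderiv_at i (local_rep c \<alpha>) (cmap c p) $ j
      - pderiv_at j (local_rep c \<alpha>) (cmap c p) $ i)"

lemma nondegenerate_contact_form:
  assumes "is_contact_form W \<alpha>" "p \<in> W" "c \<in> charts_at A p"
  shows "nondegenerate_on_kernel (form_matrix c \<alpha> p) (\<alpha> p c)"
proof -
  let ?M = "form_matrix c \<alpha> p"
  obtain v where v: "wedge_power n (\<alpha> p c) (ext_deriv c \<alpha> p) v \<noteq> 0"
    using contact_formD(5)[OF assms] by blast
  have E: "ext_deriv c \<alpha> p u w = (\<Sum>i\<in>UNIV. \<Sum>j\<in>UNIV. ?M $ i $ j * u $ i * w $ j)" for u w
    by (simp add: ext_deriv_def form_matrix_def)
  have bil: "bilinear (ext_deriv c \<alpha> p)"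
    unfolding bilinear_def
    by (intro conjI allI linearI) (simp_all add: E algebra_simps sum.distrib sum_distrib_left)
  have sk: "?M $ i $ j = - ?M $ j $ i" for i j by (simp add: form_matrix_def)
  have skE: "ext_deriv c \<alpha> p u w = - ext_deriv c \<alpha> p w u" for u w
  proof -
    have "(\<Sum>i\<in>UNIV. \<Sum>j\<in>UNIV. ?M $ i $ j * u $ i * w $ j)
        = (\<Sum>i\<in>UNIV. \<Sum>j\<in>UNIV. - (?M $ i $ j * w $ i * u $ j))"
      by (subst sum.swap, subst sk) (simp add: mult_ac)
    then show ?thesis by (simp add: E sum_negf)
  qed
  show ?thesis unfolding nondegenerate_on_kernel_def
  proof (intro conjI allI impI)
    fix w :: "real^'k"
    assume "covec_app (\<alpha> p c) w = 0"
      "\<forall>u. covec_app (\<alpha> p c) u = 0 \<longrightarrow> (\<Sum>i\<in>UNIV. \<Sum>j\<in>UNIV. ?M $ i $ j * w $ i * u $ j) = 0"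
    then show "w = 0"
      by (intro wedge_power_nondegenerate[OF dim bil skE v]) (simp_all add: E)
  qed (rule sk)
qed

lemma contact_form_nonzero:
  assumes "is_contact_form W \<alpha>" "p \<in> W" "c \<in> charts_at A p"
  shows "\<alpha> p c \<noteq> 0"
proof
  assume "\<alpha> p c = 0"
  then show False using contact_formD(5)[OF assms]
    by (simp add: wedge_power_def covec_app_def)
qed

text \<open>The set \<open>\<xi> p\<close> contains real vectors only; membership in its
  complexification is expressed through the contact forms around \<open>p\<close>.\<close>

definition tangent_to_contact :: "'m \<Rightarrow> (('m, 'k) chart \<Rightarrow> complex^'k) \<Rightarrow> bool" where
  "tangent_to_contact p v \<longleftrightarrow> (\<forall>W \<alpha>. is_contact_form W \<alpha> \<longrightarrow> p \<in> W \<longrightarrow>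
      (\<forall>c\<in>charts_at A p. covec_app (\<alpha> p c) (v c) = 0))"

lemma TVect_iff: "X \<in> TV \<longleftrightarrow> X \<in> Vect A \<and> (\<forall>p. tangent_to_contact p (X p))"
  unfolding TVect_def tangent_to_contact_def by blast

lemma TVectD: "X \<in> TV \<Longrightarrow> X \<in> Vect A"
  "X \<in> TV \<Longrightarrow> is_contact_form W \<alpha> \<Longrightarrow> p \<in> W \<Longrightarrow> c \<in> charts_at A p \<Longrightarrow> covec_app (\<alpha> p c) (X p c) = 0"
  unfolding TVect_def by blast+

text \<open>Both forms cut out the same set \<open>\<xi> p\<close> of real vectors; real and
  imaginary parts of \<open>v\<close> are treated separately. In this way the factor relating the
  two forms never appears.\<close>

lemma kernel_eq:
  assumes \<alpha>: "is_contact_form W \<alpha>" "p \<in> W" and \<beta>: "is_contact_form W' \<beta>" "p \<in> W'"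
    and c: "c \<in> charts_at A p" and v: "covec_app (\<alpha> p c) v = (0::complex)"
  shows "covec_app (\<beta> p c) v = 0"
proof -
  have real: "covec_app (\<beta> p c) u = 0" if "covec_app (\<alpha> p c) u = 0" for u :: "real^'k"
  proof -
    have t: "tangent_vec p c u \<in> tangent_space A p" by (rule tangent_vec_in_tangent_space[OF c])
    have "covec_app (\<alpha> p c') (tangent_vec p c u c') = 0" if "c' \<in> charts_at A p" for c'
      using covec_app_change[OF t contact_formD(2)[OF \<alpha>] c that] \<open>covec_app (\<alpha> p c) u = 0\<close> c by simp
    then have "tangent_vec p c u \<in> \<xi> p" using t contact_formD(4)[OF \<alpha>] by blast
    then have "covec_app (\<beta> p c) (tangent_vec p c u c) = 0" using contact_formD(4)[OF \<beta>] c by blast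
    then show ?thesis using c by simp
  qed
  have Re: "covec_app a (\<chi> i. Re (v $ i)) = Re (covec_app a v)"
    and Im: "covec_app a (\<chi> i. Im (v $ i)) = Im (covec_app a v)" for a
    by (simp_all add: covec_app_def)
  show ?thesis
    using real[of "\<chi> i. Re (v $ i)"] real[of "\<chi> i. Im (v $ i)"] v
    by (simp add: Re Im complex_eq_iff)
qed

text \<open>A single form and a single chart decide tangency: \<open>kernel_eq\<close> changes the
  form and \<open>covec_app_change\<close> the chart.\<close>

lemma tangent_to_contactI:
  assumes v: "v \<in> tangent_space A p" and \<alpha>: "is_contact_form W \<alpha>" "p \<in> W" and c: "c \<in> charts_at A p"
    and "covec_app (\<alpha> p c) (v c) = 0"
  shows "tangent_to_contact p v"
  unfolding tangent_to_contact_def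
proof (intro allI impI ballI)
  fix W' \<beta> c' assume \<beta>: "is_contact_form W' \<beta>" "p \<in> W'" and c': "c' \<in> charts_at A p"
  have "covec_app (\<beta> p c) (v c) = 0" by (rule kernel_eq[OF \<alpha> \<beta> c assms(5)])
  then show "covec_app (\<beta> p c') (v c') = 0"
    using covec_app_change[OF v contact_formD(2)[OF \<beta>] c c'] by simp
qed

lemma TVectI:
  assumes X: "X \<in> Vect A"
    and "\<And>W \<alpha> p c. is_contact_form W \<alpha> \<Longrightarrow> p \<in> W \<Longrightarrow> c \<in> charts_at A p \<Longrightarrow> covec_app (\<alpha> p c) (X p c) = 0"
  shows "X \<in> TV"
  using assms unfolding TVect_def by blast

text \<open>This is \<open>(L_X \<alpha>)(Y) = X(\<alpha>(Y)) - \<alpha>([X, Y])\<close>. The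
  product rule splits \<open>X(\<alpha>(Y))\<close> into derivatives of \<open>Y\<close> and of
  \<open>\<alpha>\<close>; the derivatives of \<open>X\<close> occur in both the bracket and the Lie
  derivative.\<close>

lemma covec_app_bracket:
  assumes \<alpha>: "is_contact_form W \<alpha>" "p \<in> W" and c: "c \<in> charts_at A p"
    and X: "X \<in> Vect A" and Y: "Y \<in> Vect A"
  shows "covec_app (\<alpha> p c) (bracket A X Y p c) =
     (\<Sum>i\<in>UNIV. X p c $ i * pderiv_at i (\<lambda>x. covec_app (local_rep c \<alpha> x) (local_rep c Y x)) (cmap c p))
     - (\<Sum>j\<in>UNIV. lie_deriv_form c X \<alpha> p $ j * Y p c $ j)"
proof -
  let ?x = "cmap c p" and ?a = "local_rep c \<alpha>" and ?Y = "local_rep c Y"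
  have da: "?a differentiable (at ?x)" by (rule differentiable_contact_form[OF \<alpha> c])
  have dY: "?Y differentiable (at ?x)" by (rule differentiable_local_rep[OF Y c])
  have a: "?a ?x = \<alpha> p c" and y: "?Y ?x = Y p c" using c by simp_all
  have "pderiv_at i (\<lambda>x. covec_app (?a x) (?Y x)) ?x
     = (\<Sum>j\<in>UNIV. \<alpha> p c $ j *\<^sub>R (pderiv_at i ?Y ?x $ j) + (pderiv_at i ?a ?x $ j) *\<^sub>R Y p c $ j)" for i
    unfolding covec_app_def
    by (subst pderiv_at_sum)
      (simp_all add: differentiable_bilinear[OF bounded_bilinear_scaleR] differentiable_vec_nth da dY
        pderiv_at_scaleR pderiv_at_vec_nth a y)
  then have "(\<Sum>i\<in>UNIV. X p c $ i * pderiv_at i (\<lambda>x. covec_app (?a x) (?Y x)) ?x)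
    = (\<Sum>i\<in>UNIV. \<Sum>j\<in>UNIV. of_real (\<alpha> p c $ j) * (X p c $ i * pderiv_at i ?Y ?x $ j))
     + (\<Sum>i\<in>UNIV. \<Sum>j\<in>UNIV. X p c $ i * of_real (pderiv_at i ?a ?x $ j) * Y p c $ j)"
    by (simp add: sum_distrib_left distrib_left sum.distrib scaleR_conv_of_real mult_ac)
  also have "\<dots> = (\<Sum>j\<in>UNIV. \<Sum>i\<in>UNIV. of_real (\<alpha> p c $ j) * (X p c $ i * pderiv_at i ?Y ?x $ j))
     + (\<Sum>j\<in>UNIV. \<Sum>i\<in>UNIV. X p c $ i * of_real (pderiv_at i ?a ?x $ j) * Y p c $ j)"
    by (subst sum.swap, subst (3) sum.swap) (rule refl)
  finally have 1: "(\<Sum>i\<in>UNIV. X p c $ i * pderiv_at i (\<lambda>x. covec_app (?a x) (?Y x)) ?x)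
    = (\<Sum>j\<in>UNIV. \<Sum>i\<in>UNIV. of_real (\<alpha> p c $ j) * (X p c $ i * pderiv_at i ?Y ?x $ j))
     + (\<Sum>j\<in>UNIV. \<Sum>i\<in>UNIV. X p c $ i * of_real (pderiv_at i ?a ?x $ j) * Y p c $ j)" .
  have 2: "(\<Sum>j\<in>UNIV. lie_deriv_form c X \<alpha> p $ j * Y p c $ j)
    = (\<Sum>j\<in>UNIV. \<Sum>i\<in>UNIV. X p c $ i * of_real (pderiv_at i ?a ?x $ j) * Y p c $ j)
     + (\<Sum>j\<in>UNIV. \<Sum>i\<in>UNIV. of_real (\<alpha> p c $ i) * (Y p c $ j * pderiv_at j (local_rep c X) ?x $ i))"
    by (simp add: lie_deriv_form_def sum_distrib_left distrib_left sum.distrib mult_ac)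
  have 3: "covec_app (\<alpha> p c) (bracket A X Y p c)
    = (\<Sum>j\<in>UNIV. \<Sum>i\<in>UNIV. of_real (\<alpha> p c $ j) * (X p c $ i * pderiv_at i ?Y ?x $ j))
     - (\<Sum>j\<in>UNIV. \<Sum>i\<in>UNIV. of_real (\<alpha> p c $ j) * (Y p c $ i * pderiv_at i (local_rep c X) ?x $ j))"
    by (simp add: covec_app_complex bracket_at[OF c] sum_distrib_left right_diff_distrib sum_subtractf)
  show ?thesis unfolding 1 2 3 by (subst (5) sum.swap) simp
qed

lemma pderiv_contact_form_TVect:
  assumes \<alpha>: "is_contact_form W \<alpha>" "p \<in> W" and c: "c \<in> charts_at A p" and T: "T \<in> TV"
  shows "pderiv_at i (\<lambda>x. covec_app (local_rep c \<alpha> x) (local_rep c T x)) (cmap c p) = 0"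
proof -
  note cA = charts_atD[OF c]
  have "pderiv_at i (\<lambda>x. 0) (cmap c p) = pderiv_at i (\<lambda>x. covec_app (local_rep c \<alpha> x) (local_rep c T x)) (cmap c p)"
  proof (rule pderiv_at_cong[OF open_contact_domain[OF \<alpha>(1) cA(1)]])
    fix y assume "y \<in> cmap c ` (cdom c \<inter> W)"
    then obtain q where "q \<in> cdom c" "q \<in> W" "y = cmap c q" by auto
    then show "0 = covec_app (local_rep c \<alpha> y) (local_rep c T y)"
      using TVectD(2)[OF T \<alpha>(1), of q c] cA by (simp add: charts_at_def)
  qed (use cA \<alpha> in auto)
  then show ?thesis by (simp add: pderiv_at_const)
qed

lemma covec_app_bracket_TVect:
  assumes \<alpha>: "is_contact_form W \<alpha>" "p \<in> W" and c: "c \<in> charts_at A p"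
    and X: "X \<in> Vect A" and T: "T \<in> TV"
  shows "covec_app (\<alpha> p c) (bracket A X T p c) = - (\<Sum>j\<in>UNIV. lie_deriv_form c X \<alpha> p $ j * T p c $ j)"
  using covec_app_bracket[OF \<alpha> c X TVectD(1)[OF T]] pderiv_contact_form_TVect[OF \<alpha> c T] by simp

text \<open>Cartan's formula \<open>L_T \<alpha> = i_T d\<alpha> + d(\<alpha>(T))\<close>, where the
  last term is 0 because \<open>\<alpha>(T)\<close> vanishes on all of \<open>W\<close>. Thus the
  derivatives of \<open>T\<close> drop out and only its value at \<open>p\<close> remains; this
  makes the condition on the tangent part a linear system at each point.\<close>

lemma lie_deriv_form_TVect:
  assumes \<alpha>: "is_contact_form W \<alpha>" "p \<in> W" and c: "c \<in> charts_at A p" and T: "T \<in> TV"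
  shows "(\<Sum>j\<in>UNIV. lie_deriv_form c T \<alpha> p $ j * t $ j) = cform (form_matrix c \<alpha> p) (T p c) t"
proof -
  let ?x = "cmap c p" and ?a = "local_rep c \<alpha>" and ?T = "local_rep c T"
  have da: "?a differentiable (at ?x)" by (rule differentiable_contact_form[OF \<alpha> c])
  have dT: "?T differentiable (at ?x)" by (rule differentiable_local_rep[OF TVectD(1)[OF T] c])
  have a: "?a ?x = \<alpha> p c" and y: "?T ?x = T p c" using c by simp_all
  have "pderiv_at j (\<lambda>x. covec_app (?a x) (?T x)) ?x
     = (\<Sum>i\<in>UNIV. \<alpha> p c $ i *\<^sub>R (pderiv_at j ?T ?x $ i) + (pderiv_at j ?a ?x $ i) *\<^sub>R T p c $ i)" for j
    unfolding covec_app_def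
    by (subst pderiv_at_sum)
      (simp_all add: differentiable_bilinear[OF bounded_bilinear_scaleR] differentiable_vec_nth da dT
        pderiv_at_scaleR pderiv_at_vec_nth a y)
  then have "(\<Sum>i\<in>UNIV. of_real (\<alpha> p c $ i) * pderiv_at j ?T ?x $ i) =
      - (\<Sum>i\<in>UNIV. of_real (pderiv_at j ?a ?x $ i) * T p c $ i)" for j
    using pderiv_contact_form_TVect[OF \<alpha> c T, of j]
    by (simp add: sum.distrib scaleR_conv_of_real eq_neg_iff_add_eq_0)
  then have "lie_deriv_form c T \<alpha> p $ j = (\<Sum>i\<in>UNIV. of_real (form_matrix c \<alpha> p $ i $ j) * T p c $ i)" for j
    by (simp add: lie_deriv_form_def form_matrix_def sum.distrib right_diff_distrib sum_subtractf mult.commute)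
  then show ?thesis by (simp add: cform_sum)
qed

lemma covec_app_bracket_TVect_TVect:
  assumes \<alpha>: "is_contact_form W \<alpha>" "p \<in> W" and c: "c \<in> charts_at A p" and X: "X \<in> TV" and T: "T \<in> TV"
  shows "covec_app (\<alpha> p c) (bracket A X T p c) = - cform (form_matrix c \<alpha> p) (X p c) (T p c)"
  using covec_app_bracket_TVect[OF \<alpha> c TVectD(1)[OF X] T] lie_deriv_form_TVect[OF \<alpha> c X] by simp

section \<open>Fields with prescribed value at a point\<close>

lemma ex_Vect_at:
  assumes c: "c \<in> charts_at A p"
  shows "\<exists>E\<in>Vect A. E p c = w"
proof -
  note cA = charts_atD[OF c]
  let ?U = "cmap c ` cdom c"
  have x: "cmap c p \<in> ?U" using cA by auto
  obtain E \<rho> where E: "E \<in> Vect A" "\<rho> (cmap c p) = (1::real)"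
    "\<And>q. q \<in> cdom c \<Longrightarrow> cmap c q \<in> ?U \<Longrightarrow> E q c = \<rho> (cmap c q) *\<^sub>R w"
    "\<And>q. \<not> (q \<in> cdom c \<and> cmap c q \<in> ?U) \<Longrightarrow> E q = (\<lambda>_. 0)"
    by (rule bump_extension[OF cA(1) open_cmap_cdom[OF cA(1)] order_refl smooth_on_const[where c=w] x]) (rule that)
  then have "E p c = w" using E(3)[OF cA(2) x] by simp
  then show ?thesis using E(1) by blast
qed

lemma ex_TVect_at:
  assumes \<alpha>: "is_contact_form W \<alpha>" "p \<in> W" and c: "c \<in> charts_at A p"
    and w: "covec_app (\<alpha> p c) w = 0"
  shows "\<exists>T\<in>TV. T p c = w"
proof -
  note cA = charts_atD[OF c]
  let ?U = "cmap c ` (cdom c \<inter> W)" and ?a = "local_rep c \<alpha>"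
  have U: "open ?U" by (rule open_contact_domain[OF \<alpha>(1) cA(1)])
  obtain k where k: "\<alpha> p c $ k \<noteq> 0"
    using contact_form_nonzero[OF \<alpha> c] by (auto simp: vec_eq_iff)
  \<comment> \<open>The combination \<open>f\<close> below, \<open>\<alpha>\<close> in the
    \<open>k\<close>-th coordinate times \<open>w'\<close> minus \<open>\<alpha>(w')\<close> times
    the \<open>k\<close>-th unit vector, lies in the kernel of \<open>\<alpha>\<close> at every
    point. At \<open>p\<close> its second term vanishes, and the normalisation of \<open>w'\<close>
    makes the first one equal to \<open>w\<close>.\<close>
  define w' where "w' = inverse (\<alpha> p c $ k) *\<^sub>R w"
  define f where "f x = (?a x $ k) *\<^sub>R w' - axis k (covec_app (?a x) w')" for x
  have sa: "smooth_on ?U ?a" by (rule contact_formD(3)[OF \<alpha>(1) cA(1)])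
  have sf: "smooth_on ?U f" unfolding f_def covec_app_def
    by (intro smooth_on_diff[OF U] smooth_on_scaleR[OF U] smooth_on_bounded_linear[OF U bounded_linear_axis]
        smooth_on_const smooth_on_sum[OF U] smooth_on_vec_nth[OF U] sa)
  have x: "cmap c p \<in> ?U" using cA \<alpha>(2) by auto
  have sub: "?U \<subseteq> cmap c ` cdom c" by auto
  obtain T \<rho> where T: "T \<in> Vect A" "\<rho> (cmap c p) = (1::real)"
    "\<And>q. q \<in> cdom c \<Longrightarrow> cmap c q \<in> ?U \<Longrightarrow> T q c = \<rho> (cmap c q) *\<^sub>R f (cmap c q)"
    "\<And>q. \<not> (q \<in> cdom c \<and> cmap c q \<in> ?U) \<Longrightarrow> T q = (\<lambda>_. 0)"
    by (rule bump_extension[OF cA(1) U sub sf x]) (rule that)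
  have "covec_app (?a x) (f x) = 0" for x
  proof -
    have "covec_app (?a x) (axis k r :: complex^'k) = (?a x $ k) *\<^sub>R r" for r
      by (simp add: covec_app_def axis_def if_distrib[of "scaleR _"] cong: if_cong)
    then show ?thesis
      by (simp add: f_def covec_app_diff linear_scale[OF linear_covec_app])
  qed
  then have 1: "covec_app (?a x) (r *\<^sub>R f x) = 0" for x r
    by (simp add: linear_scale[OF linear_covec_app])
  have "tangent_to_contact q (T q)" for q
  proof (cases "q \<in> cdom c \<and> cmap c q \<in> ?U")
    case True
    then have cq: "c \<in> charts_at A q" using cA by (simp add: charts_at_def)
    \<comment> \<open>Membership of the coordinates in the image only yields some \<open>q'\<close>
      in \<open>W\<close> with the same coordinates; injectivity of the chart identifies it with
      \<open>q\<close>.\<close>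
    from conjunct2[OF True] obtain q' where q': "q' \<in> cdom c" "q' \<in> W" "cmap c q = cmap c q'"
      by (elim imageE IntE) (rule that)
    have "q = cinv c (cmap c q)" using True cinv_cmap[OF cA(1)] by (simp only:)
    also have "\<dots> = q'" using q' cinv_cmap[OF cA(1)] by (simp only:)
    finally have "q = q'" .
    then have "q \<in> W" using q' by simp
    then show ?thesis
      by (rule tangent_to_contactI[OF VectD(1)[OF T(1)] \<alpha>(1) _ cq])
        (use T(3)[of q] True 1[of "cmap c q"] cq in simp)
  next
    case False
    then show ?thesis using T(4) by (simp add: tangent_to_contact_def covec_app_0)
  qed
  then have "T \<in> TV" using T(1) by (simp add: TVect_iff)
  moreover have "T p c = w"
  proof -
    have "covec_app (\<alpha> p c) w' = 0" using w by (simp add: w'_def linear_scale[OF linear_covec_app])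
    then have "f (cmap c p) = (\<alpha> p c $ k) *\<^sub>R w'"
      using c by (simp add: f_def axis_def vec_eq_iff)
    also have "\<dots> = w" using k by (simp add: w'_def)
    finally show ?thesis using T(2) T(3)[OF cA(2) x] by simp
  qed
  ultimately show ?thesis by blast
qed

text \<open>Every complex vector in the kernel is the value of a tangent field, so testing against
  tangent fields is as strong as testing against vectors.\<close>

lemma tangent_uniqueness:
  assumes \<alpha>: "is_contact_form W \<alpha>" "p \<in> W" and c: "c \<in> charts_at A p"
    and v: "covec_app (\<alpha> p c) v = 0"
    and T: "\<And>T. T \<in> TV \<Longrightarrow> cform (form_matrix c \<alpha> p) v (T p c) = 0"
  shows "v = 0"
proof (rule nondegenerate_on_kernel_complex[OF nondegenerate_contact_form[OF \<alpha> c] v])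
  fix t :: "complex^'k"
  assume "covec_app (\<alpha> p c) t = 0"
  then show "cform (form_matrix c \<alpha> p) v t = 0" using ex_TVect_at[OF \<alpha> c] T by metis
qed

section \<open>Contact fields as the stabiliser of the tangent fields\<close>

lemma CVect_bracket_TVect:
  assumes V: "V \<in> CV" and T: "T \<in> TV"
  shows "bracket A V T \<in> TV"
proof (rule TVectI)
  have V': "V \<in> Vect A" using V by (simp add: CVect_def)
  show "bracket A V T \<in> Vect A" by (rule bracket_in_Vect[OF V' TVectD(1)[OF T]])
  fix W \<alpha> p c assume \<alpha>: "is_contact_form W \<alpha>" "p \<in> W" and c: "c \<in> charts_at A p"
  obtain f where f: "\<And>j. lie_deriv_form c V \<alpha> p $ j = f p * of_real (\<alpha> p c $ j)"
    using V \<alpha> c unfolding CVect_def by blast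
  have "covec_app (\<alpha> p c) (bracket A V T p c) = - (f p * covec_app (\<alpha> p c) (T p c))"
    unfolding covec_app_bracket_TVect[OF \<alpha> c V' T] f
    by (simp add: covec_app_complex sum_distrib_left mult.assoc)
  then show "covec_app (\<alpha> p c) (bracket A V T p c) = 0"
    using TVectD(2)[OF T \<alpha> c] by simp
qed

text \<open>The factor \<open>f\<close> with \<open>L\<^sub>V \<alpha> = f \<alpha>\<close> is read off \<open>L\<^sub>V \<alpha>\<close> in each chart; it does not depend on
  the chart because \<open>f \<alpha>(E) = V(\<alpha>(E)) - \<alpha>([V, E])\<close> for every vector field \<open>E\<close>.\<close>

lemma CVectI:
  assumes V: "V \<in> Vect A" and VT: "\<And>T. T \<in> TV \<Longrightarrow> bracket A V T \<in> TV"
  shows "V \<in> CV"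
proof -
  have "\<exists>f. smooth_fun_on A W f \<and> (\<forall>p\<in>W. \<forall>c\<in>charts_at A p. \<forall>j.
          lie_deriv_form c V \<alpha> p $ j = f p * of_real (\<alpha> p c $ j))" if \<alpha>: "is_contact_form W \<alpha>" for W \<alpha>
  proof -
    \<comment> \<open>The squared Euclidean length of the coordinate vector of
      \<open>\<alpha>\<close>, nonzero since the coordinates are real and not all 0. With it,
      \<open>g\<close> is the coefficient of the orthogonal projection of
      \<open>L_V \<alpha>\<close> onto \<open>\<alpha>\<close>.\<close>
    define s where "s c p = (\<Sum>j\<in>UNIV. (of_real (\<alpha> p c $ j))\<^sup>2 :: complex)" for c p
    define g where "g c p = (\<Sum>j\<in>UNIV. lie_deriv_form c V \<alpha> p $ j * of_real (\<alpha> p c $ j)) / s c p" for c p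
    have s: "s c p \<noteq> 0" if "p \<in> W" "c \<in> charts_at A p" for p c
    proof -
      have "s c p = of_real (\<alpha> p c \<bullet> \<alpha> p c)"
        by (simp add: s_def inner_vec_def power2_eq_square)
      then show ?thesis using contact_form_nonzero[OF \<alpha> that] by simp
    qed
    have g: "lie_deriv_form c V \<alpha> p $ j = g c p * of_real (\<alpha> p c $ j)" if p: "p \<in> W" and c: "c \<in> charts_at A p" for p c j
    proof -
      let ?l = "lie_deriv_form c V \<alpha> p"
      \<comment> \<open>The \<open>j\<close>-th unit vector minus its orthogonal projection onto the
        coordinates of \<open>\<alpha>\<close>: it lies in the kernel, and pairing
        \<open>L_V \<alpha>\<close> with it gives the \<open>j\<close>-th component of the
        claim.\<close>
      define w where "w = (\<chi> i. (if i = j then 1 else 0) - of_real (\<alpha> p c $ j) / s c p * of_real (\<alpha> p c $ i))"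
      have sum: "(\<Sum>i\<in>UNIV. b i * w $ i) = b j - of_real (\<alpha> p c $ j) / s c p * (\<Sum>i\<in>UNIV. b i * of_real (\<alpha> p c $ i))" for b
      proof -
        have "(\<Sum>i\<in>UNIV. b i * w $ i) = (\<Sum>i\<in>UNIV. (if i = j then b i else 0)
            - of_real (\<alpha> p c $ j) / s c p * (b i * of_real (\<alpha> p c $ i)))"
          by (rule sum.cong) (auto simp: w_def algebra_simps)
        then show ?thesis by (simp add: sum_subtractf sum_distrib_left)
      qed
      have "covec_app (\<alpha> p c) w = 0"
        using s[OF p c] by (simp add: covec_app_complex sum s_def power2_eq_square)
      then obtain T where T: "T \<in> TV" "T p c = w" using ex_TVect_at[OF \<alpha> p c] by blast
      have "(\<Sum>i\<in>UNIV. ?l $ i * w $ i) = 0"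
        using covec_app_bracket_TVect[OF \<alpha> p c V T(1)] TVectD(2)[OF VT[OF T(1)] \<alpha> p c] T(2) by simp
      then show ?thesis by (simp add: sum g_def)
    qed
    have indep: "g c p = g c' p" if p: "p \<in> W" and c: "c \<in> charts_at A p" "c' \<in> charts_at A p" for p c c'
    proof -
      \<comment> \<open>With these coordinates \<open>\<alpha>(E)\<close> equals
        \<open>s c p\<close> at \<open>p\<close>, which is nonzero and can be cancelled at the
        end.\<close>
      obtain E where E: "E \<in> Vect A" "E p c = (\<chi> i. of_real (\<alpha> p c $ i))" using ex_Vect_at[OF c(1)] by blast
      \<comment> \<open>The function \<open>\<alpha>(E)\<close> on the manifold. The chart is chosen
        arbitrarily at each point, which does not matter on \<open>W\<close>; as a function of the
        point it can be differentiated along \<open>V\<close> in either chart.\<close>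
      define F where "F q = (let c = SOME c. c \<in> charts_at A q in covec_app (\<alpha> q c) (E q c))" for q
      have F: "F q = covec_app (\<alpha> q d) (E q d)" if "q \<in> W" "d \<in> charts_at A q" for q d
        unfolding F_def Let_def using that(2)
        by (intro covec_app_change[OF VectD(1)[OF E(1)] contact_formD(2)[OF \<alpha> that(1)]]) (auto intro: someI)
      have dF: "(\<lambda>x. F (cinv d x)) differentiable (at (cmap d p))"
        and pF: "pderiv_at i (\<lambda>x. covec_app (local_rep d \<alpha> x) (local_rep d E x)) (cmap d p)
          = pderiv_at i (\<lambda>x. F (cinv d x)) (cmap d p)" if d: "d \<in> charts_at A p" for d i
      proof -
        note dA = charts_atD[OF d]
        let ?S = "cmap d ` (cdom d \<inter> W)"
        have S: "open ?S" by (rule open_contact_domain[OF \<alpha> dA(1)])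
        have x: "cmap d p \<in> ?S" using p dA by auto
        have eq: "covec_app (local_rep d \<alpha> y) (local_rep d E y) = F (cinv d y)" if "y \<in> ?S" for y
          using that dA by (auto intro!: F[symmetric] simp: charts_atI)
        have D: "(\<lambda>x. covec_app (local_rep d \<alpha> x) (local_rep d E x)) differentiable (at (cmap d p))"
          unfolding covec_app_def
          by (intro differentiable_sum finite_class.finite_UNIV differentiable_bilinear[OF bounded_bilinear_scaleR]
              differentiable_vec_nth ballI differentiable_contact_form[OF \<alpha> p d] differentiable_local_rep[OF E(1) d])
        show "(\<lambda>x. F (cinv d x)) differentiable (at (cmap d p))"
          by (rule differentiable_cong[OF S x eq D])
        show "pderiv_at i (\<lambda>x. covec_app (local_rep d \<alpha> x) (local_rep d E x)) (cmap d p)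
          = pderiv_at i (\<lambda>x. F (cinv d x)) (cmap d p)"
          by (rule pderiv_at_cong[OF S x eq D])
      qed
      have val: "g d p * F p = (\<Sum>i\<in>UNIV. V p d $ i * pderiv_at i (\<lambda>x. F (cinv d x)) (cmap d p))
          - covec_app (\<alpha> p d) (bracket A V E p d)" if d: "d \<in> charts_at A p" for d
      proof -
        have "g d p * F p = (\<Sum>j\<in>UNIV. lie_deriv_form d V \<alpha> p $ j * E p d $ j)"
          by (simp add: F[OF p d] g[OF p d] covec_app_complex sum_distrib_left mult.assoc)
        then show ?thesis using covec_app_bracket[OF \<alpha> p d V E(1)] pF[OF d] by simp
      qed
      have "g c p * F p = g c' p * F p"
        using val[OF c(1)] val[OF c(2)] directional_derivative_change[OF VectD(1)[OF V] c dF[OF c(2)]]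
          covec_app_change[OF bracket_in_tangent_space[OF V E(1)] contact_formD(2)[OF \<alpha> p] c] by simp
      moreover have "F p = s c p"
        by (simp add: F[OF p c(1)] E(2) covec_app_complex s_def power2_eq_square)
      ultimately show ?thesis using s[OF p c(1)] by simp
    qed
    define f where "f p = g (SOME c. c \<in> charts_at A p) p" for p
    have f: "f p = g c p" if "p \<in> W" "c \<in> charts_at A p" for p c
      unfolding f_def using that by (intro indep) (auto intro: someI)
    have "smooth_fun_on A W f" unfolding smooth_fun_on_def
    proof
      fix c assume c: "c \<in> A"
      let ?S = "cmap c ` (cdom c \<inter> W)"
      have S: "open ?S" by (rule open_contact_domain[OF \<alpha> c])
      have sa: "smooth_on ?S (local_rep c \<alpha>)" by (rule contact_formD(3)[OF \<alpha> c])
      have sV: "smooth_on ?S (local_rep c V)" by (rule smooth_on_subset[OF VectD(2)[OF V c]]) auto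
      let ?l = "\<lambda>x j. \<Sum>i\<in>UNIV. local_rep c V x $ i * of_real (pderiv_at i (local_rep c \<alpha>) x $ j)
        + of_real (local_rep c \<alpha> x $ i) * pderiv_at j (local_rep c V) x $ i"
      let ?s = "\<lambda>x. \<Sum>j\<in>UNIV. (of_real (local_rep c \<alpha> x $ j)) * of_real (local_rep c \<alpha> x $ j) :: complex"
      have eq: "f (cinv c x) = (\<Sum>j\<in>UNIV. ?l x j * of_real (local_rep c \<alpha> x $ j)) / ?s x" and nz: "?s x \<noteq> 0"
        if "x \<in> ?S" for x
      proof -
        from that obtain q where q: "q \<in> cdom c" "q \<in> W" "x = cmap c q" by auto
        then have cq: "c \<in> charts_at A q" using c by (simp add: charts_atI)
        show "f (cinv c x) = (\<Sum>j\<in>UNIV. ?l x j * of_real (local_rep c \<alpha> x $ j)) / ?s x"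
          using q c cq by (simp add: f[OF q(2) cq] g_def s_def lie_deriv_form_def power2_eq_square)
        show "?s x \<noteq> 0" using s[OF q(2) cq] q cq by (simp add: s_def power2_eq_square)
      qed
      have "smooth_on ?S (\<lambda>x. (\<Sum>j\<in>UNIV. ?l x j * of_real (local_rep c \<alpha> x $ j)) / ?s x)"
        by (intro smooth_on_divide[OF S nz] smooth_on_sum[OF S] smooth_on_mult[OF S] smooth_on_add[OF S]
            smooth_on_of_real[OF S] smooth_on_vec_nth[OF S] smooth_on_pderiv_at sa sV)
      then show "smooth_on ?S (\<lambda>x. f (cinv c x))"
        by (rule smooth_on_cong[OF S, rotated]) (simp add: eq)
    qed
    then show ?thesis using f g by metis
  qed
  then show ?thesis using V unfolding CVect_def by blast
qed

section \<open>Linear operations, and the splitting into contact and tangent fields\<close>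

abbreviation vf_diff :: "('m, 'k) vfield \<Rightarrow> ('m, 'k) vfield \<Rightarrow> ('m, 'k) vfield" where
  "vf_diff X Y \<equiv> vf_add X (vf_minus Y)"

lemma vf_diff_in_Vect: "X \<in> Vect A \<Longrightarrow> Y \<in> Vect A \<Longrightarrow> vf_diff X Y \<in> Vect A"
  by (intro vf_add_in_Vect vf_minus_in_Vect)

lemma bracket_diff_left:
  assumes "X \<in> Vect A" "Y \<in> Vect A" "Z \<in> Vect A"
  shows "bracket A (vf_diff X Y) Z = vf_diff (bracket A X Z) (bracket A Y Z)"
  using bracket_add_left[OF assms(1) vf_minus_in_Vect[OF assms(2)] assms(3)]
    bracket_scale_left[OF assms(2,3), of "- 1"] by (simp add: vf_minus_eq_mult)

lemma TVect_add:
  assumes "X \<in> TV" "Y \<in> TV"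
  shows "vf_add X Y \<in> TV"
proof (rule TVectI)
  show "vf_add X Y \<in> Vect A" by (intro vf_add_in_Vect TVectD(1)[OF assms(1)] TVectD(1)[OF assms(2)])
qed (use assms in \<open>simp add: vf_add_def covec_app_add TVectD(2)\<close>)

lemma TVect_mult:
  assumes "smooth_fun_on A UNIV f" "X \<in> TV"
  shows "vf_mult f X \<in> TV"
proof (rule TVectI)
  show "vf_mult f X \<in> Vect A" by (rule vf_mult_in_Vect[OF assms(1) TVectD(1)[OF assms(2)]])
qed (use assms in \<open>simp add: vf_mult_def covec_app_vector_scalar_mult TVectD(2)\<close>)

lemma TVect_minus: "X \<in> TV \<Longrightarrow> vf_minus X \<in> TV"
  unfolding vf_minus_eq_mult by (rule TVect_mult[OF smooth_fun_on_const])

lemma CVect_in_Vect: "V \<in> CV \<Longrightarrow> V \<in> Vect A"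
  by (simp add: CVect_def)

lemma CVect_add:
  assumes "U \<in> CV" "V \<in> CV"
  shows "vf_add U V \<in> CV"
proof (rule CVectI)
  note UV = assms[THEN CVect_in_Vect]
  show "vf_add U V \<in> Vect A" by (rule vf_add_in_Vect[OF UV])
  show "bracket A (vf_add U V) T \<in> TV" if "T \<in> TV" for T
    unfolding bracket_add_left[OF UV TVectD(1)[OF that]]
    by (intro TVect_add CVect_bracket_TVect assms that)
qed

lemma CVect_scale:
  assumes "V \<in> CV"
  shows "vf_mult (\<lambda>_. r) V \<in> CV"
proof (rule CVectI)
  note V = CVect_in_Vect[OF assms]
  show "vf_mult (\<lambda>_. r) V \<in> Vect A" by (rule vf_mult_in_Vect[OF smooth_fun_on_const V])
  show "bracket A (vf_mult (\<lambda>_. r) V) T \<in> TV" if "T \<in> TV" for T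
    unfolding bracket_scale_left[OF V TVectD(1)[OF that]]
    by (intro TVect_mult smooth_fun_on_const CVect_bracket_TVect assms that)
qed

lemma CVect_minus: "V \<in> CV \<Longrightarrow> vf_minus V \<in> CV"
  unfolding vf_minus_eq_mult by (rule CVect_scale)

text \<open>The stabiliser of a subspace is closed under brackets: by the Jacobi identity
  \<open>[[U, V], T] = [U, [V, T]] - [V, [U, T]]\<close>.\<close>

lemma CVect_bracket:
  assumes U: "U \<in> CV" and V: "V \<in> CV"
  shows "bracket A U V \<in> CV"
proof (rule CVectI)
  note UV = U[THEN CVect_in_Vect] V[THEN CVect_in_Vect]
  show "bracket A U V \<in> Vect A" by (rule bracket_in_Vect[OF UV])
  fix T assume T: "T \<in> TV"
  note T' = TVectD(1)[OF T]
  have "bracket A (bracket A U V) T = vf_diff (bracket A U (bracket A V T)) (bracket A V (bracket A U T))"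
    unfolding jacobi_identity[OF UV T'] by (simp add: vf_add_def vf_minus_def)
  then show "bracket A (bracket A U V) T \<in> TV"
    using T U V by (simp add: TVect_add TVect_minus CVect_bracket_TVect)
qed

lemma CVect_Int_TVect:
  assumes "V \<in> CV" "V \<in> TV"
  shows "V = vf_zero"
proof
  fix p
  obtain W \<alpha> c where \<alpha>: "is_contact_form W \<alpha>" "p \<in> W" and c: "c \<in> charts_at A p"
    using ex_contact_form ex_chart by blast
  have "V p c = 0"
  proof (rule tangent_uniqueness[OF \<alpha> c TVectD(2)[OF assms(2) \<alpha> c]])
    fix T assume T: "T \<in> TV"
    show "cform (form_matrix c \<alpha> p) (V p c) (T p c) = 0"
      using covec_app_bracket_TVect_TVect[OF \<alpha> c assms(2) T]
        TVectD(2)[OF CVect_bracket_TVect[OF assms(1) T] \<alpha> c] by simp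
  qed
  moreover have "(\<lambda>_. 0) \<in> tangent_space A p" by (rule tangent_spaceI) auto
  ultimately show "V p = vf_zero p"
    unfolding vf_zero_def
    by (intro tangent_space_eqI[OF VectD(1)[OF TVectD(1)[OF assms(2)]] _ c]) auto
qed

text \<open>The component of \<open>Z\<close> along the contact distribution, in a chart: the condition
  \<open>\<alpha>([Z - T', T]) = 0\<close> for all \<open>T\<close> is linear in the value of \<open>T'\<close> at the point.\<close>

definition tangent_part :: "('m, 'k) vfield \<Rightarrow> ('m, 'k) chart \<Rightarrow> ('m, 'k) rform \<Rightarrow> 'm \<Rightarrow> complex^'k" where
  "tangent_part Z c \<alpha> p = kernel_solution (form_matrix c \<alpha> p) (\<alpha> p c) (lie_deriv_form c Z \<alpha> p)"

text \<open>On the kernel, \<open>L_Z \<alpha>\<close> is \<open>d\<alpha>(s, -)\<close> for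
  \<open>s = tangent_part Z c \<alpha> p\<close>, and therefore
  \<open>\<alpha>([Z - T', T]) = d\<alpha>(T' - s, T)\<close>. The left-hand side mentions neither a
  chart nor a form; this is what makes the local solutions fit together.\<close>

lemma tangent_part_iff:
  assumes Z: "Z \<in> Vect A" and T': "T' \<in> TV"
    and \<alpha>: "is_contact_form W \<alpha>" "p \<in> W" and c: "c \<in> charts_at A p"
  shows "(\<forall>T\<in>TV. tangent_to_contact p (bracket A (vf_diff Z T') T p)) \<longleftrightarrow> T' p c = tangent_part Z c \<alpha> p"
proof -
  let ?M = "form_matrix c \<alpha> p" and ?s = "tangent_part Z c \<alpha> p"
  note nd = nondegenerate_contact_form[OF \<alpha> c]
  have s0: "covec_app (\<alpha> p c) ?s = 0"
    unfolding tangent_part_def by (rule kernel_solution(1)[OF nd])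
  have val: "covec_app (\<alpha> p c) (bracket A (vf_diff Z T') T p c) = cform ?M (T' p c - ?s) (T p c)"
    if T: "T \<in> TV" for T
  proof -
    have "covec_app (\<alpha> p c) (bracket A (vf_diff Z T') T p c)
       = cform ?M (T' p c) (T p c) - (\<Sum>j\<in>UNIV. lie_deriv_form c Z \<alpha> p $ j * T p c $ j)"
      unfolding bracket_diff_left[OF Z TVectD(1)[OF T'] TVectD(1)[OF T]]
      by (simp add: vf_add_def vf_minus_def covec_app_diff covec_app_bracket_TVect_TVect[OF \<alpha> c T' T]
          covec_app_bracket_TVect[OF \<alpha> c Z T])
    also have "\<dots> = cform ?M (T' p c) (T p c) - cform ?M ?s (T p c)"
      unfolding tangent_part_def
      by (simp add: kernel_solution(2)[OF nd TVectD(2)[OF T \<alpha> c]])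
    finally show ?thesis by (simp add: cform_diff_left)
  qed
  show ?thesis
  proof
    assume "\<forall>T\<in>TV. tangent_to_contact p (bracket A (vf_diff Z T') T p)"
    then have "cform ?M (T' p c - ?s) (T p c) = 0" if "T \<in> TV" for T
      using val[OF that] \<alpha> c that unfolding tangent_to_contact_def by metis
    moreover have "covec_app (\<alpha> p c) (T' p c - ?s) = 0"
      using TVectD(2)[OF T' \<alpha> c] s0 by (simp add: covec_app_diff)
    ultimately have "T' p c - ?s = 0" by (intro tangent_uniqueness[OF \<alpha> c])
    then show "T' p c = ?s" by simp
  next
    assume "T' p c = ?s"
    then have "covec_app (\<alpha> p c) (bracket A (vf_diff Z T') T p c) = 0" if "T \<in> TV" for T
      using val[OF that] by (simp add: cform_def)
    moreover have "bracket A (vf_diff Z T') T p \<in> tangent_space A p" if "T \<in> TV" for T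
      by (intro bracket_in_tangent_space vf_diff_in_Vect Z TVectD(1)[OF T'] TVectD(1)[OF that])
    ultimately show "\<forall>T\<in>TV. tangent_to_contact p (bracket A (vf_diff Z T') T p)"
      using tangent_to_contactI[OF _ \<alpha> c] by blast
  qed
qed

lemma smooth_on_tangent_part:
  assumes Z: "Z \<in> Vect A" and \<alpha>: "is_contact_form W \<alpha>" and c: "c \<in> A"
  shows "smooth_on (cmap c ` (cdom c \<inter> W)) (\<lambda>x. tangent_part Z c \<alpha> (cinv c x))"
proof -
  let ?S = "cmap c ` (cdom c \<inter> W)" and ?a = "local_rep c \<alpha>" and ?Z = "local_rep c Z"
  have S: "open ?S" by (rule open_contact_domain[OF \<alpha> c])
  have sa: "smooth_on ?S ?a" by (rule contact_formD(3)[OF \<alpha> c])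
  have sZ: "smooth_on ?S ?Z" by (rule smooth_on_subset[OF VectD(2)[OF Z c]]) auto
  let ?M = "\<lambda>x. \<chi> i j. pderiv_at i ?a x $ j - pderiv_at j ?a x $ i"
  let ?l = "\<lambda>x. \<chi> j. \<Sum>i\<in>UNIV. ?Z x $ i * of_real (pderiv_at i ?a x $ j) + of_real (?a x $ i) * pderiv_at j ?Z x $ i"
  have eq: "form_matrix c \<alpha> (cinv c x) = ?M x" "\<alpha> (cinv c x) c = ?a x" "lie_deriv_form c Z \<alpha> (cinv c x) = ?l x"
    and nd: "nondegenerate_on_kernel (?M x) (?a x)" if "x \<in> ?S" for x
  proof -
    from that obtain q where q: "q \<in> cdom c" "q \<in> W" "x = cmap c q" by auto
    then have cq: "c \<in> charts_at A q" using c by (simp add: charts_atI)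
    show 1: "form_matrix c \<alpha> (cinv c x) = ?M x" "\<alpha> (cinv c x) c = ?a x" "lie_deriv_form c Z \<alpha> (cinv c x) = ?l x"
      using q c cq by (simp_all add: form_matrix_def lie_deriv_form_def)
    show "nondegenerate_on_kernel (?M x) (?a x)"
      using nondegenerate_contact_form[OF \<alpha> q(2) cq] 1 q c by simp
  qed
  have "smooth_on ?S (\<lambda>x. kernel_solution (?M x) (?a x) (?l x))"
  proof (rule smooth_on_kernel_solution[OF S _ _ _ nd])
    show "smooth_on ?S (\<lambda>x. ?M x $ i $ j)" for i j
      by (simp, intro smooth_on_diff[OF S] smooth_on_vec_nth[OF S] smooth_on_pderiv_at sa)
    show "smooth_on ?S (\<lambda>x. ?a x $ i)" for i
      by (intro smooth_on_vec_nth[OF S] sa)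
    show "smooth_on ?S (\<lambda>x. ?l x $ j)" for j
      by (simp, intro smooth_on_sum[OF S] smooth_on_add[OF S] smooth_on_mult[OF S] smooth_on_of_real[OF S]
          smooth_on_vec_nth[OF S] smooth_on_pderiv_at sa sZ)
  qed
  then show ?thesis
    by (rule smooth_on_cong[OF S, rotated]) (simp add: tangent_part_def eq)
qed

text \<open>The condition \<open>Q p\<close>, which requires stability at the single point
  \<open>p\<close> only, can be met by some tangent field for each \<open>p\<close>. The values of
  these fields at their own points form a field that agrees with \<open>tangent_part\<close> in
  every chart and for every contact form. From this come its smoothness and, read backwards at all
  points, the contact property of the difference.\<close>

lemma decomposition:
  assumes Z: "Z \<in> Vect A"
  shows "\<exists>V\<in>CV. vf_diff Z V \<in> TV"
proof -
  define Q where "Q p T' \<longleftrightarrow> T' \<in> TV \<and> (\<forall>T\<in>TV. tangent_to_contact p (bracket A (vf_diff Z T') T p))" for p T'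
  have "\<exists>T'. Q p T'" for p
  proof -
    obtain W \<alpha> c where \<alpha>: "is_contact_form W \<alpha>" "p \<in> W" and c: "c \<in> charts_at A p"
      using ex_contact_form ex_chart by blast
    have "covec_app (\<alpha> p c) (tangent_part Z c \<alpha> p) = 0"
      unfolding tangent_part_def by (rule kernel_solution(1)[OF nondegenerate_contact_form[OF \<alpha> c]])
    then obtain T' where "T' \<in> TV" "T' p c = tangent_part Z c \<alpha> p" using ex_TVect_at[OF \<alpha> c] by blast
    then show ?thesis using tangent_part_iff[OF Z _ \<alpha> c] unfolding Q_def by blast
  qed
  then obtain S where S: "\<And>p. Q p (S p)" by metis
  \<comment> \<open>Diagonal values: \<open>S p\<close> is under control only at \<open>p\<close>.
    Being values of tangent fields, they already lie in the tangent space and in the kernel of every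
    contact form.\<close>
  define T0 where "T0 p = S p p" for p
  have ST: "S p \<in> TV" for p using S by (simp add: Q_def)
  have T0: "T0 p c = tangent_part Z c \<alpha> p" if "is_contact_form W \<alpha>" "p \<in> W" "c \<in> charts_at A p" for W \<alpha> p c
    using tangent_part_iff[OF Z ST that, of p] S[of p] unfolding Q_def T0_def by blast
  have "smooth_on (cmap c ` cdom c) (local_rep c T0)" if c: "c \<in> A" for c
  proof (rule smooth_on_local)
    fix y assume "y \<in> cmap c ` cdom c"
    then obtain q where q: "q \<in> cdom c" "y = cmap c q" by auto
    obtain W \<alpha> where \<alpha>: "is_contact_form W \<alpha>" "q \<in> W" using ex_contact_form by blast
    let ?S = "cmap c ` (cdom c \<inter> W)"
    have O: "open ?S" by (rule open_contact_domain[OF \<alpha>(1) c])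
    have "smooth_on ?S (local_rep c T0)"
      by (rule smooth_on_cong[OF O _ smooth_on_tangent_part[OF Z \<alpha>(1) c]])
        (use c in \<open>auto simp: charts_atI T0[OF \<alpha>(1)]\<close>)
    then show "\<exists>T. open T \<and> y \<in> T \<and> smooth_on T (local_rep c T0)" using O q \<alpha>(2) by blast
  qed
  moreover have "T0 p \<in> tangent_space A p" for p
    unfolding T0_def by (rule VectD(1)[OF TVectD(1)[OF ST]])
  ultimately have "T0 \<in> Vect A" by (simp add: Vect_def)
  moreover have "tangent_to_contact p (T0 p)" for p
    unfolding T0_def using ST[of p] by (simp add: TVect_iff)
  ultimately have T0T: "T0 \<in> TV" by (simp add: TVect_iff)
  have "vf_diff Z T0 \<in> CV"
  proof (rule CVectI)
    show V: "vf_diff Z T0 \<in> Vect A" by (rule vf_diff_in_Vect[OF Z TVectD(1)[OF T0T]])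
    fix T assume T: "T \<in> TV"
    have "tangent_to_contact p (bracket A (vf_diff Z T0) T p)" for p
    proof -
      obtain W \<alpha> c where \<alpha>: "is_contact_form W \<alpha>" "p \<in> W" "c \<in> charts_at A p"
        using ex_contact_form ex_chart by blast
      show ?thesis using tangent_part_iff[OF Z T0T \<alpha>] T0[OF \<alpha>] T by blast
    qed
    then show "bracket A (vf_diff Z T0) T \<in> TV"
      using bracket_in_Vect[OF V TVectD(1)[OF T]] by (simp add: TVect_iff)
  qed
  moreover have "vf_diff Z (vf_diff Z T0) = T0" by (simp add: vf_add_def vf_minus_def)
  ultimately show ?thesis using T0T by metis
qed

section \<open>The projection onto contact fields\<close>

definition contact_part :: "('m, 'k) vfield \<Rightarrow> ('m, 'k) vfield" where
  "contact_part Z = (SOME V. V \<in> CV \<and> vf_diff Z V \<in> TV)"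

lemma contact_part:
  assumes "Z \<in> Vect A"
  shows "contact_part Z \<in> CV" "vf_diff Z (contact_part Z) \<in> TV"
  using someI_ex[of "\<lambda>V. V \<in> CV \<and> vf_diff Z V \<in> TV"] decomposition[OF assms]
  unfolding contact_part_def by blast+

text \<open>Two decompositions of \<open>Z\<close> differ by a field that is both contact and
  tangent, hence 0. So the choice in \<open>contact_part\<close> is immaterial, and any
  decomposition found by hand computes it.\<close>

lemma contact_part_eqI:
  assumes Z: "Z \<in> Vect A" and V: "V \<in> CV" "vf_diff Z V \<in> TV"
  shows "contact_part Z = V"
proof -
  note P = contact_part[OF Z]
  have "vf_diff (contact_part Z) V \<in> CV" by (intro CVect_add CVect_minus P V)
  moreover have "vf_diff (contact_part Z) V = vf_diff (vf_diff Z V) (vf_diff Z (contact_part Z))"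
    by (simp add: vf_add_def vf_minus_def)
  then have "vf_diff (contact_part Z) V \<in> TV" using TVect_add[OF V(2) TVect_minus[OF P(2)]] by simp
  ultimately have "vf_diff (contact_part Z) V = vf_zero" by (rule CVect_Int_TVect)
  then show ?thesis by (auto simp: vf_add_def vf_minus_def vf_zero_def fun_eq_iff)
qed

lemma contact_part_add:
  assumes "Y \<in> Vect A" "Z \<in> Vect A"
  shows "contact_part (vf_add Y Z) = vf_add (contact_part Y) (contact_part Z)"
proof (rule contact_part_eqI)
  have "vf_diff (vf_add Y Z) (vf_add (contact_part Y) (contact_part Z)) =
      vf_add (vf_diff Y (contact_part Y)) (vf_diff Z (contact_part Z))"
    by (simp add: vf_add_def vf_minus_def algebra_simps)
  then show "vf_diff (vf_add Y Z) (vf_add (contact_part Y) (contact_part Z)) \<in> TV"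
    using TVect_add contact_part(2) assms by simp
qed (intro vf_add_in_Vect CVect_add contact_part assms)+

lemma contact_part_scale:
  assumes "Z \<in> Vect A"
  shows "contact_part (vf_mult (\<lambda>_. r) Z) = vf_mult (\<lambda>_. r) (contact_part Z)"
proof (rule contact_part_eqI)
  have "vf_diff (vf_mult (\<lambda>_. r) Z) (vf_mult (\<lambda>_. r) (contact_part Z)) =
      vf_mult (\<lambda>_. r) (vf_diff Z (contact_part Z))"
    by (simp add: vf_add_def vf_minus_def vf_mult_def vec_eq_iff fun_eq_iff algebra_simps)
  then show "vf_diff (vf_mult (\<lambda>_. r) Z) (vf_mult (\<lambda>_. r) (contact_part Z)) \<in> TV"
    using TVect_mult[OF smooth_fun_on_const contact_part(2)[OF assms]] by simp
qed (intro vf_mult_in_Vect smooth_fun_on_const CVect_scale contact_part assms)+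

lemma contact_part_bracket:
  assumes V: "V \<in> CV" and Z: "Z \<in> Vect A"
  shows "contact_part (bracket A V Z) = bracket A V (contact_part Z)"
proof (rule contact_part_eqI)
  note V' = CVect_in_Vect[OF V] and P = contact_part[OF Z]
  show "bracket A V Z \<in> Vect A" by (rule bracket_in_Vect[OF V' Z])
  show "bracket A V (contact_part Z) \<in> CV" by (rule CVect_bracket[OF V P(1)])
  have "bracket A V (vf_diff Z (contact_part Z)) = vf_diff (bracket A V Z) (bracket A V (contact_part Z))"
    using bracket_add_right[OF V' Z vf_minus_in_Vect[OF CVect_in_Vect[OF P(1)]]]
      bracket_scale_right[OF V' CVect_in_Vect[OF P(1)], of "- 1"] by (simp add: vf_minus_eq_mult)
  then show "vf_diff (bracket A V Z) (bracket A V (contact_part Z)) \<in> TV"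
    using CVect_bracket_TVect[OF V P(2)] by simp
qed

text \<open>By the Leibniz rule both brackets are \<open>f [X, Y]\<close> up to
  \<open>- Y(f) X\<close> and \<open>X(f) Y\<close> respectively. Their difference is thus tangent,
  and tangent fields have no contact part.\<close>

lemma contact_part_bracket_balanced:
  assumes f: "smooth_fun_on A UNIV f" and X: "X \<in> TV" and Y: "Y \<in> TV"
  shows "contact_part (bracket A (vf_mult f X) Y) = contact_part (bracket A X (vf_mult f Y))"
proof -
  note X' = TVectD(1)[OF X] and Y' = TVectD(1)[OF Y]
  note fX = vf_mult_in_Vect[OF f X'] and fY = vf_mult_in_Vect[OF f Y']
  let ?L = "bracket A (vf_mult f X) Y" and ?R = "bracket A X (vf_mult f Y)"
  have L: "?L \<in> Vect A" and R: "?R \<in> Vect A" by (rule bracket_in_Vect[OF fX Y'] bracket_in_Vect[OF X' fY])+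
  note P = contact_part[OF R]
  have "vf_diff ?L ?R \<in> TV"
  proof (rule TVectI)
    show "vf_diff ?L ?R \<in> Vect A" by (rule vf_diff_in_Vect[OF L R])
    fix W \<alpha> p c assume \<alpha>: "is_contact_form W \<alpha>" "p \<in> W" and c: "c \<in> charts_at A p"
    have sk: "bracket A X Z p c = - bracket A Z X p c" for X Z
      by (subst bracket_skew) (simp add: vf_minus_def)
    show "covec_app (\<alpha> p c) (vf_diff ?L ?R p c) = 0"
      using TVectD(2)[OF X \<alpha> c] TVectD(2)[OF Y \<alpha> c] bracket_mult_left[OF f X' Y' c]
        bracket_mult_left[OF f Y' X' c] sk[of X "vf_mult f Y"] sk[of X Y]
      by (simp add: vf_add_def vf_minus_def covec_app_diff covec_app_add covec_app_minus
          covec_app_vector_scalar_mult)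
  qed
  moreover have "vf_diff ?L (contact_part ?R) = vf_add (vf_diff ?L ?R) (vf_diff ?R (contact_part ?R))"
    by (simp add: vf_add_def vf_minus_def)
  ultimately have "vf_diff ?L (contact_part ?R) \<in> TV" using TVect_add[OF _ P(2)] by simp
  then show ?thesis by (rule contact_part_eqI[OF L P(1)])
qed

text \<open>If all these contact parts vanish, every bracket of \<open>X\<close> with a tangent
  field is tangent. Then \<open>X\<close> is itself a contact field, and a field that is both
  contact and tangent is 0.\<close>

lemma contact_part_bracket_nondegenerate:
  assumes X: "X \<in> TV" and "X \<noteq> vf_zero"
  shows "\<exists>Y\<in>TV. contact_part (bracket A X Y) \<noteq> vf_zero"
proof (rule ccontr)
  assume "\<not> ?thesis"
  then have z: "contact_part (bracket A X Y) = vf_zero" if "Y \<in> TV" for Y using that by blast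
  have "bracket A X Y \<in> TV" if "Y \<in> TV" for Y
    using contact_part(2)[OF bracket_in_Vect[OF TVectD(1)[OF X] TVectD(1)[OF that]]] z[OF that]
    by (simp add: vf_add_def vf_minus_def vf_zero_def)
  then have "X \<in> CV" by (rule CVectI[OF TVectD(1)[OF X]])
  then show False using CVect_Int_TVect X assms(2) by blast
qed

end

theorem theorem4p2:
  fixes A :: "('m::{t2_space, second_countable_topology}, 'k::finite) chart set"
    and n :: nat
    and \<xi> :: "('m, 'k) distrib"
  assumes "n \<ge> 1"
    and "CARD('k) = 2 * n + 1"
    and "smooth_atlas A"
    and "contact_structure A n \<xi>"
  shows "\<exists>B :: ('m, 'k) vfield \<Rightarrow> ('m, 'k) vfield \<Rightarrow> ('m, 'k) vfield.
    (\<forall>X \<in> TVect A n \<xi>. \<forall>Y \<in> TVect A n \<xi>. B X Y \<in> CVect A n \<xi>) \<and>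
    vf_bilinear_on (TVect A n \<xi>) B \<and>
    vf_skew_on (TVect A n \<xi>) B \<and>
    vf_balanced_on A (TVect A n \<xi>) B \<and>
    vf_invariant_on A (CVect A n \<xi>) (TVect A n \<xi>) B \<and>
    vf_nondegenerate_on (TVect A n \<xi>) B"
proof -
  interpret contact_manifold A n \<xi>
    by unfold_locales (use assms in auto)
  define B where "B X Y = contact_part (bracket A X Y)" for X Y
  note TVectD(1)[intro, simp] bracket_in_Vect[intro, simp]
  have "\<forall>X\<in>TV. \<forall>Y\<in>TV. B X Y \<in> CV"
    by (simp add: B_def contact_part)
  moreover have "vf_bilinear_on TV B"
    by (simp add: vf_bilinear_on_def B_def bracket_add_left bracket_add_right contact_part_add
        bracket_scale_left bracket_scale_right contact_part_scale)
  moreover have "vf_skew_on TV B"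
    unfolding vf_skew_on_def B_def
  proof (intro ballI)
    fix X Y assume "X \<in> TV" "Y \<in> TV"
    then show "contact_part (bracket A X Y) = vf_minus (contact_part (bracket A Y X))"
      by (subst bracket_skew) (simp add: vf_minus_eq_mult contact_part_scale)
  qed
  moreover have "vf_balanced_on A TV B"
    unfolding vf_balanced_on_def B_def using contact_part_bracket_balanced by blast
  moreover have "vf_invariant_on A CV TV B"
    unfolding vf_invariant_on_def B_def
  proof (intro ballI)
    fix V X Y assume V: "V \<in> CV" and XY: "X \<in> TV" "Y \<in> TV"
    note V' = CVect_in_Vect[OF V]
    show "bracket A V (contact_part (bracket A X Y)) =
        vf_add (contact_part (bracket A (bracket A V X) Y)) (contact_part (bracket A X (bracket A V Y)))"
      using XY V' by (simp add: contact_part_bracket[OF V, symmetric] jacobi_identity[OF V'] contact_part_add)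
  qed
  moreover have "vf_nondegenerate_on TV B"
    by (simp add: vf_nondegenerate_on_def B_def contact_part_bracket_nondegenerate)
  ultimately show ?thesis by blast
qed

end
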